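(* Let $q$ be a fixed prime power. The $n\to\infty$ limit of the probability that a uniformly random element of $GL(n,q)$ is regular-semisimple is $$1-\frac{1}{q}.$$
   Context: $GL(n,q)$ is the group of invertible $n\times n$ matrices over the finite field $F_q$, and $\overline{F_q}$ is an algebraic closure of $F_q$. An element $\alpha\in GL(n,q)\subset GL(n,\overline{F_q})$ is regular if the dimension of its centralizer in the algebraic group $GL(n,\overline{F_q})$ is as small as possible (namely $n$, the rank of the group). It is semisimple if it is diagonalizable over $\overline{F_q}$, and regular-semisimple if it is both regular and semisimple. *)

theory Defs
  imports
    "HOL-Probability.Probability"
    "HOL-Number_Theory.Prime_Powers"
    "HOL-Algebra.Algebraic_Closure_Type"
    "Jordan_Normal_Form.Matrix"
begin

definition GL :: "nat \<Rightarrow> 'a :: field mat set" where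
  "GL n = {A \<in> carrier_mat n n. invertible_mat A}"

lemma one_mat_in_GL: "1\<^sub>m n \<in> GL n"
  by (auto simp: GL_def invertible_mat_def inverts_mat_def intro!: exI[of _ "1\<^sub>m n"])

lemma finite_GL: "finite (GL n :: 'a :: {field, finite} mat set)"
proof -
  have "A \<in> mat n n ` ({..<n} \<times> {..<n} \<rightarrow>\<^sub>E UNIV)" if "A \<in> GL n" for A :: "'a mat"
  proof
    show "A = mat n n (\<lambda>p\<in>{..<n} \<times> {..<n}. A $$ p)"
      using that by (intro eq_matI) (auto simp: GL_def)
    show "(\<lambda>p\<in>{..<n} \<times> {..<n}. A $$ p) \<in> {..<n} \<times> {..<n} \<rightarrow>\<^sub>E UNIV"
      by (simp add: PiE_def)
  qed
  then have "(GL n :: 'a mat set) \<subseteq> mat n n ` ({..<n} \<times> {..<n} \<rightarrow>\<^sub>E UNIV)"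
    by blast
  moreover have "finite ({..<n} \<times> {..<n} \<rightarrow>\<^sub>E (UNIV :: 'a set))"
    by (intro finite_PiE) simp_all
  ultimately show ?thesis
    by (meson finite_imageI finite_subset)
qed

definition GL_centralizer :: "nat \<Rightarrow> 'a :: field mat \<Rightarrow> 'a mat set" where
  "GL_centralizer n A = {B \<in> GL n. A * B = B * A}"

text \<open>
  Functions on $n \times n$ matrices that are polynomial in the matrix entries. Only their values
  on \<^term>\<open>carrier_mat n n\<close> matter.
\<close>

inductive_set mat_poly_funs :: "nat \<Rightarrow> ('a :: field mat \<Rightarrow> 'a) set" for n :: nat where
  const: "(\<lambda>_. c) \<in> mat_poly_funs n"
| entry: "i < n \<Longrightarrow> j < n \<Longrightarrow> (\<lambda>A. A $$ (i, j)) \<in> mat_poly_funs n"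
| add: "f \<in> mat_poly_funs n \<Longrightarrow> g \<in> mat_poly_funs n \<Longrightarrow> (\<lambda>A. f A + g A) \<in> mat_poly_funs n"
| mult: "f \<in> mat_poly_funs n \<Longrightarrow> g \<in> mat_poly_funs n \<Longrightarrow> (\<lambda>A. f A * g A) \<in> mat_poly_funs n"

definition zariski_open :: "nat \<Rightarrow> 'a :: field mat set \<Rightarrow> bool" where
  "zariski_open n U \<longleftrightarrow>
     (\<exists>F \<subseteq> mat_poly_funs n. U = {A \<in> carrier_mat n n. \<exists>f\<in>F. f A \<noteq> 0})"

definition zariski :: "nat \<Rightarrow> 'a :: field mat topology" where
  "zariski n = topology (zariski_open n)"

lemma istopology_zariski_open: "istopology (zariski_open n :: 'a :: field mat set \<Rightarrow> bool)"
  unfolding istopology_def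
proof (intro conjI allI impI)
  fix S T :: "'a mat set"
  assume "zariski_open n S" "zariski_open n T"
  then obtain F G where
    F: "F \<subseteq> mat_poly_funs n" "S = {A \<in> carrier_mat n n. \<exists>f\<in>F. f A \<noteq> 0}" and
    G: "G \<subseteq> mat_poly_funs n" "T = {A \<in> carrier_mat n n. \<exists>f\<in>G. f A \<noteq> 0}"
    unfolding zariski_open_def by blast
  define H where "H = (\<lambda>(f, g) A. f A * g A) ` (F \<times> G)"
  have "H \<subseteq> mat_poly_funs n"
    using F(1) G(1) by (auto simp: H_def intro!: mat_poly_funs.mult)
  moreover have "S \<inter> T = {A \<in> carrier_mat n n. \<exists>f\<in>H. f A \<noteq> 0}"
    unfolding F(2) G(2) H_def by auto
  ultimately show "zariski_open n (S \<inter> T)"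
    unfolding zariski_open_def by blast
next
  fix K :: "'a mat set set"
  assume "\<forall>S\<in>K. zariski_open n S"
  then have "\<forall>S\<in>K. \<exists>F. F \<subseteq> mat_poly_funs n \<and> S = {A \<in> carrier_mat n n. \<exists>f\<in>F. f A \<noteq> 0}"
    unfolding zariski_open_def .
  from bchoice[OF this] obtain F where
    F: "\<forall>S\<in>K. F S \<subseteq> mat_poly_funs n \<and> S = {A \<in> carrier_mat n n. \<exists>f\<in>F S. f A \<noteq> 0}" ..
  have S_iff: "A \<in> S \<longleftrightarrow> A \<in> carrier_mat n n \<and> (\<exists>f\<in>F S. f A \<noteq> 0)" if "S \<in> K" for S A
  proof -
    have "S = {A \<in> carrier_mat n n. \<exists>f\<in>F S. f A \<noteq> 0}"
      using bspec[OF F that] by (rule conjunct2)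
    from arg_cong[OF this, of "(\<in>) A"] show ?thesis
      by simp
  qed
  have "(\<Union>S\<in>K. F S) \<subseteq> mat_poly_funs n"
    by (rule UN_least) (rule conjunct1[OF bspec[OF F]])
  moreover have "\<Union>K = {A \<in> carrier_mat n n. \<exists>f\<in>(\<Union>S\<in>K. F S). f A \<noteq> 0}"
  proof (rule Set.set_eqI)
    fix A
    have "A \<in> \<Union>K \<longleftrightarrow> (\<exists>S\<in>K. A \<in> carrier_mat n n \<and> (\<exists>f\<in>F S. f A \<noteq> 0))"
      unfolding Union_iff by (rule bex_cong[OF refl S_iff])
    also have "\<dots> \<longleftrightarrow> A \<in> {A \<in> carrier_mat n n. \<exists>f\<in>(\<Union>S\<in>K. F S). f A \<noteq> 0}"
      by blast
    finally show "A \<in> \<Union>K \<longleftrightarrow> A \<in> {A \<in> carrier_mat n n. \<exists>f\<in>(\<Union>S\<in>K. F S). f A \<noteq> 0}" .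
  qed
  ultimately show "zariski_open n (\<Union>K)"
    unfolding zariski_open_def by (intro exI[of _ "\<Union>S\<in>K. F S"] conjI)
qed

lemma openin_zariski: "openin (zariski n) = zariski_open n"
  by (simp add: zariski_def istopology_zariski_open)

lemma topspace_zariski: "topspace (zariski n) = carrier_mat n n"
proof -
  have "zariski_open n (carrier_mat n n :: 'a mat set)"
    unfolding zariski_open_def by (rule exI[of _ "{\<lambda>_. 1}"]) (auto intro: mat_poly_funs.const)
  moreover have "U \<subseteq> carrier_mat n n" if "zariski_open n U" for U :: "'a mat set"
    using that by (auto simp: zariski_open_def)
  ultimately show ?thesis
    unfolding topspace_def openin_zariski by blast
qed

definition irreducible_closedin :: "'a topology \<Rightarrow> 'a set \<Rightarrow> bool" where
  "irreducible_closedin T S \<longleftrightarrow>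
     closedin T S \<and> S \<noteq> {} \<and>
     (\<forall>C D. closedin T C \<longrightarrow> closedin T D \<longrightarrow> S \<subseteq> C \<union> D \<longrightarrow> S \<subseteq> C \<or> S \<subseteq> D)"

text \<open>
  The Krull dimension of a topological space: the supremum of the lengths $k$ of chains
  $Z_0 \subset Z_1 \subset \dots \subset Z_k$ of irreducible closed subsets. (The empty space gets
  dimension 0 here.)
\<close>

definition krull_dim :: "'a topology \<Rightarrow> enat" where
  "krull_dim T = Sup {enat k | k. \<exists>Z :: nat \<Rightarrow> 'a set.
     (\<forall>i\<le>k. irreducible_closedin T (Z i)) \<and> (\<forall>i<k. Z i \<subset> Z (Suc i))}"

definition centralizer_dim :: "nat \<Rightarrow> 'a :: alg_closed_field mat \<Rightarrow> enat" where
  "centralizer_dim n A = krull_dim (subtopology (zariski n) (GL_centralizer n A))"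

definition regular_GL :: "nat \<Rightarrow> 'a :: alg_closed_field mat \<Rightarrow> bool" where
  "regular_GL n A \<longleftrightarrow>
     A \<in> GL n \<and> (\<forall>B \<in> (GL n :: 'a mat set). centralizer_dim n A \<le> centralizer_dim n B)"

definition diagonalizable_mat :: "'a :: field mat \<Rightarrow> bool" where
  "diagonalizable_mat A \<longleftrightarrow> (\<exists>D. diagonal_mat D \<and> similar_mat A D)"

definition regular_mat :: "nat \<Rightarrow> 'a :: field mat \<Rightarrow> bool" where
  "regular_mat n A \<longleftrightarrow> regular_GL n (map_mat to_ac A)"

definition semisimple_mat :: "'a :: field mat \<Rightarrow> bool" where
  "semisimple_mat A \<longleftrightarrow> diagonalizable_mat (map_mat to_ac A)"

definition regular_semisimple_mat :: "nat \<Rightarrow> 'a :: field mat \<Rightarrow> bool" where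
  "regular_semisimple_mat n A \<longleftrightarrow> regular_mat n A \<and> semisimple_mat A"

end

theory Submission
  imports Defs "Jordan_Normal_Form.Char_Poly"
begin

text \<open>
  Over an algebraically closed field every centralizer has dimension at least \<open>n\<close>, because upper
  triangular matrices commuting with an upper triangular matrix are cut out by \<open>n\<close> fewer equations
  than unknowns; a diagonalizable matrix attains the bound iff its eigenvalues are distinct. Hence a
  matrix over \<open>F\<^sub>q\<close> is regular-semisimple iff its characteristic polynomial is a product of a finite
  set \<open>S\<close> of distinct monic irreducible polynomials (irreducible polynomials over a finite field are
  separable).

  The pairs \<open>(A, v)\<close> where \<open>v\<close> is a cyclic vector of \<open>A\<close> and \<open>A\<close> has characteristic polynomial
  \<open>\<Prod>S\<close> correspond to the elements of \<open>GL(n, q)\<close>, namely to the bases \<open>v, A v, A (A v), \<dots>\<close>.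
  Each such \<open>A\<close> has as many cyclic vectors as there are units modulo \<open>\<Prod>S\<close>, so the probability in
  question is the sum of \<open>\<Prod>p\<in>S. 1 / (q ^ degree p - 1)\<close> over all \<open>S\<close> of total degree \<open>n\<close> not
  containing the polynomial \<open>x\<close>. This is the coefficient of \<open>u ^ n\<close> in
  \<open>(1 - u / q) / (1 - u) * H(u)\<close>, where the Euler product \<open>H\<close> converges beyond the unit circle and
  \<open>H(1) = 1\<close>.
\<close>

text \<open>The dimension of a centralizer is defined by chains of irreducible closed sets, so the
  lower bound has to exhibit a chain and the upper bound has to exclude longer ones. Chains are
  found by fixing matrix entries one after the other. Longer chains are excluded by a Hilbert
  function count: they would yield more independent polynomial functions than \<open>n\<close>
  coordinates allow.

  The factor \<open>(1 - u / q) / (1 - u)\<close> is the zeta function of the affine line without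
  the origin. Unique factorization makes the product of \<open>1 - (u / q) ^ degree p\<close> over
  all monic irreducible \<open>p\<close> equal to \<open>1 - u\<close>, and omitting
  \<open>p = x\<close> divides it by \<open>1 - u / q\<close>. Multiplied by its Euler factor,
  \<open>1 + u ^ d / (q ^ d - 1)\<close> deviates from 1 only by
  \<open>(u ^ d - u ^ (2 * d)) / (q ^ d * (q ^ d - 1))\<close>; as there are at most
  \<open>q ^ d\<close> monic irreducibles of degree \<open>d\<close>, this converges for
  \<open>\<bar>u\<bar> ^ 2 < q\<close>. All Euler products are cut off at degree \<open>n\<close>,
  which leaves coefficient \<open>n\<close> unchanged, and the estimates are uniform in the
  cut-off.\<close>

unbundle no vec_syntax and no Formal_Power_Series.fps_syntax and no fps_syntax
hide_const (open) Polynomials.degree Polynomials.lead_coeff up_ring.coeff up_ring.monom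
  Divisibility.irreducible Divisibility.prime Module.smult

section \<open>Systems of linear equations\<close>

text \<open>An indexed family instead of a set of vectors. \<open>I\<close> will be a set of
  unknowns, of matrix positions or of points of a closed set, so one notion serves vectors, matrices
  and functions.\<close>

definition lin_indep :: "nat \<Rightarrow> 'i set \<Rightarrow> (nat \<Rightarrow> 'i \<Rightarrow> 'a :: field) \<Rightarrow> bool" where
  "lin_indep k I y \<longleftrightarrow> (\<forall>c. (\<forall>i\<in>I. (\<Sum>s<k. c s * y s i) = 0) \<longrightarrow> (\<forall>s<k. c s = 0))"

lemma lin_indep_cong:
  assumes "\<And>s i. s < k \<Longrightarrow> i \<in> I \<Longrightarrow> y s i = y' s i"
  shows "lin_indep k I y \<longleftrightarrow> lin_indep k I y'"
proof -
  have "(\<Sum>s<k. c s * y s i) = (\<Sum>s<k. c s * y' s i)" if "i \<in> I" for c i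
    using assms that by (intro sum.cong) auto
  then show ?thesis
    unfolding lin_indep_def by simp
qed

text \<open>One elimination step: if a linear functional takes the value \<open>b r\<close> on
  \<open>y r\<close>, subtracting multiples of a pivot vector leaves one vector fewer, all in its
  kernel. The coefficients \<open>z\<close> are returned so that the same combinations can be formed
  elsewhere.\<close>

lemma lin_indep_pivot:
  fixes y :: "nat \<Rightarrow> 'i \<Rightarrow> 'a :: field" and b :: "nat \<Rightarrow> 'a"
  assumes "lin_indep (Suc k) I y"
  obtains z :: "nat \<Rightarrow> nat \<Rightarrow> 'a" where
    "\<And>s. s < k \<Longrightarrow> (\<Sum>r<Suc k. z s r * b r) = 0"
    "lin_indep k I (\<lambda>s i. \<Sum>r<Suc k. z s r * y r i)"
proof -
  \<comment> \<open>If \<open>b\<close> vanishes, any index may be discarded; the quotient by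
    \<open>b p = 0\<close> below is then zero.\<close>
  obtain p where p: "p \<le> k" "b p = 0 \<Longrightarrow> (\<forall>r\<le>k. b r = 0)"
    by (cases "\<forall>r\<le>k. b r = 0") auto
  define \<sigma> where "\<sigma> s = (if s < p then s else Suc s)" for s
  define z where "z s r = (if r = \<sigma> s then 1 else 0) - (if r = p then b (\<sigma> s) / b p else 0)" for s r
  have \<sigma>: "\<sigma> s < Suc k" "\<sigma> s \<noteq> p" if "s < k" for s
    using that p(1) by (auto simp: \<sigma>_def)
  have inj: "\<sigma> s = \<sigma> s' \<longleftrightarrow> s = s'" for s s'
    by (auto simp: \<sigma>_def)
  have zsum: "(\<Sum>r<Suc k. z s r * g r) = g (\<sigma> s) - b (\<sigma> s) / b p * g p" if "s < k" for s and g :: "nat \<Rightarrow> 'a"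
  proof -
    have "(\<Sum>r<Suc k. z s r * g r) =
       (\<Sum>r<Suc k. (if r = \<sigma> s then g r else 0) - (if r = p then b (\<sigma> s) / b p * g r else 0))"
      by (intro sum.cong) (auto simp: z_def algebra_simps)
    also have "\<dots> = g (\<sigma> s) - b (\<sigma> s) / b p * g p"
      using \<sigma>[OF that] p(1) by (simp add: sum_subtractf)
    finally show ?thesis .
  qed
  show thesis
  proof (rule that[of z])
    fix s assume s: "s < k"
    show "(\<Sum>r<Suc k. z s r * b r) = 0"
      unfolding zsum[OF s] using p \<sigma>[OF s] by (cases "b p = 0") auto
  next
    show "lin_indep k I (\<lambda>s i. \<Sum>r<Suc k. z s r * y r i)"
      unfolding lin_indep_def
    proof (intro allI impI)
      fix c s assume c: "\<forall>i\<in>I. (\<Sum>s<k. c s * (\<Sum>r<Suc k. z s r * y r i)) = 0" and s: "s < k"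
      define d where "d r = (\<Sum>s<k. c s * z s r)" for r
      have "(\<Sum>r<Suc k. d r * y r i) = 0" if "i \<in> I" for i
      proof -
        have "(\<Sum>r<Suc k. d r * y r i) = (\<Sum>s<k. c s * (\<Sum>r<Suc k. z s r * y r i))"
          unfolding d_def sum_distrib_left sum_distrib_right
          by (subst sum.swap) (simp add: mult_ac)
        then show ?thesis using c that by simp
      qed
      then have "d (\<sigma> s) = 0"
        using assms \<sigma>(1)[OF s] unfolding lin_indep_def by blast
      \<comment> \<open>Apart from the pivot, each old vector occurs in exactly one new one, with
        coefficient 1.\<close>
      moreover have "d (\<sigma> s) = (\<Sum>s'<k. if s' = s then c s' else 0)"
        unfolding d_def by (intro sum.cong) (use \<sigma>[OF s] in \<open>auto simp: z_def inj\<close>)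
      ultimately show "c s = 0"
        using s by simp
    qed
  qed
qed

text \<open>Each new equation costs at most one solution: \<open>lin_indep_pivot\<close> is applied
  to the values of the equation on the solutions found so far. With at least as many equations as
  unknowns, truncated subtraction makes the family empty.\<close>

lemma independent_solutions:
  fixes a :: "'j \<Rightarrow> 'i \<Rightarrow> 'a :: field"
  assumes "finite J" "finite I"
  shows "\<exists>y. (\<forall>s<card I - card J. \<forall>j\<in>J. (\<Sum>i\<in>I. a j i * y s i) = 0) \<and> lin_indep (card I - card J) I y"
  using assms(1)
proof (induction J)
  case empty
  obtain e where e: "bij_betw e {..<card I} I"
    using ex_bij_betw_nat_finite[OF assms(2)] atLeast0LessThan by metis
  have "lin_indep (card I) I (\<lambda>s i. if i = e s then 1 else (0 :: 'a))"
    unfolding lin_indep_def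
  proof (intro allI impI)
    fix c :: "nat \<Rightarrow> 'a" and s
    assume c: "\<forall>i\<in>I. (\<Sum>s<card I. c s * (if i = e s then 1 else 0)) = 0" and s: "s < card I"
    then have "0 = (\<Sum>s'<card I. c s' * (if e s = e s' then 1 else 0))"
      using e by (auto simp: bij_betw_def)
    also have "\<dots> = (\<Sum>s'<card I. if s' = s then c s' else 0)"
      using e s by (intro sum.cong) (auto simp: bij_betw_def inj_on_def)
    finally show "c s = 0"
      using s by simp
  qed
  then show ?case by auto
next
  case (insert j J)
  then obtain y where y: "\<forall>s<card I - card J. \<forall>j\<in>J. (\<Sum>i\<in>I. a j i * y s i) = 0"
    "lin_indep (card I - card J) I y" by blast
  show ?case
  proof (cases "card I - card J")
    case 0
    then show ?thesis using insert by (auto simp: lin_indep_def)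
  next
    case (Suc k)
    obtain z where z: "\<And>s. s < k \<Longrightarrow> (\<Sum>r<Suc k. z s r * (\<Sum>i\<in>I. a j i * y r i)) = 0"
      "lin_indep k I (\<lambda>s i. \<Sum>r<Suc k. z s r * y r i)"
      using lin_indep_pivot[OF y(2)[unfolded Suc], of "\<lambda>r. \<Sum>i\<in>I. a j i * y r i"] by blast
    have eq: "(\<Sum>i\<in>I. a j' i * (\<Sum>r<Suc k. z s r * y r i)) = (\<Sum>r<Suc k. z s r * (\<Sum>i\<in>I. a j' i * y r i))" for j' s
      unfolding sum_distrib_left by (subst sum.swap) (simp add: mult_ac)
    have "card I - card (insert j J) = k"
      using insert Suc by simp
    moreover have "(\<Sum>i\<in>I. a j' i * (\<Sum>r<Suc k. z s r * y r i)) = 0" if "s < k" "j' \<in> insert j J" for s j'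
      unfolding eq using that z(1) y(1) Suc by (cases "j' = j") auto
    ultimately show ?thesis
      using z(2) by (intro exI[of _ "\<lambda>s i. \<Sum>r<Suc k. z s r * y r i"]) auto
  qed
qed

section \<open>Chains of irreducible sets in centralizers\<close>

lemma GL_iff_det: "(A :: 'a :: field mat) \<in> GL n \<longleftrightarrow> A \<in> carrier_mat n n \<and> det A \<noteq> 0"
proof
  assume A: "A \<in> GL n"
  then have c: "A \<in> carrier_mat n n" by (simp add: GL_def)
  from A obtain B where B: "A * B = 1\<^sub>m n" "B * A = 1\<^sub>m (dim_row B)"
    by (auto simp: GL_def invertible_mat_def inverts_mat_def)
  have "dim_col B = n" "dim_row B = n"
    using B c by (metis carrier_matD(2) index_mult_mat(3) index_one_mat(3), metis B(2) c carrier_matD(2) index_mult_mat(3) index_one_mat(3))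
  then have "B \<in> carrier_mat n n" by auto
  from det_mult[OF c this] B(1) show "A \<in> carrier_mat n n \<and> det A \<noteq> 0"
    using c by auto
next
  assume A: "A \<in> carrier_mat n n \<and> det A \<noteq> 0"
  from det_non_zero_imp_unit[of A n "()"] A obtain B where "B \<in> carrier_mat n n" "A * B = 1\<^sub>m n" "B * A = 1\<^sub>m n"
    by (auto simp: Units_def ring_mat_def)
  then show "A \<in> GL n" using A
    by (auto simp: GL_def invertible_mat_def inverts_mat_def intro!: exI[of _ B])
qed

lemma GL_inverse:
  assumes "(A :: 'a :: field mat) \<in> GL n"
  obtains B where "B \<in> carrier_mat n n" "A * B = 1\<^sub>m n" "B * A = 1\<^sub>m n"
proof -
  from assms have "A \<in> carrier_mat n n" "det A \<noteq> 0"
    by (auto simp: GL_iff_det)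
  from det_non_zero_imp_unit[OF this, of "()"] that show thesis
    by (auto simp: Units_def ring_mat_def)
qed

lemma mat_poly_funs_sum:
  "(\<And>x. x \<in> S \<Longrightarrow> f x \<in> mat_poly_funs n) \<Longrightarrow> (\<lambda>A. \<Sum>x\<in>S. f x A) \<in> mat_poly_funs n"
  by (induction S rule: infinite_finite_induct) (auto intro: mat_poly_funs.intros)

lemma mat_poly_funs_prod:
  "(\<And>x. x \<in> S \<Longrightarrow> f x \<in> mat_poly_funs n) \<Longrightarrow> (\<lambda>A. \<Prod>x\<in>S. f x A) \<in> mat_poly_funs n"
  by (induction S rule: infinite_finite_induct) (auto intro: mat_poly_funs.intros)

text \<open>\<open>det\<close> also has values on matrices of other sizes, so only agreement on
  \<open>carrier_mat n n\<close> is asked for; the Leibniz formula is the polynomial.\<close>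

lemma det_mat_poly_fun:
  obtains d where "d \<in> mat_poly_funs n" "\<And>A. A \<in> carrier_mat n n \<Longrightarrow> d A = det (A :: 'a :: field mat)"
proof
  show "(\<lambda>A. \<Sum>p | p permutes {0..<n}. signof p * (\<Prod>i = 0..<n. A $$ (i, p i))) \<in> mat_poly_funs n"
    by (intro mat_poly_funs_sum mat_poly_funs.mult mat_poly_funs.const mat_poly_funs_prod mat_poly_funs.entry)
       (auto simp: permutes_in_image[of _ "{0..<n}", unfolded atLeastLessThan_iff])
qed (simp add: det_def')

definition line :: "nat \<Rightarrow> 'a :: comm_ring_1 mat \<Rightarrow> 'a mat \<Rightarrow> 'a \<Rightarrow> 'a mat" where
  "line n M Y t = mat n n (\<lambda>p. M $$ p + t * Y $$ p)"

lemma line_carrier [simp]: "line n M Y t \<in> carrier_mat n n"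
  by (simp add: line_def)

lemma line_dim [simp]: "dim_row (line n M Y t) = n" "dim_col (line n M Y t) = n"
  by (simp_all add: line_def)

lemma line_index [simp]: "i < n \<Longrightarrow> j < n \<Longrightarrow> line n M Y t $$ (i, j) = M $$ (i, j) + t * Y $$ (i, j)"
  by (simp add: line_def)

lemma mat_poly_fun_line:
  assumes "f \<in> mat_poly_funs n"
  shows "\<exists>p. \<forall>t. f (line n M Y t) = poly p t"
  using assms
proof induction
  case (const c)
  show ?case by (intro exI[of _ "[:c:]"]) simp
next
  case (entry i j)
  then show ?case by (intro exI[of _ "[:M $$ (i, j), Y $$ (i, j):]"]) simp
next
  case (add f g)
  then show ?case by (metis poly_add)
next
  case (mult f g)
  then show ?case by (metis poly_mult)
qed

lemma commute_iff:
  assumes "A \<in> carrier_mat n n" "M \<in> carrier_mat n n"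
  shows "A * M = M * A \<longleftrightarrow>
    (\<forall>i<n. \<forall>j<n. (\<Sum>k<n. A $$ (i, k) * M $$ (k, j)) = (\<Sum>k<n. M $$ (i, k) * A $$ (k, j)))"
proof -
  have "A * M = M * A \<longleftrightarrow> (\<forall>i<n. \<forall>j<n. (A * M) $$ (i, j) = (M * A) $$ (i, j))"
    using assms by (intro iffI eq_matI) simp_all
  then show ?thesis
    using assms by (simp add: scalar_prod_def lessThan_atLeast0)
qed

lemma commute_line:
  assumes "A \<in> carrier_mat n n" "M \<in> carrier_mat n n" "Y \<in> carrier_mat n n"
    "A * M = M * A" "A * Y = Y * A"
  shows "A * line n M Y t = line n M Y t * A"
proof -
  have "(\<Sum>k<n. A $$ (i, k) * M $$ (k, j)) + t * (\<Sum>k<n. A $$ (i, k) * Y $$ (k, j)) =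
     (\<Sum>k<n. M $$ (i, k) * A $$ (k, j)) + t * (\<Sum>k<n. Y $$ (i, k) * A $$ (k, j))" if "i < n" "j < n" for i j
    using assms(4,5) that commute_iff[OF assms(1,2)] commute_iff[OF assms(1,3)] by simp
  then show ?thesis
    using assms(1) by (subst commute_iff[of _ n]) (auto simp: algebra_simps sum.distrib sum_distrib_left)
qed

lemma closedin_zariski_iff:
  "closedin (zariski n) C \<longleftrightarrow>
    (\<exists>F \<subseteq> mat_poly_funs n. C = {A \<in> carrier_mat n n. \<forall>f\<in>F. f A = 0})"
proof
  assume "closedin (zariski n) C"
  then have C: "C \<subseteq> carrier_mat n n" "zariski_open n (carrier_mat n n - C)"
    by (auto simp: closedin_def topspace_zariski openin_zariski)
  then obtain F where F: "F \<subseteq> mat_poly_funs n" "carrier_mat n n - C = {A \<in> carrier_mat n n. \<exists>f\<in>F. f A \<noteq> 0}"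
    unfolding zariski_open_def by blast
  then have "C = {A \<in> carrier_mat n n. \<forall>f\<in>F. f A = 0}"
    using C(1) by blast
  with F(1) show "\<exists>F \<subseteq> mat_poly_funs n. C = {A \<in> carrier_mat n n. \<forall>f\<in>F. f A = 0}" by blast
next
  assume "\<exists>F \<subseteq> mat_poly_funs n. C = {A \<in> carrier_mat n n. \<forall>f\<in>F. f A = 0}"
  then obtain F where F: "F \<subseteq> mat_poly_funs n" "C = {A \<in> carrier_mat n n. \<forall>f\<in>F. f A = 0}" by blast
  then have "carrier_mat n n - C = {A \<in> carrier_mat n n. \<exists>f\<in>F. f A \<noteq> 0}" by blast
  with F show "closedin (zariski n) C"
    unfolding closedin_def topspace_zariski openin_zariski zariski_open_def by blast
qed

lemma closedin_subtopology_zariski_iff: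
  assumes "M \<subseteq> carrier_mat n n"
  shows "closedin (subtopology (zariski n) M) C \<longleftrightarrow>
    (\<exists>F \<subseteq> mat_poly_funs n. C = {A \<in> M. \<forall>f\<in>F. f A = 0})"
proof -
  have *: "{A \<in> carrier_mat n n. \<forall>f\<in>F. f A = 0} \<inter> M = {A \<in> M. \<forall>f\<in>F. f A = 0}" for F :: "('a mat \<Rightarrow> 'a) set"
    using assms by blast
  show ?thesis
    unfolding closedin_subtopology closedin_zariski_iff by (metis (no_types, lifting) *)
qed

lemma GL_centralizer_carrier: "GL_centralizer n A \<subseteq> carrier_mat n n"
  by (auto simp: GL_centralizer_def GL_def)

context
  fixes A :: "'a :: field mat" and n :: nat
  assumes A: "A \<in> carrier_mat n n" and inf: "infinite (UNIV :: 'a set)"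
begin

text \<open>
  Slices through the identity are irreducible: a polynomial function restricted to the line through two
  points of a slice is a univariate polynomial, and over an infinite field a product of nonzero
  polynomials has a non-root.
\<close>

definition slice :: "(nat \<times> nat) set \<Rightarrow> 'a mat set" where
  "slice E = {M \<in> GL_centralizer n A. \<forall>p\<in>E. M $$ p = 1\<^sub>m n $$ p}"

lemma irreducible_slice:
  assumes E: "E \<subseteq> {..<n} \<times> {..<n}"
  shows "irreducible_closedin (subtopology (zariski n) (GL_centralizer n A)) (slice E)"
proof -
  note iff = closedin_subtopology_zariski_iff[OF GL_centralizer_carrier, of n A]
  have "closedin (subtopology (zariski n) (GL_centralizer n A)) (slice E)"
    unfolding iff
  proof (intro exI[of _ "(\<lambda>p M. M $$ p + - 1\<^sub>m n $$ p) ` E"] conjI)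
    show "(\<lambda>p M. M $$ p + - 1\<^sub>m n $$ p) ` E \<subseteq> mat_poly_funs n"
      using E by (auto simp del: add_uminus_conv_diff intro!: mat_poly_funs.intros)
    show "slice E = {M \<in> GL_centralizer n A. \<forall>f\<in>(\<lambda>p M. M $$ p + - 1\<^sub>m n $$ p) ` E. f M = 0}"
      unfolding slice_def by simp
  qed
  moreover have "1\<^sub>m n \<in> slice E"
    using A by (auto simp: slice_def GL_centralizer_def one_mat_in_GL)
  moreover have "slice E \<subseteq> C \<or> slice E \<subseteq> D"
    if C: "closedin (subtopology (zariski n) (GL_centralizer n A)) C"
      and D: "closedin (subtopology (zariski n) (GL_centralizer n A)) D"
      and CD: "slice E \<subseteq> C \<union> D" for C D
  proof (rule ccontr)
    assume "\<not> (slice E \<subseteq> C \<or> slice E \<subseteq> D)"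
    then obtain x y where x: "x \<in> slice E" "x \<notin> C" and y: "y \<in> slice E" "y \<notin> D" by blast
    obtain F where F: "F \<subseteq> mat_poly_funs n" "C = {B \<in> GL_centralizer n A. \<forall>f\<in>F. f B = 0}"
      using iffD1[OF iff C] by (elim exE conjE)
    obtain G where G: "G \<subseteq> mat_poly_funs n" "D = {B \<in> GL_centralizer n A. \<forall>f\<in>G. f B = 0}"
      using iffD1[OF iff D] by (elim exE conjE)
    from x F obtain f where f: "f \<in> F" "f x \<noteq> 0" by (auto simp: slice_def)
    from y G obtain g where g: "g \<in> G" "g y \<noteq> 0" by (auto simp: slice_def)
    obtain d where d: "d \<in> mat_poly_funs n" "\<And>A. A \<in> carrier_mat n n \<Longrightarrow> d A = det (A :: 'a mat)"
      using det_mat_poly_fun by blast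
    have xc: "x \<in> carrier_mat n n" "A * x = x * A" and yc: "y \<in> carrier_mat n n" "A * y = y * A"
      and detx: "det x \<noteq> 0"
      using x(1) y(1) by (auto simp: slice_def GL_centralizer_def GL_iff_det)
    \<comment> \<open>The line \<open>x + t * (y - x)\<close>. Commuting with \<open>A\<close> and
      having the fixed entries are linear conditions and hold along it; \<open>f\<close>,
      \<open>g\<close> and \<open>det\<close> are each nonzero at some point of it, hence all at a
      common one.\<close>
    define l where "l = line n x (line n y x (-1))"
    have l0: "l 0 = x" and l1: "l 1 = y"
      using xc yc by (auto simp: l_def intro!: eq_matI)
    obtain pf where pf: "\<And>t. f (l t) = poly pf t"
      using mat_poly_fun_line f(1) F(1) unfolding l_def by blast
    obtain pg where pg: "\<And>t. g (l t) = poly pg t"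
      using mat_poly_fun_line g(1) G(1) unfolding l_def by blast
    obtain pd where pd: "\<And>t. d (l t) = poly pd t"
      using mat_poly_fun_line d(1) unfolding l_def by blast
    have "pf \<noteq> 0" "pg \<noteq> 0" "pd \<noteq> 0"
      using pf[of 0] pg[of 1] pd[of 0] l0 l1 f g detx d(2)[OF xc(1)] by auto
    then have "finite {t. poly (pf * pg * pd) t = 0}"
      by (intro poly_roots_finite) simp
    then obtain t where "poly (pf * pg * pd) t \<noteq> 0"
      using ex_new_if_finite[OF inf] by blast
    then have t: "f (l t) \<noteq> 0" "g (l t) \<noteq> 0" "det (l t) \<noteq> 0"
      using pf pg pd d(2)[of "l t"] by (auto simp: l_def)
    have "A * l t = l t * A"
      unfolding l_def using A xc yc by (intro commute_line) auto
    then have "l t \<in> GL_centralizer n A"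
      using t(3) by (auto simp: GL_centralizer_def GL_iff_det l_def)
    moreover have "l t $$ p = 1\<^sub>m n $$ p" if "p \<in> E" for p
    proof -
      obtain i j where p: "p = (i, j)" "i < n" "j < n"
        using E \<open>p \<in> E\<close> by auto
      have "x $$ p = 1\<^sub>m n $$ p" "y $$ p = 1\<^sub>m n $$ p"
        using x(1) y(1) \<open>p \<in> E\<close> by (auto simp: slice_def)
      then show ?thesis
        using p by (simp add: l_def)
    qed
    ultimately have "l t \<in> slice E"
      by (auto simp: slice_def)
    with CD F(2) G(2) f(1) g(1) t show False by blast
  qed
  ultimately show ?thesis
    unfolding irreducible_closedin_def by blast
qed

text \<open>Induction on the number of directions. An entry where \<open>V 0\<close> is nonzero is
  fixed as well; pivoting on that entry leaves \<open>m\<close> directions that vanish there, and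
  the chain they give ends in the new slice. It lies properly in the old one, which contains an
  invertible \<open>1 + t * V 0\<close> with a different entry at that position.\<close>

lemma slice_chain:
  fixes V :: "nat \<Rightarrow> 'a mat"
  assumes "E \<subseteq> {..<n} \<times> {..<n}"
    "\<And>s. s < m \<Longrightarrow> V s \<in> carrier_mat n n \<and> A * V s = V s * A \<and> (\<forall>p\<in>E. V s $$ p = 0)"
    "lin_indep m ({..<n} \<times> {..<n}) (\<lambda>s p. V s $$ p)"
  shows "\<exists>Z. (\<forall>i\<le>m. irreducible_closedin (subtopology (zariski n) (GL_centralizer n A)) (Z i)) \<and>
    (\<forall>i<m. Z i \<subset> Z (Suc i)) \<and> Z m = slice E"
  using assms
proof (induction m arbitrary: E V)
  case 0
  then show ?case
    using irreducible_slice by (intro exI[of _ "\<lambda>_. slice E"]) auto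
next
  case (Suc m)
  have V: "V s \<in> carrier_mat n n" "A * V s = V s * A" "\<forall>p\<in>E. V s $$ p = 0" if "s < Suc m" for s
    using Suc.prems(2)[OF that] by auto
  have "\<exists>i<n. \<exists>j<n. V 0 $$ (i, j) \<noteq> 0"
  proof (rule ccontr)
    assume "\<not> ?thesis"
    then have "\<forall>p\<in>{..<n} \<times> {..<n}. (\<Sum>s<Suc m. (if s = 0 then 1 else 0) * V s $$ p) = 0"
      by (auto intro!: sum.neutral)
    then have "\<forall>s<Suc m. (if s = 0 then 1 else 0) = (0 :: 'a)"
      using Suc.prems(3)[unfolded lin_indep_def, rule_format, of "\<lambda>s. if s = 0 then 1 else 0"] by blast
    then show False by auto
  qed
  then obtain i0 j0 where ij: "i0 < n" "j0 < n" "V 0 $$ (i0, j0) \<noteq> 0" by blast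
  define E' where "E' = insert (i0, j0) E"
  obtain z where z: "\<And>s. s < m \<Longrightarrow> (\<Sum>r<Suc m. z s r * V r $$ (i0, j0)) = 0"
    "lin_indep m ({..<n} \<times> {..<n}) (\<lambda>s p. \<Sum>r<Suc m. z s r * V r $$ p)"
    using lin_indep_pivot[OF Suc.prems(3), of "\<lambda>r. V r $$ (i0, j0)"] by blast
  define W where "W s = mat n n (\<lambda>p. \<Sum>r<Suc m. z s r * V r $$ p)" for s
  have W: "W s \<in> carrier_mat n n" "A * W s = W s * A" for s
  proof -
    show c: "W s \<in> carrier_mat n n" by (simp add: W_def)
    have "(\<Sum>k<n. A $$ (i, k) * W s $$ (k, j)) = (\<Sum>k<n. W s $$ (i, k) * A $$ (k, j))" if "i < n" "j < n" for i j
    proof -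
      have "(\<Sum>k<n. A $$ (i, k) * W s $$ (k, j)) = (\<Sum>r<Suc m. z s r * (\<Sum>k<n. A $$ (i, k) * V r $$ (k, j)))"
        unfolding sum_distrib_left using that
        by (subst sum.swap) (auto simp: W_def sum_distrib_left mult_ac simp del: sum.lessThan_Suc intro!: sum.cong)
      also have "\<dots> = (\<Sum>r<Suc m. z s r * (\<Sum>k<n. V r $$ (i, k) * A $$ (k, j)))"
        using V commute_iff[OF A] that by (intro sum.cong) auto
      also have "\<dots> = (\<Sum>k<n. W s $$ (i, k) * A $$ (k, j))"
        unfolding sum_distrib_left using that
        by (subst sum.swap) (auto simp: W_def sum_distrib_left sum_distrib_right mult_ac simp del: sum.lessThan_Suc intro!: sum.cong)
      finally show ?thesis .
    qed
    then show "A * W s = W s * A"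
      using commute_iff[OF A c] by blast
  qed
  have E': "E' \<subseteq> {..<n} \<times> {..<n}"
    using Suc.prems(1) ij by (auto simp: E'_def)
  have "\<exists>Z. (\<forall>i\<le>m. irreducible_closedin (subtopology (zariski n) (GL_centralizer n A)) (Z i)) \<and>
    (\<forall>i<m. Z i \<subset> Z (Suc i)) \<and> Z m = slice E'"
  proof (rule Suc.IH[OF E', of W])
    fix s assume s: "s < m"
    have "W s $$ p = 0" if "p \<in> E'" for p
    proof -
      have "p \<in> {..<n} \<times> {..<n}" using E' that by blast
      then have "W s $$ p = (\<Sum>r<Suc m. z s r * V r $$ p)"
        by (auto simp: W_def)
      also have "\<dots> = 0"
      proof (cases "p = (i0, j0)")
        case True
        with z(1)[OF s] show ?thesis by simp
      next
        case False
        with that V(3) show ?thesis by (intro sum.neutral) (auto simp: E'_def)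
      qed
      finally show ?thesis .
    qed
    then show "W s \<in> carrier_mat n n \<and> A * W s = W s * A \<and> (\<forall>p\<in>E'. W s $$ p = 0)"
      using W by auto
  next
    show "lin_indep m ({..<n} \<times> {..<n}) (\<lambda>s p. W s $$ p)"
      using z(2) by (rule iffD1[OF lin_indep_cong, rotated]) (auto simp: W_def)
  qed
  then obtain Z where Z: "\<forall>i\<le>m. irreducible_closedin (subtopology (zariski n) (GL_centralizer n A)) (Z i)"
    "\<forall>i<m. Z i \<subset> Z (Suc i)" "Z m = slice E'" by blast
  have "slice E' \<subset> slice E"
  proof -
    obtain d where d: "d \<in> mat_poly_funs n" "\<And>A. A \<in> carrier_mat n n \<Longrightarrow> d A = det (A :: 'a mat)"
      using det_mat_poly_fun by blast
    obtain pd where pd: "\<And>t. d (line n (1\<^sub>m n) (V 0) t) = poly pd t"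
      using mat_poly_fun_line d(1) by blast
    have "line n (1\<^sub>m n) (V 0) 0 = 1\<^sub>m n"
      by (auto intro!: eq_matI simp: line_def)
    then have "pd \<noteq> 0"
      using pd[of 0] d(2)[of "1\<^sub>m n"] by auto
    \<comment> \<open>The factor \<open>[:0, 1:]\<close> excludes \<open>t = 0\<close>, which would
      give the identity itself.\<close>
    then have "finite {t. poly (pd * [:0, 1:]) t = 0}"
      by (intro poly_roots_finite) simp
    then obtain t where "poly (pd * [:0, 1:]) t \<noteq> 0"
      using ex_new_if_finite[OF inf] by blast
    then have t: "t \<noteq> 0" "det (line n (1\<^sub>m n) (V 0) t) \<noteq> 0"
      using pd d(2)[of "line n (1\<^sub>m n) (V 0) t"] by auto
    have "A * line n (1\<^sub>m n) (V 0) t = line n (1\<^sub>m n) (V 0) t * A"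
      using A V[of 0] by (intro commute_line) auto
    then have "line n (1\<^sub>m n) (V 0) t \<in> slice E"
      using t V(3)[of 0] Suc.prems(1) by (auto simp: slice_def GL_centralizer_def GL_iff_det)
    moreover have "line n (1\<^sub>m n) (V 0) t \<notin> slice E'"
      using t ij by (auto simp: slice_def E'_def)
    moreover have "slice E' \<subseteq> slice E"
      by (auto simp: slice_def E'_def)
    ultimately show ?thesis by blast
  qed
  then have "(if i \<le> m then Z i else slice E) \<subset> (if Suc i \<le> m then Z (Suc i) else slice E)" if "i < Suc m" for i
    using that Z(2,3) by (cases "i = m") auto
  then show ?case
    using Z(1) irreducible_slice[OF Suc.prems(1)]
    by (intro exI[of _ "\<lambda>i. if i \<le> m then Z i else slice E"]) simp
qed

text \<open>Invertibility is an open condition, so the dimension of the centralizer is at least that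
  of the linear space of all matrices commuting with \<open>A\<close>.\<close>

lemma krull_dim_GL_centralizer_ge:
  fixes V :: "nat \<Rightarrow> 'a mat"
  assumes "\<And>s. s < m \<Longrightarrow> V s \<in> carrier_mat n n \<and> A * V s = V s * A"
    "lin_indep m ({..<n} \<times> {..<n}) (\<lambda>s p. V s $$ p)"
  shows "enat m \<le> krull_dim (subtopology (zariski n) (GL_centralizer n A))"
proof -
  have "\<exists>Z. (\<forall>i\<le>m. irreducible_closedin (subtopology (zariski n) (GL_centralizer n A)) (Z i)) \<and>
    (\<forall>i<m. Z i \<subset> Z (Suc i)) \<and> Z m = slice {}"
    using assms by (intro slice_chain[of "{}" m V]) auto
  then show ?thesis
    unfolding krull_dim_def by (intro Sup_upper) blast
qed

end

section \<open>An upper bound for the Krull dimension\<close>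

text \<open>A polynomial of degree \<open>n + 1\<close> in \<open>m\<close> outgrows one of degree
  \<open>n\<close>. With \<open>k = Suc n\<close> and \<open>m = k * M\<close> the standard lower
  bound for the binomial coefficient is exactly \<open>(M + 1) ^ k\<close>, and
  \<open>M = C ^ n\<close> absorbs the constant.\<close>

lemma binomial_gt_power:
  obtains m where "(c * m + 1) ^ n < (m + Suc n) choose (Suc n)"
proof -
  define k where "k = Suc n"
  define C where "C = c * k + 1"
  define M where "M = C ^ n"
  have "real ((c * (k * M) + 1) ^ n) \<le> real ((C * (M + 1)) ^ n)"
    unfolding of_nat_le_iff by (intro power_mono) (auto simp: C_def algebra_simps)
  also have "\<dots> = real M * real (M + 1) ^ n"
    by (simp only: M_def power_mult_distrib of_nat_mult of_nat_power)
  also have "\<dots> < real (M + 1) * real (M + 1) ^ n"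
    by (intro mult_strict_right_mono) auto
  also have "\<dots> = (real (k * M + k) / real k) ^ k"
  proof -
    have "real (k * M + k) / real k = real (M + 1)"
      by (simp add: k_def field_simps)
    then show ?thesis
      by (simp only: k_def power_Suc)
  qed
  also have "\<dots> \<le> real ((k * M + k) choose k)"
    by (rule binomial_ge_n_over_k_pow_k) simp
  finally show thesis
    using that[of "k * M"] by (simp only: of_nat_less_iff k_def)
qed

section \<open>Polynomials in finitely many coordinate functions\<close>

locale coordinates =
  fixes S :: "'b set" and n :: nat and t :: "nat \<Rightarrow> 'b \<Rightarrow> 'a :: field"
begin

definition monom_fun :: "(nat \<Rightarrow> nat) \<Rightarrow> 'b \<Rightarrow> 'a" where
  "monom_fun \<alpha> x = (\<Prod>k<n. t k x ^ \<alpha> k)"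

text \<open>The degree is bounded in each coordinate separately, so that the number of exponents is
  a plain power; extensional functions make the set finite.\<close>

definition expos :: "nat \<Rightarrow> (nat \<Rightarrow> nat) set" where
  "expos d = {..<n} \<rightarrow>\<^sub>E {..d}"

text \<open>The representation is required on \<open>S\<close> only and need not be unique, so
  relations between the coordinates do no harm.\<close>

definition poly_upto :: "nat \<Rightarrow> ('b \<Rightarrow> 'a) set" where
  "poly_upto d = {f. \<exists>c. \<forall>x\<in>S. f x = (\<Sum>\<alpha>\<in>expos d. c \<alpha> * monom_fun \<alpha> x)}"

lemma finite_expos [simp]: "finite (expos d)"
  and card_expos: "card (expos d) = (d + 1) ^ n"
  by (simp_all add: expos_def finite_PiE card_PiE)

lemma poly_upto_cong: "f \<in> poly_upto d \<Longrightarrow> (\<And>x. x \<in> S \<Longrightarrow> f x = g x) \<Longrightarrow> g \<in> poly_upto d"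
  by (simp add: poly_upto_def)

lemma poly_upto_add:
  assumes "f \<in> poly_upto d" "g \<in> poly_upto d"
  shows "(\<lambda>x. f x + g x) \<in> poly_upto d"
proof -
  obtain c c' where "\<forall>x\<in>S. f x = (\<Sum>\<alpha>\<in>expos d. c \<alpha> * monom_fun \<alpha> x)"
    "\<forall>x\<in>S. g x = (\<Sum>\<alpha>\<in>expos d. c' \<alpha> * monom_fun \<alpha> x)"
    using assms unfolding poly_upto_def by blast
  then show ?thesis
    unfolding poly_upto_def by (auto simp: distrib_right sum.distrib intro!: exI[of _ "\<lambda>\<alpha>. c \<alpha> + c' \<alpha>"])
qed

lemma poly_upto_cmult:
  assumes "f \<in> poly_upto d"
  shows "(\<lambda>x. c * f x) \<in> poly_upto d"
proof -
  obtain c' where "\<forall>x\<in>S. f x = (\<Sum>\<alpha>\<in>expos d. c' \<alpha> * monom_fun \<alpha> x)"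
    using assms unfolding poly_upto_def by blast
  then show ?thesis
    unfolding poly_upto_def by (auto simp: sum_distrib_left mult.assoc intro!: exI[of _ "\<lambda>\<alpha>. c * c' \<alpha>"])
qed

lemma poly_upto_sum:
  assumes "\<And>i. i \<in> I \<Longrightarrow> f i \<in> poly_upto d"
  shows "(\<lambda>x. \<Sum>i\<in>I. f i x) \<in> poly_upto d"
proof -
  have z: "(\<lambda>x. 0) \<in> poly_upto d"
    unfolding poly_upto_def by (auto intro!: exI[of _ "\<lambda>_. 0"])
  show ?thesis
    using assms by (induction I rule: infinite_finite_induct) (auto simp: z poly_upto_add)
qed

lemma monom_fun_in_poly_upto:
  assumes "\<And>k. k < n \<Longrightarrow> \<alpha> k \<le> d"
  shows "monom_fun \<alpha> \<in> poly_upto d"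
proof -
  define \<beta> where "\<beta> = restrict \<alpha> {..<n}"
  have \<beta>: "\<beta> \<in> expos d"
    using assms by (auto simp: \<beta>_def expos_def)
  have "monom_fun \<alpha> x = (\<Sum>\<gamma>\<in>expos d. (if \<gamma> = \<beta> then 1 else 0) * monom_fun \<gamma> x)" for x
  proof -
    have "monom_fun \<alpha> x = monom_fun \<beta> x"
      unfolding monom_fun_def by (intro prod.cong) (auto simp: \<beta>_def)
    also have "\<dots> = (\<Sum>\<gamma>\<in>expos d. if \<gamma> = \<beta> then monom_fun \<gamma> x else 0)"
      using \<beta> by simp
    also have "\<dots> = (\<Sum>\<gamma>\<in>expos d. (if \<gamma> = \<beta> then 1 else 0) * monom_fun \<gamma> x)"
      by (intro sum.cong) auto
    finally show ?thesis .
  qed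
  then have "\<exists>c. \<forall>x\<in>S. monom_fun \<alpha> x = (\<Sum>\<gamma>\<in>expos d. c \<gamma> * monom_fun \<gamma> x)"
    by (intro exI[of _ "\<lambda>\<gamma>. if \<gamma> = \<beta> then 1 else 0"] ballI)
  then show ?thesis
    by (simp add: poly_upto_def)
qed

lemma poly_upto_mono:
  assumes "f \<in> poly_upto d" "d \<le> e"
  shows "f \<in> poly_upto e"
proof -
  obtain c where c: "\<forall>x\<in>S. f x = (\<Sum>\<alpha>\<in>expos d. c \<alpha> * monom_fun \<alpha> x)"
    using assms unfolding poly_upto_def by blast
  have "(\<lambda>x. \<Sum>\<alpha>\<in>expos d. c \<alpha> * monom_fun \<alpha> x) \<in> poly_upto e"
    using assms(2)
    by (intro poly_upto_sum poly_upto_cmult monom_fun_in_poly_upto) (auto simp: expos_def PiE_def Pi_def intro: order_trans)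
  then show ?thesis
    by (rule poly_upto_cong) (simp add: c)
qed

lemma poly_upto_const: "(\<lambda>x. c) \<in> poly_upto d"
proof -
  have "(\<lambda>x. c * monom_fun (\<lambda>_. 0) x) \<in> poly_upto d"
    by (intro poly_upto_cmult monom_fun_in_poly_upto) auto
  then show ?thesis
    by (simp add: monom_fun_def)
qed

lemma poly_upto_coordinate:
  assumes "k < n"
  shows "t k \<in> poly_upto 1"
proof -
  have "monom_fun (\<lambda>i. if i = k then 1 else 0) \<in> poly_upto 1"
    by (intro monom_fun_in_poly_upto) auto
  moreover have "monom_fun (\<lambda>i. if i = k then 1 else 0) x = t k x" for x
  proof -
    have "monom_fun (\<lambda>i. if i = k then 1 else 0) x = (\<Prod>i<n. if i = k then t i x else 1)"
      unfolding monom_fun_def by (intro prod.cong) auto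
    then show ?thesis using assms by simp
  qed
  ultimately show ?thesis
    by (rule poly_upto_cong)
qed

lemma poly_upto_mult:
  assumes "f \<in> poly_upto d" "g \<in> poly_upto e"
  shows "(\<lambda>x. f x * g x) \<in> poly_upto (d + e)"
proof -
  obtain c c' where c: "\<forall>x\<in>S. f x = (\<Sum>\<alpha>\<in>expos d. c \<alpha> * monom_fun \<alpha> x)"
    and c': "\<forall>x\<in>S. g x = (\<Sum>\<alpha>\<in>expos e. c' \<alpha> * monom_fun \<alpha> x)"
    using assms unfolding poly_upto_def by blast
  have "(\<lambda>x. \<Sum>\<alpha>\<in>expos d. \<Sum>\<beta>\<in>expos e. (c \<alpha> * c' \<beta>) * monom_fun (\<lambda>k. \<alpha> k + \<beta> k) x) \<in> poly_upto (d + e)"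
    by (intro poly_upto_sum poly_upto_cmult monom_fun_in_poly_upto add_mono)
      (auto simp: expos_def PiE_def Pi_def)
  moreover have "(\<Sum>\<alpha>\<in>expos d. \<Sum>\<beta>\<in>expos e. (c \<alpha> * c' \<beta>) * monom_fun (\<lambda>k. \<alpha> k + \<beta> k) x) = f x * g x"
    if "x \<in> S" for x
  proof -
    have "f x * g x = (\<Sum>\<alpha>\<in>expos d. \<Sum>\<beta>\<in>expos e. (c \<alpha> * monom_fun \<alpha> x) * (c' \<beta> * monom_fun \<beta> x))"
      using that by (simp add: c c' sum_product)
    also have "\<dots> = (\<Sum>\<alpha>\<in>expos d. \<Sum>\<beta>\<in>expos e. (c \<alpha> * c' \<beta>) * monom_fun (\<lambda>k. \<alpha> k + \<beta> k) x)"
      by (intro sum.cong refl) (simp add: monom_fun_def power_add prod.distrib mult_ac)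
    finally show ?thesis ..
  qed
  ultimately show ?thesis
    by (rule poly_upto_cong)
qed

text \<open>There are \<open>(d + 1) ^ n\<close> monomials. A nonzero vector orthogonal to all their
  coefficient rows, taken from \<open>independent_solutions\<close>, is a linear relation between
  the \<open>F s\<close>.\<close>

lemma not_lin_indep_poly_upto:
  assumes F: "\<And>s. s < N \<Longrightarrow> F s \<in> poly_upto d" and N: "(d + 1) ^ n < N" and Z: "Z \<subseteq> S"
  shows "\<not> lin_indep N Z F"
proof
  assume indep: "lin_indep N Z F"
  have "\<forall>s. \<exists>c. s < N \<longrightarrow> (\<forall>x\<in>S. F s x = (\<Sum>\<alpha>\<in>expos d. c \<alpha> * monom_fun \<alpha> x))"
    using F unfolding poly_upto_def by blast
  then obtain c where c: "\<And>s x. s < N \<Longrightarrow> x \<in> S \<Longrightarrow> F s x = (\<Sum>\<alpha>\<in>expos d. c s \<alpha> * monom_fun \<alpha> x)"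
    by metis
  obtain y where y: "\<forall>s<card {..<N} - card (expos d). \<forall>\<alpha>\<in>expos d. (\<Sum>i<N. c i \<alpha> * y s i) = 0"
    "lin_indep (card {..<N} - card (expos d)) {..<N} y"
    using independent_solutions[of "expos d" "{..<N}" "\<lambda>\<alpha> s. c s \<alpha>"] by auto
  define K where "K = card {..<N} - card (expos d)"
  have K: "0 < K"
    using N by (simp add: K_def card_expos)
  have "(\<Sum>s<N. y 0 s * F s x) = 0" if "x \<in> Z" for x
  proof -
    have "(\<Sum>s<N. y 0 s * F s x) = (\<Sum>s<N. y 0 s * (\<Sum>\<alpha>\<in>expos d. c s \<alpha> * monom_fun \<alpha> x))"
      using that Z c by (intro sum.cong) auto
    also have "\<dots> = (\<Sum>\<alpha>\<in>expos d. (\<Sum>s<N. c s \<alpha> * y 0 s) * monom_fun \<alpha> x)"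
      unfolding sum_distrib_left sum_distrib_right by (subst sum.swap) (simp add: mult_ac)
    also have "\<dots> = 0"
      using y(1) K unfolding K_def by (intro sum.neutral) auto
    finally show ?thesis .
  qed
  then have "\<forall>s<N. y 0 s = 0"
    using indep unfolding lin_indep_def by blast
  \<comment> \<open>A vanishing \<open>y 0\<close> is itself a relation within \<open>y\<close>,
    with coefficient 1 at index 0.\<close>
  then have "\<forall>i\<in>{..<N}. (\<Sum>s<K. (if s = 0 then 1 else 0) * y s i) = 0"
    by (auto intro!: sum.neutral)
  then have "\<forall>s<K. (if s = 0 then 1 else 0) = (0 :: 'a)"
    using y(2)[folded K_def, unfolded lin_indep_def, rule_format, of "\<lambda>s. if s = 0 then 1 else 0"] by blast
  with K show False by auto
qed

end

text \<open>Restriction to \<open>Z\<close> removes the multiples of \<open>f\<close> and shows that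
  the first \<open>a\<close> coefficients vanish; \<open>dom\<close> then cancels \<open>f\<close>
  from the rest. Irreducibility will enter through \<open>dom\<close>.\<close>

lemma lin_indep_append:
  assumes F: "lin_indep a Z F" and G: "lin_indep b Z' G" and "Z \<subseteq> Z'"
    and f: "\<And>x. x \<in> Z \<Longrightarrow> f x = 0"
    and dom: "\<And>c. \<forall>x\<in>Z'. f x * (\<Sum>s<b. c s * G s x) = 0 \<Longrightarrow> \<forall>x\<in>Z'. (\<Sum>s<b. c s * G s x) = 0"
  shows "lin_indep (a + b) Z' (\<lambda>s x. if s < a then F s x else f x * G (s - a) x)"
  unfolding lin_indep_def
proof (intro allI impI)
  fix c s
  assume c: "\<forall>x\<in>Z'. (\<Sum>s<a + b. c s * (if s < a then F s x else f x * G (s - a) x)) = 0" and s: "s < a + b"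
  have split: "(\<Sum>s<a + b. c s * (if s < a then F s x else f x * G (s - a) x)) =
    (\<Sum>s<a. c s * F s x) + f x * (\<Sum>s<b. c (a + s) * G s x)" for x
  proof -
    have "(\<Sum>s<a + b. g s) = (\<Sum>s<a. g s) + (\<Sum>s<b. g (a + s))" for g :: "nat \<Rightarrow> 'b"
      by (induction b) (simp_all add: add.assoc)
    then show ?thesis
      by (simp add: sum_distrib_left mult.left_commute)
  qed
  have "\<forall>x\<in>Z. (\<Sum>s<a. c s * F s x) = 0"
  proof
    fix x assume "x \<in> Z"
    with bspec[OF c[unfolded split], of x] f assms(3) show "(\<Sum>s<a. c s * F s x) = 0"
      by auto
  qed
  then have c1: "\<forall>s<a. c s = 0"
    using F unfolding lin_indep_def by blast
  then have "\<forall>x\<in>Z'. f x * (\<Sum>s<b. c (a + s) * G s x) = 0"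
    using c[unfolded split] by auto
  from dom[OF this] have "\<forall>s<b. c (a + s) = 0"
    by (rule G[unfolded lin_indep_def, THEN spec, THEN mp])
  with c1 s show "c s = 0"
    by (metis add_diff_inverse_nat nat_add_left_cancel_less)
qed

text \<open>
  If \<open>f\<close> vanishes on \<open>Z i\<close> but not on the irreducible set \<open>Z (Suc i)\<close>, then functions that are
  independent on \<open>Z i\<close> and \<open>f\<close>-multiples of functions that are independent on \<open>Z (Suc i)\<close> are jointly
  independent on \<open>Z (Suc i)\<close>. So a chain of length \<open>k\<close> yields \<open>(m + k) choose k\<close> independent
  functions among the span of only \<open>(e * m + 1) ^ n\<close> monomials, for all \<open>m\<close> and a fixed \<open>e\<close>.
\<close>

lemma krull_dim_le_coordinates:
  fixes S :: "'a :: field mat set"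
  assumes S: "S \<subseteq> carrier_mat N N"
    and coord: "\<And>i j. i < N \<Longrightarrow> j < N \<Longrightarrow> \<exists>c. \<forall>x\<in>S. x $$ (i, j) = (\<Sum>k<n. c k * t k x)"
  shows "krull_dim (subtopology (zariski N) S) \<le> enat n"
proof -
  interpret coordinates S n t .
  note iff = closedin_subtopology_zariski_iff[OF S]
  have ex_poly_upto: "\<exists>d. f \<in> poly_upto d" if "f \<in> mat_poly_funs N" for f
    using that
  proof induction
    case (const c)
    then show ?case using poly_upto_const by blast
  next
    case (entry i j)
    then obtain c where "\<forall>x\<in>S. x $$ (i, j) = (\<Sum>k<n. c k * t k x)"
      using coord by blast
    moreover have "(\<lambda>x. \<Sum>k<n. c k * t k x) \<in> poly_upto 1"
      by (intro poly_upto_sum poly_upto_cmult poly_upto_coordinate) auto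
    ultimately show ?case
      using poly_upto_cong[of _ 1 "\<lambda>A. A $$ (i, j)"] by (metis (mono_tags, lifting))
  next
    case (add f g)
    then obtain d e where "f \<in> poly_upto d" "g \<in> poly_upto e" by blast
    then have "f \<in> poly_upto (max d e)" "g \<in> poly_upto (max d e)"
      using poly_upto_mono by (metis max.cobounded1, metis max.cobounded2)
    then show ?case using poly_upto_add by blast
  next
    case (mult f g)
    then show ?case using poly_upto_mult by blast
  qed
  have "k \<le> n" if irr: "\<And>i. i \<le> k \<Longrightarrow> irreducible_closedin (subtopology (zariski N) S) (Z i)"
    and Z: "\<And>i. i < k \<Longrightarrow> Z i \<subset> Z (Suc i)" for k Z
  proof (rule ccontr)
    assume "\<not> k \<le> n"
    then have k: "Suc n \<le> k" by simp
    have ZS: "Z i \<subseteq> S" if "i \<le> k" for i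
    proof -
      have "closedin (subtopology (zariski N) S) (Z i)"
        using irr[OF that] by (simp add: irreducible_closedin_def)
      from closedin_subset[OF this] show ?thesis by simp
    qed
    have "\<exists>f d. f \<in> mat_poly_funs N \<and> (\<forall>x\<in>Z i. f x = 0) \<and> (\<exists>x\<in>Z (Suc i). f x \<noteq> 0) \<and> f \<in> poly_upto d"
      if i: "i < k" for i
    proof -
      have "closedin (subtopology (zariski N) S) (Z i)"
        using irr[of i] i by (auto simp: irreducible_closedin_def)
      from iffD1[OF iff this] obtain F where F: "F \<subseteq> mat_poly_funs N" "Z i = {B \<in> S. \<forall>f\<in>F. f B = 0}"
        by (elim exE conjE)
      have sub: "Z (Suc i) \<subseteq> S"
        using ZS[of "Suc i"] i by simp
      from Z[OF i] obtain x where "x \<in> Z (Suc i)" "x \<notin> Z i" by blast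
      with F sub obtain f where "f \<in> F" "f x \<noteq> 0" by blast
      with F \<open>x \<in> Z (Suc i)\<close> ex_poly_upto[of f] show ?thesis by blast
    qed
    then have "\<forall>i. \<exists>f d. i < k \<longrightarrow> f \<in> mat_poly_funs N \<and> (\<forall>x\<in>Z i. f x = 0) \<and> (\<exists>x\<in>Z (Suc i). f x \<noteq> 0) \<and> f \<in> poly_upto d"
      by blast
    then obtain f d where fd: "\<And>i. i < k \<Longrightarrow> f i \<in> mat_poly_funs N"
      "\<And>i x. i < k \<Longrightarrow> x \<in> Z i \<Longrightarrow> f i x = 0" "\<And>i. i < k \<Longrightarrow> \<exists>x\<in>Z (Suc i). f i x \<noteq> 0"
      "\<And>i. i < k \<Longrightarrow> f i \<in> poly_upto (d i)"
      by metis
    \<comment> \<open>A crude common bound for the degrees of the separating functions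
      \<open>f i\<close>.\<close>
    define e where "e = (\<Sum>i<k. d i)"
    have fe: "f i \<in> poly_upto e" if "i < k" for i
      using fd(4)[OF that] by (rule poly_upto_mono) (use that in \<open>auto simp: e_def intro!: member_le_sum\<close>)
    have ne: "Z i \<noteq> {}" if "i \<le> k" for i
      using irr[OF that] unfolding irreducible_closedin_def by blast
    have main: "\<exists>F. (\<forall>s<(m + i) choose i. F s \<in> mat_poly_funs N \<and> F s \<in> poly_upto (e * m)) \<and>
      lin_indep ((m + i) choose i) (Z i) F" if "i \<le> k" for i m
      using that
    proof (induction i arbitrary: m)
      case 0
      then show ?case
        using ne[of 0] by (intro exI[of _ "\<lambda>_ _. 1"]) (auto simp: lin_indep_def poly_upto_const mat_poly_funs.const)
    next
      case (Suc i)
      note IH = Suc.IH and prems = Suc.prems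
      show ?case
      proof (induction m)
        case 0
        then show ?case
          using ne[of "Suc i"] prems by (intro exI[of _ "\<lambda>_ _. 1"]) (auto simp: lin_indep_def poly_upto_const mat_poly_funs.const)
      next
        case (Suc m)
        define a b where "a = (Suc m + i) choose i" and "b = (m + Suc i) choose Suc i"
        from \<open>Suc i \<le> k\<close> have i: "i < k" "i \<le> k" by auto
        obtain F where F: "\<And>s. s < a \<Longrightarrow> F s \<in> mat_poly_funs N \<and> F s \<in> poly_upto (e * Suc m)" "lin_indep a (Z i) F"
          using IH[OF i(2), of "Suc m"] unfolding a_def by blast
        obtain G where G: "\<And>s. s < b \<Longrightarrow> G s \<in> mat_poly_funs N \<and> G s \<in> poly_upto (e * m)" "lin_indep b (Z (Suc i)) G"
          using Suc.IH unfolding b_def by blast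
        \<comment> \<open>Pascal's rule matches the union of the families \<open>F\<close> and
          \<open>f i * G\<close>; the extra factor \<open>f i\<close> fits into the step from
          \<open>e * m\<close> to \<open>e * Suc m\<close>.\<close>
        have ab: "(Suc m + Suc i) choose Suc i = a + b"
          by (simp add: a_def b_def)
        define H where "H s x = (if s < a then F s x else f i x * G (s - a) x)" for s x
        have "lin_indep (a + b) (Z (Suc i)) H"
          unfolding H_def
        proof (rule lin_indep_append[OF F(2) G(2)])
          show "Z i \<subseteq> Z (Suc i)" using Z[OF i(1)] by blast
          show "f i x = 0" if "x \<in> Z i" for x using fd(2) i that by blast
          fix c assume c: "\<forall>x\<in>Z (Suc i). f i x * (\<Sum>s<b. c s * G s x) = 0"
          define g where "g x = (\<Sum>s<b. c s * G s x)" for x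
          have g: "g \<in> mat_poly_funs N"
            unfolding g_def using G(1) by (intro mat_poly_funs_sum mat_poly_funs.mult mat_poly_funs.const) auto
          have cl: "closedin (subtopology (zariski N) S) {B \<in> S. h B = 0}" if "h \<in> mat_poly_funs N" for h
            unfolding iff using that by (intro exI[of _ "{h}"]) auto
          \<comment> \<open>The zero sets of \<open>f i\<close> and \<open>g\<close> cover the
            irreducible set \<open>Z (Suc i)\<close>, and that of \<open>f i\<close> does not
            suffice.\<close>
          have "Z (Suc i) \<subseteq> {B \<in> S. f i B = 0} \<union> {B \<in> S. g B = 0}"
            using c ZS[of "Suc i"] i by (auto simp: g_def)
          moreover have "\<not> Z (Suc i) \<subseteq> {B \<in> S. f i B = 0}"
            using fd(3)[OF i(1)] by blast
          ultimately have "Z (Suc i) \<subseteq> {B \<in> S. g B = 0}"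
            using irr[of "Suc i"] i cl[OF fd(1)[OF i(1)]] cl[OF g] unfolding irreducible_closedin_def
            by (meson Suc_leI)
          then show "\<forall>x\<in>Z (Suc i). (\<Sum>s<b. c s * G s x) = 0"
            unfolding g_def by blast
        qed
        moreover have "H s \<in> mat_poly_funs N \<and> H s \<in> poly_upto (e * Suc m)" if "s < a + b" for s
        proof (cases "s < a")
          case True
          then have "H s = F s" by (auto simp: H_def)
          with F(1)[OF True] show ?thesis by simp
        next
          case False
          then have H: "H s = (\<lambda>x. f i x * G (s - a) x)" and s: "s - a < b"
            using that by (auto simp: H_def)
          show ?thesis
            unfolding H using G(1)[OF s] fd(1) i poly_upto_mult[OF fe, of i "G (s - a)" "e * m"]
            by (simp add: mat_poly_funs.mult)
        qed
        ultimately show ?case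
          unfolding ab by blast
      qed
    qed
    obtain m where m: "(e * m + 1) ^ n < (m + Suc n) choose (Suc n)"
      by (rule binomial_gt_power)
    from main[OF k, of m] obtain F where
      "\<forall>s<(m + Suc n) choose Suc n. F s \<in> poly_upto (e * m)" "lin_indep ((m + Suc n) choose Suc n) (Z (Suc n)) F"
      by blast
    with not_lin_indep_poly_upto[OF _ m ZS[OF k]] show False by blast
  qed
  then show ?thesis
    unfolding krull_dim_def by (intro Sup_least) force
qed

section \<open>Dimensions of centralizers\<close>

lemma extend_to_GL:
  fixes v :: "'a :: field vec"
  assumes v: "v \<in> carrier_vec n" and v0: "v \<noteq> 0\<^sub>v n"
  obtains W where "W \<in> GL n" "\<And>i. i < n \<Longrightarrow> W $$ (i, 0) = v $ i"
proof -
  obtain r where r: "r < n" "v $ r \<noteq> 0"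
    using v v0 by (metis carrier_vecD eq_vecI index_zero_vec(1) index_zero_vec(2))
  \<comment> \<open>The remaining columns of \<open>W\<close> are the unit vectors other than the
    one at \<open>r\<close>; exchanging 0 and \<open>r\<close> numbers them by the positive column
    indices.\<close>
  define \<tau> where "\<tau> i = (if i = 0 then r else if i = r then 0 else i)" for i :: nat
  have \<tau>: "\<tau> (\<tau> i) = i" "i < n \<Longrightarrow> \<tau> i < n" for i
    using r by (auto simp: \<tau>_def)
  define W where "W = mat n n (\<lambda>(i, j). if j = 0 then v $ i else if i = \<tau> j then 1 else 0)"
  have Wc: "W \<in> carrier_mat n n" by (simp add: W_def)
  have Wx: "(W *\<^sub>v x) $ i = v $ i * x $ 0 + (if \<tau> i = 0 then 0 else x $ (\<tau> i))"
    if "x \<in> carrier_vec n" "i < n" for x i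
  proof -
    have "(W *\<^sub>v x) $ i = (\<Sum>j<n. W $$ (i, j) * x $ j)"
      using that Wc by (simp add: scalar_prod_def lessThan_atLeast0)
    also have "\<dots> = (\<Sum>j<n. (if j = 0 then v $ i * x $ j else 0) + (if j = \<tau> i then if j = 0 then 0 else x $ j else 0))"
      using that \<tau>(1) by (intro sum.cong) (auto simp: W_def)
    also have "\<dots> = v $ i * x $ 0 + (if \<tau> i = 0 then 0 else x $ (\<tau> i))"
      using \<tau>(2)[OF that(2)] r by (simp add: sum.distrib)
    finally show ?thesis .
  qed
  have "det W \<noteq> 0"
  proof
    assume "det W = 0"
    then obtain x where x: "x \<in> carrier_vec n" "x \<noteq> 0\<^sub>v n" "W *\<^sub>v x = 0\<^sub>v n"
      using det_0_iff_vec_prod_zero[OF Wc] by blast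
    have "v $ r * x $ 0 = 0"
      using Wx[OF x(1) r(1)] x(3) r(1) by (simp add: \<tau>_def split: if_splits)
    then have x0: "x $ 0 = 0" using r by simp
    have "x $ i = 0" if i: "i < n" for i
    proof (cases "i = 0")
      case False
      then show ?thesis
        using Wx[OF x(1) \<tau>(2)[OF i]] x(3) \<tau>(2)[OF i] x0 by (simp add: \<tau>(1))
    qed (simp add: x0)
    then have "x = 0\<^sub>v n" using x(1) by (intro eq_vecI) auto
    with x(2) show False ..
  qed
  then show thesis
    using Wc r by (intro that[of W]) (auto simp: GL_iff_det W_def)
qed

text \<open>Deflation: with an eigenvector as first basis vector, the first column is zero below the
  eigenvalue, and the induction hypothesis handles the lower right block.\<close>

lemma triangularizable:
  fixes A :: "'a :: alg_closed_field mat"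
  assumes "A \<in> carrier_mat n n"
  shows "\<exists>B. upper_triangular B \<and> similar_mat A B"
  using assms
proof (induction n arbitrary: A)
  case 0
  then show ?case
    by (intro exI[of _ A]) (auto intro: similar_mat_refl)
next
  case (Suc m)
  note A = Suc.prems
  have "degree (char_poly A) > 0"
    using degree_monic_char_poly[OF A] by simp
  then obtain e where "poly (char_poly A) e = 0"
    using alg_closed_imp_poly_has_root by blast
  then obtain v where "eigenvector A v e"
    using eigenvalue_root_char_poly[OF A] unfolding eigenvalue_def by blast
  then have v: "v \<in> carrier_vec (Suc m)" "v \<noteq> 0\<^sub>v (Suc m)" "A *\<^sub>v v = e \<cdot>\<^sub>v v"
    using A by (auto simp: eigenvector_def)
  obtain W where W: "W \<in> GL (Suc m)" "\<And>i. i < Suc m \<Longrightarrow> W $$ (i, 0) = v $ i"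
    using extend_to_GL[OF v(1,2)] by blast
  then have Wc: "W \<in> carrier_mat (Suc m) (Suc m)" by (simp add: GL_def)
  obtain W' where W': "W' \<in> carrier_mat (Suc m) (Suc m)" "W * W' = 1\<^sub>m (Suc m)" "W' * W = 1\<^sub>m (Suc m)"
    using GL_inverse[OF W(1)] by blast
  define A' where "A' = W' * A * W"
  have A': "A' \<in> carrier_mat (Suc m) (Suc m)"
    using A Wc W' by (simp add: A'_def)
  have "similar_mat A' A"
    by (rule similar_matI[of _ _ W' W "Suc m"]) (use A A' Wc W' in \<open>auto simp: A'_def\<close>)
  then have sim: "similar_mat A A'" by (rule similar_mat_sym)
  have Wv: "W *\<^sub>v unit_vec (Suc m) 0 = v"
    using W(2) Wc v(1) by (intro eq_vecI) auto
  have W'v: "W' *\<^sub>v v = unit_vec (Suc m) 0"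
    using W' Wc by (subst Wv[symmetric], subst assoc_mult_mat_vec[symmetric]) auto
  have "A' *\<^sub>v unit_vec (Suc m) 0 = e \<cdot>\<^sub>v unit_vec (Suc m) 0"
  proof -
    have "A' *\<^sub>v unit_vec (Suc m) 0 = W' * A *\<^sub>v (W *\<^sub>v unit_vec (Suc m) 0)"
      unfolding A'_def using A Wc W' by (intro assoc_mult_mat_vec) auto
    also have "\<dots> = W' *\<^sub>v (A *\<^sub>v v)"
      unfolding Wv using A W' v by (intro assoc_mult_mat_vec) auto
    also have "\<dots> = e \<cdot>\<^sub>v (W' *\<^sub>v v)"
      unfolding v(3) using W' v by (intro mult_mat_vec) auto
    finally show ?thesis unfolding W'v .
  qed
  note A'u = this
  have col0: "A' $$ (i, 0) = (if i = 0 then e else 0)" if "i < Suc m" for i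
  proof -
    have "A' $$ (i, 0) = (A' *\<^sub>v unit_vec (Suc m) 0) $ i"
      using that A' by (simp add: scalar_prod_right_unit)
    then show ?thesis
      unfolding A'u using that by (simp add: unit_vec_def)
  qed
  obtain A1 A2 A0 A3 where split: "split_block A' 1 1 = (A1, A2, A0, A3)"
    by (cases "split_block A' 1 1") auto
  have dims: "dim_row A' = 1 + m" "dim_col A' = 1 + m" using A' by auto
  note sp = split_block[OF split dims]
  have A1: "A1 = mat 1 1 (\<lambda>_. e)"
    using split col0[of 0] by (auto simp: split_block_def Let_def intro!: eq_matI)
  have A0: "A0 = 0\<^sub>m m 1"
    using split col0 A' by (auto simp: split_block_def Let_def intro!: eq_matI)
  obtain B where B: "upper_triangular B" "similar_mat A3 B"
    using Suc.IH[of A3] sp by auto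
  have Bc: "B \<in> carrier_mat m m"
    using similar_matD[OF B(2)] sp(4) by auto
  obtain B0 where B0: "B0 \<in> carrier_mat 1 m"
    "similar_mat (four_block_mat A1 A2 (0\<^sub>m m 1) A3) (four_block_mat A1 B0 (0\<^sub>m m 1) B)"
    using similar_mat_four_block_0_ex[OF similar_mat_refl[OF sp(1)] B(2) sp(2) sp(1) sp(4)] by blast
  have "similar_mat A (four_block_mat A1 B0 (0\<^sub>m m 1) B)"
    using sim B0(2) sp(5) A0 similar_mat_trans by metis
  moreover have "upper_triangular (four_block_mat A1 B0 (0\<^sub>m m 1) B)"
    using A1 B(1) Bc by (intro upper_triangular_four_block[of _ 1 _ m]) auto
  ultimately show ?case by blast
qed

lemma mult3_index:
  assumes "P \<in> carrier_mat n n" "C \<in> carrier_mat n n" "Q \<in> carrier_mat n n" "i < n" "j < n"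
  shows "(P * C * Q) $$ (i, j) = (\<Sum>k<n. \<Sum>l<n. P $$ (i, k) * C $$ (k, l) * Q $$ (l, j))"
  using assms by (simp add: scalar_prod_def lessThan_atLeast0 sum_distrib_left mult.assoc)

lemma lin_indep_conjugate:
  fixes V :: "nat \<Rightarrow> 'a :: field mat"
  assumes PQ: "P \<in> carrier_mat n n" "Q \<in> carrier_mat n n" "Q * P = 1\<^sub>m n" "P * Q = 1\<^sub>m n"
    and V: "\<And>s. s < m \<Longrightarrow> V s \<in> carrier_mat n n"
    and indep: "lin_indep m ({..<n} \<times> {..<n}) (\<lambda>s p. V s $$ p)"
  shows "lin_indep m ({..<n} \<times> {..<n}) (\<lambda>s p. (P * V s * Q) $$ p)"
  unfolding lin_indep_def
proof (rule allI, rule impI)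
  fix c assume c: "\<forall>p\<in>{..<n} \<times> {..<n}. (\<Sum>s<m. c s * (P * V s * Q) $$ p) = 0"
  \<comment> \<open>A relation between the conjugates says \<open>P * C * Q = 0\<close>, hence
    \<open>C = 0\<close>.\<close>
  define C where "C = mat n n (\<lambda>p. \<Sum>s<m. c s * V s $$ p)"
  have C: "C \<in> carrier_mat n n" by (simp add: C_def)
  have "P * C * Q = 0\<^sub>m n n"
  proof (rule eq_matI)
    fix i j assume "i < dim_row (0\<^sub>m n n :: 'a mat)" "j < dim_col (0\<^sub>m n n :: 'a mat)"
    then have ij: "i < n" "j < n" by auto
    have "(P * C * Q) $$ (i, j) = (\<Sum>k<n. \<Sum>l<n. \<Sum>s<m. c s * (P $$ (i, k) * V s $$ (k, l) * Q $$ (l, j)))"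
      unfolding mult3_index[OF PQ(1) C PQ(2) ij]
      by (intro sum.cong refl) (simp add: C_def sum_distrib_left sum_distrib_right mult_ac)
    also have "\<dots> = (\<Sum>k<n. \<Sum>s<m. \<Sum>l<n. c s * (P $$ (i, k) * V s $$ (k, l) * Q $$ (l, j)))"
      by (rule sum.cong[OF refl], rule sum.swap)
    also have "\<dots> = (\<Sum>s<m. \<Sum>k<n. \<Sum>l<n. c s * (P $$ (i, k) * V s $$ (k, l) * Q $$ (l, j)))"
      by (rule sum.swap)
    also have "\<dots> = (\<Sum>s<m. c s * (P * V s * Q) $$ (i, j))"
      by (intro sum.cong refl) (simp add: mult3_index[OF PQ(1) V PQ(2) ij] sum_distrib_left)
    also have "\<dots> = 0" using c ij by auto
    finally show "(P * C * Q) $$ (i, j) = 0\<^sub>m n n $$ (i, j)" using ij by simp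
  qed (use PQ in auto)
  then have "Q * (P * C * Q) * P = 0\<^sub>m n n"
    using PQ(1,2) by simp
  also have "Q * (P * C * Q) * P = (Q * P) * C * (Q * P)"
    using PQ(1,2) C by (simp add: assoc_mult_mat[of _ n n _ n _ n])
  also have "\<dots> = C" using PQ(3) C by simp
  finally have "C = 0\<^sub>m n n" .
  then have "(\<Sum>s<m. c s * V s $$ p) = 0" if "p \<in> {..<n} \<times> {..<n}" for p
    using that by (auto simp: C_def mat_eq_iff)
  with indep show "\<forall>s<m. c s = 0"
    unfolding lin_indep_def by blast
qed

lemma mult_inverse_cancel_left:
  fixes N :: "'a :: semiring_1 mat"
  assumes "P \<in> carrier_mat n n" "Q \<in> carrier_mat n n" "Q * P = 1\<^sub>m n" "N \<in> carrier_mat n n"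
  shows "Q * (P * N) = N"
  using assoc_mult_mat[OF assms(2,1,4)] left_mult_one_mat[OF assms(4)] assms(3) by simp

lemma commute_conjugate:
  fixes B :: "'a :: semiring_1 mat"
  assumes "P \<in> carrier_mat n n" "Q \<in> carrier_mat n n" "Q * P = 1\<^sub>m n"
    "B \<in> carrier_mat n n" "V \<in> carrier_mat n n" "B * V = V * B"
  shows "(P * B * Q) * (P * V * Q) = (P * V * Q) * (P * B * Q)"
proof -
  have "(P * M * Q) * (P * N * Q) = P * (M * N) * Q" if "M \<in> carrier_mat n n" "N \<in> carrier_mat n n" for M N
  proof -
    have "Q * (P * (N * Q)) = N * Q"
      using assms that by (intro mult_inverse_cancel_left) auto
    then show ?thesis
      using assms(1,2) that by (simp add: assoc_mult_mat[of _ n n _ n _ n])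
  qed
  then show ?thesis using assms by simp
qed

text \<open>For upper triangular \<open>U\<close> and \<open>V\<close> the equation
  \<open>U * V = V * U\<close> is trivial below the diagonal, and on it both sides are
  \<open>U $$ (i, i) * V $$ (i, i)\<close>. Only the strictly upper positions \<open>J\<close> give
  conditions, while the unknowns are indexed by \<open>I\<close>, which is larger by the
  diagonal.\<close>

lemma upper_triangular_commuting:
  fixes U :: "'a :: field mat"
  assumes U: "U \<in> carrier_mat n n" "upper_triangular U"
  obtains V where "\<And>s. s < n \<Longrightarrow> V s \<in> carrier_mat n n \<and> U * V s = V s * U"
    "lin_indep n ({..<n} \<times> {..<n}) (\<lambda>s p. V s $$ p)"
proof -
  define R where "R = {..<n} \<times> {..<n}"
  define I where "I = {p \<in> R. fst p \<le> snd p}"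
  define J where "J = {p \<in> R. fst p < snd p}"
  have fin: "finite R" "finite I" "finite J" by (auto simp: R_def I_def J_def)
  have "I = J \<union> (\<lambda>i. (i, i)) ` {..<n}" by (auto simp: I_def J_def R_def)
  moreover have "J \<inter> (\<lambda>i. (i, i)) ` {..<n} = {}" by (auto simp: J_def)
  ultimately have "card I = card J + n"
    using fin by (simp add: card_Un_disjoint card_image inj_on_def)
  then have card: "card I - card J = n" by simp
  \<comment> \<open>\<open>a p p'\<close> is the coefficient of the unknown \<open>V $$ p'\<close>
    in entry \<open>p\<close> of \<open>U * V - V * U\<close>.\<close>
  define a where "a = (\<lambda>(i, j) (k, l). (if l = j then U $$ (i, k) else 0) - (if k = i then U $$ (l, j) else 0))"
  obtain y where y: "\<And>s p. s < n \<Longrightarrow> p \<in> J \<Longrightarrow> (\<Sum>p'\<in>I. a p p' * y s p') = 0" "lin_indep n I y"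
    using independent_solutions[OF fin(3,2), of a] unfolding card by blast
  define V where "V s = mat n n (\<lambda>p. if fst p \<le> snd p then y s p else 0)" for s
  have Vc: "V s \<in> carrier_mat n n" for s by (simp add: V_def)
  have V0: "V s $$ (k, l) = 0" if "l < k" "k < n" "l < n" for s k l
    using that by (simp add: V_def)
  have U0: "U $$ (k, l) = 0" if "l < k" "k < n" for k l
    using U that by auto
  show thesis
  proof (rule that[of V])
    fix s assume s: "s < n"
    have "(\<Sum>k<n. U $$ (i, k) * V s $$ (k, j)) = (\<Sum>k<n. V s $$ (i, k) * U $$ (k, j))" if ij: "i < n" "j < n" for i j
    proof (cases "i < j")
      case True
      then have "(i, j) \<in> J" using ij by (simp add: J_def R_def)
      then have "0 = (\<Sum>p'\<in>I. a (i, j) p' * y s p')" using y(1)[OF s] by simp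
      also have "\<dots> = (\<Sum>p'\<in>R. if fst p' \<le> snd p' then a (i, j) p' * y s p' else 0)"
        unfolding I_def by (rule sum.inter_filter[OF fin(1)])
      also have "\<dots> = (\<Sum>p'\<in>R. a (i, j) p' * V s $$ p')"
        by (intro sum.cong) (auto simp: V_def R_def)
      also have "\<dots> = (\<Sum>k<n. \<Sum>l<n. (if l = j then U $$ (i, k) * V s $$ (k, l) else 0) - (if k = i then V s $$ (k, l) * U $$ (l, j) else 0))"
        unfolding R_def sum.cartesian_product'
        by (intro sum.cong refl) (auto simp: a_def algebra_simps)
      also have "\<dots> = (\<Sum>k<n. U $$ (i, k) * V s $$ (k, j)) - (\<Sum>k<n. \<Sum>l<n. if k = i then V s $$ (k, l) * U $$ (l, j) else 0)"
        using ij by (simp add: sum_subtractf)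
      also have "(\<Sum>k<n. \<Sum>l<n. if k = i then V s $$ (k, l) * U $$ (l, j) else 0) = (\<Sum>l<n. V s $$ (i, l) * U $$ (l, j))"
        using ij by (subst sum.swap) simp
      finally show ?thesis by simp
    next
      case False
      \<comment> \<open>As \<open>j \<le> i\<close> and a nonzero term needs
        \<open>i \<le> k\<close> and \<open>k \<le> j\<close>, only \<open>k = i = j\<close>
        contributes.\<close>
      have *: "(\<Sum>k<n. f k * g k) = (if i = j then f i * g i else 0)"
        if f0: "\<And>k. k < n \<Longrightarrow> k < i \<Longrightarrow> f k = 0" and g0: "\<And>k. k < n \<Longrightarrow> j < k \<Longrightarrow> g k = 0"
        for f g :: "nat \<Rightarrow> 'a"
      proof -
        have "f k * g k = (if k = i then if i = j then f i * g i else 0 else 0)" if "k < n" for k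
        proof -
          consider "k < i" | "j < k" | "k = i" "i = j"
            using False by linarith
          then show ?thesis
            using f0[OF that] g0[OF that] by cases auto
        qed
        then have "(\<Sum>k<n. f k * g k) = (\<Sum>k<n. if k = i then if i = j then f i * g i else 0 else 0)"
          by (intro sum.cong refl) auto
        then show ?thesis using ij by simp
      qed
      show ?thesis
        using ij by (simp add: *[of "\<lambda>k. U $$ (i, k)" "\<lambda>k. V s $$ (k, j)"] *[of "\<lambda>k. V s $$ (i, k)" "\<lambda>k. U $$ (k, j)"] U0 V0)
    qed
    then show "V s \<in> carrier_mat n n \<and> U * V s = V s * U"
      using commute_iff[OF U(1) Vc] Vc by blast
  next
    have "lin_indep n I (\<lambda>s p. V s $$ p)"
      using y(2) by (rule iffD1[OF lin_indep_cong, rotated]) (auto simp: V_def I_def R_def)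
    then show "lin_indep n ({..<n} \<times> {..<n}) (\<lambda>s p. V s $$ p)"
      unfolding lin_indep_def I_def R_def by blast
  qed
qed

lemma similar_witE:
  assumes "similar_mat A B" "A \<in> carrier_mat n n"
  obtains P Q where "P \<in> carrier_mat n n" "Q \<in> carrier_mat n n" "B \<in> carrier_mat n n"
    "P * Q = 1\<^sub>m n" "Q * P = 1\<^sub>m n" "A = P * B * Q"
proof -
  from similar_matD[OF assms(1)] obtain m P Q where *: "{A, B, P, Q} \<subseteq> carrier_mat m m"
    "P * Q = 1\<^sub>m m" "Q * P = 1\<^sub>m m" "A = P * B * Q"
    by (elim exE conjE)
  have "m = n" using *(1) assms(2) by auto
  show thesis
    by (rule that[of P Q]) (use * in \<open>simp_all add: \<open>m = n\<close>\<close>)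
qed

text \<open>Euclid's argument: over a finite field, 1 plus the product of all
  \<open>[:- a, 1:]\<close> has positive degree and no root.\<close>

lemma infinite_alg_closed: "infinite (UNIV :: 'a :: alg_closed_field set)"
proof
  assume fin: "finite (UNIV :: 'a set)"
  define p where "p = (\<Prod>a\<in>(UNIV :: 'a set). [:- a, 1:]) + 1"
  have "poly p x = 1" for x
    using fin by (auto simp: p_def poly_prod intro!: prod_zero)
  moreover have "degree p > 0"
  proof (rule ccontr)
    assume "\<not> degree p > 0"
    then obtain c where "p = [:c:]" by (metis degree_eq_zeroE not_gr_zero)
    then have "degree (p - 1) = 0" by (simp add: one_pCons)
    moreover have "p - 1 = (\<Prod>a\<in>(UNIV :: 'a set). [:- a, 1:])" by (simp add: p_def)
    moreover have "degree (\<Prod>a\<in>(UNIV :: 'a set). [:- a, 1:]) = card (UNIV :: 'a set)"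
      by (subst degree_prod_eq_sum_degree) auto
    ultimately show False using fin by simp
  qed
  ultimately show False
    using alg_closed_imp_poly_has_root[of p] by auto
qed

lemma centralizer_dim_ge:
  fixes A :: "'a :: alg_closed_field mat"
  assumes A: "A \<in> carrier_mat n n"
  shows "enat n \<le> centralizer_dim n A"
proof -
  obtain B where "upper_triangular B" "similar_mat A B"
    using triangularizable[OF A] by blast
  then obtain P Q where PQ: "P \<in> carrier_mat n n" "Q \<in> carrier_mat n n" "B \<in> carrier_mat n n"
    "P * Q = 1\<^sub>m n" "Q * P = 1\<^sub>m n" "A = P * B * Q"
    using similar_witE[OF _ A] by metis
  obtain V where V: "\<And>s. s < n \<Longrightarrow> V s \<in> carrier_mat n n \<and> B * V s = V s * B"
    "lin_indep n ({..<n} \<times> {..<n}) (\<lambda>s p. V s $$ p)"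
    using upper_triangular_commuting[OF PQ(3) \<open>upper_triangular B\<close>] by blast
  show ?thesis
    unfolding centralizer_dim_def
  proof (rule krull_dim_GL_centralizer_ge[OF A infinite_alg_closed])
    show "P * V s * Q \<in> carrier_mat n n \<and> A * (P * V s * Q) = P * V s * Q * A" if "s < n" for s
    proof
      show "P * V s * Q \<in> carrier_mat n n" using V(1)[OF that] PQ by auto
      show "A * (P * V s * Q) = P * V s * Q * A"
        unfolding PQ(6) using V(1)[OF that] PQ by (intro commute_conjugate) auto
    qed
    show "lin_indep n ({..<n} \<times> {..<n}) (\<lambda>s p. (P * V s * Q) $$ p)"
      using V PQ by (intro lin_indep_conjugate) auto
  qed
qed

section \<open>Centralizers of diagonalizable matrices\<close>

lemma diagonal_commute_iff:
  fixes D :: "'a :: field mat"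
  assumes "D \<in> carrier_mat n n" "diagonal_mat D" "M \<in> carrier_mat n n"
  shows "D * M = M * D \<longleftrightarrow> (\<forall>i<n. \<forall>j<n. D $$ (i, i) * M $$ (i, j) = M $$ (i, j) * D $$ (j, j))"
proof -
  have D0: "D $$ (i, j) = 0" if "i < n" "j < n" "i \<noteq> j" for i j
    using assms that by (auto simp: diagonal_mat_def)
  have "(\<Sum>k<n. D $$ (i, k) * M $$ (k, j)) = D $$ (i, i) * M $$ (i, j)" if "i < n" for i j
  proof -
    have "(\<Sum>k<n. D $$ (i, k) * M $$ (k, j)) = (\<Sum>k<n. if k = i then D $$ (i, i) * M $$ (i, j) else 0)"
      by (intro sum.cong refl) (use that D0 in auto)
    then show ?thesis using that by simp
  qed
  moreover have "(\<Sum>k<n. M $$ (i, k) * D $$ (k, j)) = M $$ (i, j) * D $$ (j, j)" if "j < n" for i j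
  proof -
    have "(\<Sum>k<n. M $$ (i, k) * D $$ (k, j)) = (\<Sum>k<n. if k = j then M $$ (i, j) * D $$ (j, j) else 0)"
      by (intro sum.cong refl) (use that D0 in auto)
    then show ?thesis using that by simp
  qed
  ultimately show ?thesis
    by (simp add: commute_iff[OF assms(1,3)])
qed

text \<open>If the diagonal entries at \<open>a\<close> and \<open>b\<close> agree, the matrix unit
  at \<open>(a, b)\<close> commutes with \<open>D\<close>, in addition to the \<open>n\<close>
  diagonal ones.\<close>

lemma centralizer_dim_repeated:
  fixes A :: "'a :: alg_closed_field mat"
  assumes A: "A \<in> carrier_mat n n" and D: "similar_mat A D" "diagonal_mat D"
    and ab: "a < n" "b < n" "a \<noteq> b" "D $$ (a, a) = D $$ (b, b)"
  shows "enat (Suc n) \<le> centralizer_dim n A"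
proof -
  obtain P Q where PQ: "P \<in> carrier_mat n n" "Q \<in> carrier_mat n n" "D \<in> carrier_mat n n"
    "P * Q = 1\<^sub>m n" "Q * P = 1\<^sub>m n" "A = P * D * Q"
    using similar_witE[OF D(1) A] by metis
  define pos where "pos s = (if s < n then (s, s) else (a, b))" for s
  define V where "V s = mat n n (\<lambda>p. if p = pos s then 1 else (0 :: 'a))" for s
  have Vc: "V s \<in> carrier_mat n n" for s by (simp add: V_def)
  have V: "D * V s = V s * D" for s
    using ab by (subst diagonal_commute_iff[OF PQ(3) D(2) Vc]) (auto simp: V_def pos_def)
  have pos: "pos s \<in> {..<n} \<times> {..<n}" for s
    using ab by (auto simp: pos_def)
  have pos_inj: "pos s = pos s' \<longleftrightarrow> s = s'" if "s < Suc n" "s' < Suc n" for s s'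
    using that ab by (auto simp: pos_def)
  have indep: "lin_indep (Suc n) ({..<n} \<times> {..<n}) (\<lambda>s p. V s $$ p)"
    unfolding lin_indep_def
  proof (intro allI impI)
    fix c s assume c: "\<forall>p\<in>{..<n} \<times> {..<n}. (\<Sum>s<Suc n. c s * V s $$ p) = 0" and s: "s < Suc n"
    have "V s' $$ pos s = (if s' = s then 1 else 0)" if "s' < Suc n" for s'
      using pos[of s] pos_inj[OF s that] by (cases "pos s") (auto simp: V_def)
    then have "(\<Sum>s'<Suc n. c s' * V s' $$ pos s) = (\<Sum>s'<Suc n. if s' = s then c s' else 0)"
      by (intro sum.cong refl) auto
    with bspec[OF c pos[of s]] s show "c s = 0"
      by (simp only: sum.delta[OF finite_lessThan] lessThan_iff if_True)
  qed
  show ?thesis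
    unfolding centralizer_dim_def
  proof (rule krull_dim_GL_centralizer_ge[OF A infinite_alg_closed])
    show "P * V s * Q \<in> carrier_mat n n \<and> A * (P * V s * Q) = P * V s * Q * A" for s
    proof
      show "P * V s * Q \<in> carrier_mat n n" using Vc[of s] PQ by auto
      show "A * (P * V s * Q) = P * V s * Q * A"
        unfolding PQ(6) using V[of s] Vc[of s] PQ by (intro commute_conjugate) auto
    qed
    show "lin_indep (Suc n) ({..<n} \<times> {..<n}) (\<lambda>s p. (P * V s * Q) $$ p)"
      using indep PQ Vc by (intro lin_indep_conjugate) auto
  qed
qed

text \<open>Matrices commuting with \<open>D\<close> are diagonal, so the \<open>n\<close> diagonal
  entries of \<open>Q * x * P\<close> determine \<open>x\<close> linearly and serve as the
  coordinates in \<open>krull_dim_le_coordinates\<close>.\<close>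

lemma centralizer_dim_distinct:
  fixes A :: "'a :: alg_closed_field mat"
  assumes A: "A \<in> carrier_mat n n" and D: "similar_mat A D" "diagonal_mat D"
    and inj: "inj_on (\<lambda>i. D $$ (i, i)) {..<n}"
  shows "centralizer_dim n A = enat n"
proof (rule antisym)
  obtain P Q where PQ: "P \<in> carrier_mat n n" "Q \<in> carrier_mat n n" "D \<in> carrier_mat n n"
    "P * Q = 1\<^sub>m n" "Q * P = 1\<^sub>m n" "A = P * D * Q"
    using similar_witE[OF D(1) A] by metis
  have coord: "x $$ (i, j) = (\<Sum>k<n. P $$ (i, k) * Q $$ (k, j) * (Q * x * P) $$ (k, k))"
    if x: "x \<in> GL_centralizer n A" and ij: "i < n" "j < n" for x i j
  proof -
    have xc: "x \<in> carrier_mat n n" and com: "A * x = x * A"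
      using x by (auto simp: GL_centralizer_def GL_def)
    define y where "y = Q * x * P"
    have yc: "y \<in> carrier_mat n n" using PQ xc by (simp add: y_def)
    have "(Q * A * P) * y = y * (Q * A * P)"
      unfolding y_def using PQ(1-5) A xc com by (intro commute_conjugate) auto
    moreover have "Q * A * P = (Q * P) * D * (Q * P)"
      unfolding PQ(6) using PQ(1-3) by (simp add: assoc_mult_mat[of _ n n _ n _ n])
    ultimately have "D * y = y * D" using PQ by simp
    then have y0: "y $$ (k, l) = 0" if "k < n" "l < n" "k \<noteq> l" for k l
    proof -
      have "D $$ (k, k) * y $$ (k, l) = y $$ (k, l) * D $$ (l, l)"
        using \<open>D * y = y * D\<close> diagonal_commute_iff[OF PQ(3) D(2) yc] that by blast
      moreover have "D $$ (k, k) \<noteq> D $$ (l, l)"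
        using inj that by (auto simp: inj_on_def)
      ultimately show ?thesis by (simp add: mult.commute)
    qed
    have "x = (P * Q) * x * (P * Q)" using PQ xc by simp
    also have "\<dots> = P * y * Q"
      unfolding y_def using PQ(1-3) xc by (simp add: assoc_mult_mat[of _ n n _ n _ n])
    finally have "x $$ (i, j) = (\<Sum>k<n. \<Sum>l<n. P $$ (i, k) * y $$ (k, l) * Q $$ (l, j))"
      using mult3_index[OF PQ(1) yc PQ(2) ij] by simp
    also have "\<dots> = (\<Sum>k<n. \<Sum>l<n. if l = k then P $$ (i, k) * y $$ (k, k) * Q $$ (k, j) else 0)"
      by (intro sum.cong refl) (use y0 in auto)
    also have "\<dots> = (\<Sum>k<n. P $$ (i, k) * Q $$ (k, j) * y $$ (k, k))"
      by (intro sum.cong refl) (simp add: mult_ac)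
    finally show ?thesis unfolding y_def .
  qed
  show "centralizer_dim n A \<le> enat n"
    unfolding centralizer_dim_def
  proof (rule krull_dim_le_coordinates[OF GL_centralizer_carrier])
    fix i j assume ij: "i < n" "j < n"
    show "\<exists>c. \<forall>x\<in>GL_centralizer n A. x $$ (i, j) = (\<Sum>k<n. c k * (Q * x * P) $$ (k, k))"
      by (intro exI[of _ "\<lambda>k. P $$ (i, k) * Q $$ (k, j)"] ballI) (rule coord[OF _ ij])
  qed
qed (rule centralizer_dim_ge[OF A])

text \<open>Such a matrix attains the bound of \<open>centralizer_dim_ge\<close>, so regular means
  dimension exactly \<open>n\<close>.\<close>

lemma diagonal_distinct_exists:
  obtains D :: "'a :: alg_closed_field mat" where "D \<in> GL n" "diagonal_mat D" "inj_on (\<lambda>i. D $$ (i, i)) {..<n}"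
proof -
  have "infinite (UNIV - {0 :: 'a})" using infinite_alg_closed by simp
  then obtain f :: "nat \<Rightarrow> 'a" where f: "inj f" "range f \<subseteq> UNIV - {0}"
    using infinite_countable_subset by blast
  define D where "D = mat n n (\<lambda>(i, j). if i = j then f i else 0)"
  have Dc: "D \<in> carrier_mat n n" by (simp add: D_def)
  have "upper_triangular D" by (auto simp: D_def)
  then have "det D = prod_list (diag_mat D)"
    by (rule det_upper_triangular[OF _ Dc])
  also have "\<dots> \<noteq> 0"
    using f(2) unfolding prod_list_diag_prod by (auto simp: D_def)
  finally have "D \<in> GL n" using Dc by (simp add: GL_iff_det)
  moreover have "inj_on (\<lambda>i. D $$ (i, i)) {..<n}"
    using f(1) by (auto simp: D_def inj_on_def)
  ultimately show thesis
    by (intro that[of D]) (auto simp: diagonal_mat_def D_def)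
qed

lemma regular_GL_diagonalizable_iff:
  fixes A :: "'a :: alg_closed_field mat"
  assumes A: "A \<in> GL n" and D: "similar_mat A D" "diagonal_mat D"
  shows "regular_GL n A \<longleftrightarrow> inj_on (\<lambda>i. D $$ (i, i)) {..<n}"
proof
  have Ac: "A \<in> carrier_mat n n" using A by (simp add: GL_def)
  show "inj_on (\<lambda>i. D $$ (i, i)) {..<n}" if reg: "regular_GL n A"
  proof (rule ccontr)
    assume "\<not> inj_on (\<lambda>i. D $$ (i, i)) {..<n}"
    then obtain a b where "a < n" "b < n" "a \<noteq> b" "D $$ (a, a) = D $$ (b, b)"
      by (auto simp: inj_on_def)
    from centralizer_dim_repeated[OF Ac D this] have "enat (Suc n) \<le> centralizer_dim n A" .
    obtain B :: "'a mat" where B: "B \<in> GL n" "diagonal_mat B" "inj_on (\<lambda>i. B $$ (i, i)) {..<n}"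
      by (rule diagonal_distinct_exists)
    then have "B \<in> carrier_mat n n" by (simp add: GL_def)
    then have "centralizer_dim n B = enat n"
      using B by (intro centralizer_dim_distinct[of B n B] similar_mat_refl)
    moreover have "centralizer_dim n A \<le> centralizer_dim n B"
      using reg B by (simp add: regular_GL_def)
    ultimately have "enat (Suc n) \<le> enat n"
      using \<open>enat (Suc n) \<le> centralizer_dim n A\<close> by (metis order_trans)
    then show False by simp
  qed
  show "regular_GL n A" if inj: "inj_on (\<lambda>i. D $$ (i, i)) {..<n}"
    unfolding regular_GL_def using A centralizer_dim_distinct[OF Ac D inj] centralizer_dim_ge
    by (auto simp: GL_def)
qed

lemma char_poly_diagonal_roots:
  fixes A :: "'a :: field mat"
  assumes A: "A \<in> carrier_mat n n" and D: "similar_mat A D" "diagonal_mat D"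
  shows "{x. poly (char_poly A) x = 0} = (\<lambda>i. D $$ (i, i)) ` {..<n}"
proof -
  have Dc: "D \<in> carrier_mat n n" using similar_witE[OF D(1) A] by metis
  have "upper_triangular D" using D(2) Dc by (auto simp: diagonal_mat_def)
  then have "char_poly A = (\<Prod>a\<leftarrow>diag_mat D. [:- a, 1:])"
    using char_poly_similar[OF D(1)] char_poly_upper_triangular[OF Dc] by simp
  moreover have "set (diag_mat D) = (\<lambda>i. D $$ (i, i)) ` {..<n}"
    using Dc by (auto simp: diag_mat_def)
  moreover have "poly (\<Prod>a\<leftarrow>xs. [:- a, 1:]) x = 0 \<longleftrightarrow> x \<in> set xs" for x and xs :: "'a list"
    by (induction xs) auto
  ultimately show ?thesis by auto
qed

text \<open>Applying \<open>A - l t\<close> to a relation removes the vector \<open>v t\<close> and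
  multiplies the other coefficients by \<open>l i - l t\<close>, which is nonzero.\<close>

lemma eigenvectors_lin_indep:
  fixes A :: "'a :: field mat"
  assumes A: "A \<in> carrier_mat n n" and T: "finite T" "inj_on l T"
    and v: "\<And>i. i \<in> T \<Longrightarrow> eigenvector A (v i) (l i)"
    and c: "\<And>k. k < n \<Longrightarrow> (\<Sum>i\<in>T. c i * v i $ k) = 0"
  shows "\<forall>i\<in>T. c i = 0"
  using T v c
proof (induction T arbitrary: c)
  case (insert t T)
  have ev: "v i \<in> carrier_vec n" "v i \<noteq> 0\<^sub>v n" "A *\<^sub>v v i = l i \<cdot>\<^sub>v v i" if "i \<in> insert t T" for i
    using insert.prems(2)[OF that] A by (auto simp: eigenvector_def)
  have Av: "(\<Sum>k<n. A $$ (j, k) * v i $ k) = l i * v i $ j" if "i \<in> insert t T" "j < n" for i j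
  proof -
    have "(A *\<^sub>v v i) $ j = (l i \<cdot>\<^sub>v v i) $ j" using ev(3)[OF that(1)] by simp
    then show ?thesis
      using A ev(1)[OF that(1)] that(2) by (simp add: scalar_prod_def lessThan_atLeast0)
  qed
  have "(\<Sum>i\<in>T. c i * (l i - l t) * v i $ j) = 0" if j: "j < n" for j
  proof -
    have "0 = (\<Sum>k<n. A $$ (j, k) * (\<Sum>i\<in>insert t T. c i * v i $ k))"
      using insert.prems(3) by simp
    also have "\<dots> = (\<Sum>i\<in>insert t T. c i * (\<Sum>k<n. A $$ (j, k) * v i $ k))"
      unfolding sum_distrib_left by (subst sum.swap) (simp add: mult_ac)
    also have "\<dots> = (\<Sum>i\<in>insert t T. c i * (l i * v i $ j))"
      using Av j by (intro sum.cong) auto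
    also have "\<dots> = (\<Sum>i\<in>insert t T. c i * (l i - l t) * v i $ j) + l t * (\<Sum>i\<in>insert t T. c i * v i $ j)"
      unfolding sum_distrib_left sum.distrib[symmetric] by (intro sum.cong) (auto simp: algebra_simps)
    also have "\<dots> = (\<Sum>i\<in>T. c i * (l i - l t) * v i $ j)"
      using insert.prems(3)[OF j] insert.hyps by simp
    finally show ?thesis ..
  qed
  then have "\<forall>i\<in>T. c i * (l i - l t) = 0"
    using insert.prems(1,2) by (intro insert.IH) auto
  then have cT: "\<forall>i\<in>T. c i = 0"
    using insert.prems(1) insert.hyps by (auto simp: inj_on_def)
  then have "c t * v t $ k = 0" if "k < n" for k
    using insert.prems(3)[OF that] insert.hyps by simp
  moreover obtain k where "k < n" "v t $ k \<noteq> 0"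
    using ev(1,2)[of t] by (metis carrier_vecD eq_vecI index_zero_vec(1) index_zero_vec(2) insertI1)
  ultimately show ?case using cT by auto
qed simp

lemma distinct_roots_diagonalizable:
  fixes A :: "'a :: field mat"
  assumes A: "A \<in> carrier_mat n n" and card: "card {x. poly (char_poly A) x = 0} = n"
  obtains D where "diagonal_mat D" "similar_mat A D" "inj_on (\<lambda>i. D $$ (i, i)) {..<n}"
proof -
  have "char_poly A \<noteq> 0" using degree_monic_char_poly[OF A] by auto
  then have "finite {x. poly (char_poly A) x = 0}" by (rule poly_roots_finite)
  then obtain l where l: "bij_betw l {..<n} {x. poly (char_poly A) x = 0}"
    using ex_bij_betw_nat_finite card atLeast0LessThan by metis
  have "\<forall>i. \<exists>v. i < n \<longrightarrow> eigenvector A v (l i)"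
    using l eigenvalue_root_char_poly[OF A] unfolding eigenvalue_def bij_betw_def by blast
  then obtain v where v: "\<And>i. i < n \<Longrightarrow> eigenvector A (v i) (l i)" by metis
  have vc: "v i \<in> carrier_vec n" "A *\<^sub>v v i = l i \<cdot>\<^sub>v v i" if "i < n" for i
    using v[OF that] A by (auto simp: eigenvector_def)
  define P where "P = mat n n (\<lambda>(i, j). v j $ i)"
  define D where "D = mat n n (\<lambda>(i, j). if i = j then l i else 0)"
  have Pc: "P \<in> carrier_mat n n" and Dc: "D \<in> carrier_mat n n" by (auto simp: P_def D_def)
  have "det P \<noteq> 0"
  proof
    assume "det P = 0"
    then obtain c where c: "c \<in> carrier_vec n" "c \<noteq> 0\<^sub>v n" "P *\<^sub>v c = 0\<^sub>v n"
      using det_0_iff_vec_prod_zero[OF Pc] by blast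
    have "(\<Sum>i\<in>{..<n}. c $ i * v i $ k) = 0" if "k < n" for k
    proof -
      have "(P *\<^sub>v c) $ k = 0" using c(3) that by simp
      then show ?thesis using that c(1) Pc
        by (simp add: scalar_prod_def lessThan_atLeast0 P_def mult.commute)
    qed
    then have "\<forall>i\<in>{..<n}. c $ i = 0"
      using l v by (intro eigenvectors_lin_indep[OF A, of _ l v]) (auto simp: bij_betw_def)
    then have "c = 0\<^sub>v n" using c(1) by (intro eq_vecI) auto
    with c(2) show False ..
  qed
  then have "P \<in> GL n" using Pc by (simp add: GL_iff_det)
  then obtain Q where Q: "Q \<in> carrier_mat n n" "P * Q = 1\<^sub>m n" "Q * P = 1\<^sub>m n"
    using GL_inverse by blast
  have "A * P = P * D"
  proof (rule eq_matI)
    fix i j assume "i < dim_row (P * D)" "j < dim_col (P * D)"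
    then have ij: "i < n" "j < n" using Pc Dc by auto
    have "col P j = v j"
      using ij vc(1)[OF ij(2)] by (intro eq_vecI) (auto simp: P_def)
    then have "(A * P) $$ (i, j) = (A *\<^sub>v v j) $ i"
      using ij A Pc by simp
    also have "\<dots> = v j $ i * l j" using vc[OF ij(2)] ij by simp
    also have "\<dots> = (\<Sum>k<n. if k = j then v k $ i * l k else 0)"
      using ij by simp
    also have "\<dots> = (\<Sum>k<n. v k $ i * (if k = j then l k else 0))"
      by (intro sum.cong refl) auto
    also have "\<dots> = (P * D) $$ (i, j)"
      using ij Pc Dc by (simp add: scalar_prod_def lessThan_atLeast0 P_def D_def)
    finally show "(A * P) $$ (i, j) = (P * D) $$ (i, j)" .
  qed (use A Pc Dc in auto)
  then have "P * D * Q = A * P * Q" by simp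
  also have "\<dots> = A" using A Pc Q by (simp add: assoc_mult_mat[of _ n n _ n _ n])
  finally have "similar_mat A D"
    using A Pc Dc Q by (intro similar_matI[of _ _ P Q n]) auto
  moreover have "inj_on (\<lambda>i. D $$ (i, i)) {..<n}"
    using l by (auto simp: D_def bij_betw_def inj_on_def)
  ultimately show thesis
    by (intro that[of D]) (auto simp: diagonal_mat_def D_def)
qed

text \<open>The topology ends here: all that remains of it is the number of distinct roots of a
  characteristic polynomial.\<close>

lemma regular_diagonalizable_iff:
  fixes A :: "'a :: alg_closed_field mat"
  shows "regular_GL n A \<and> diagonalizable_mat A \<longleftrightarrow> A \<in> GL n \<and> card {x. poly (char_poly A) x = 0} = n"
proof
  assume *: "regular_GL n A \<and> diagonalizable_mat A"
  then obtain D where D: "similar_mat A D" "diagonal_mat D" and A: "A \<in> GL n"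
    by (auto simp: diagonalizable_mat_def regular_GL_def)
  then have "inj_on (\<lambda>i. D $$ (i, i)) {..<n}"
    using * regular_GL_diagonalizable_iff by blast
  moreover have "A \<in> carrier_mat n n" using A by (simp add: GL_def)
  ultimately show "A \<in> GL n \<and> card {x. poly (char_poly A) x = 0} = n"
    using A D by (simp add: char_poly_diagonal_roots card_image)
next
  assume *: "A \<in> GL n \<and> card {x. poly (char_poly A) x = 0} = n"
  then have "A \<in> carrier_mat n n" by (simp add: GL_def)
  then obtain D where "diagonal_mat D" "similar_mat A D" "inj_on (\<lambda>i. D $$ (i, i)) {..<n}"
    using distinct_roots_diagonalizable * by blast
  then show "regular_GL n A \<and> diagonalizable_mat A"
    using * regular_GL_diagonalizable_iff unfolding diagonalizable_mat_def by blast
qed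

section \<open>Irreducible polynomials over finite fields\<close>

text \<open>Monic representatives: divisibility among them is equality, so squarefree monic
  polynomials correspond to finite sets.\<close>

definition irr_polys :: "'a :: field poly set" where
  "irr_polys = {p. irreducible p \<and> lead_coeff p = 1}"

lemma irreducible_degree_pos:
  assumes "irreducible (p :: 'a :: field poly)"
  shows "degree p > 0"
proof (rule ccontr)
  assume "\<not> degree p > 0"
  then obtain c where "p = [:c:]" by (metis degree_eq_zeroE not_gr_zero)
  with assms show False
    by (auto simp: Factorial_Ring.irreducible_def is_unit_pCons_iff)
qed

lemma irr_polysD:
  assumes "p \<in> irr_polys"
  shows "irreducible p" "lead_coeff p = 1" "p \<noteq> 0" "degree p > 0" "prime_elem p" "\<not> is_unit p"
proof -
  show p: "irreducible p" and "lead_coeff p = 1"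
    using assms by (auto simp: irr_polys_def)
  show "p \<noteq> 0" "\<not> is_unit p" using p by (auto simp: Factorial_Ring.irreducible_def)
  show "degree p > 0" by (rule irreducible_degree_pos[OF p])
  show "prime_elem p" by (rule field_poly_irreducible_imp_prime[OF p])
qed

text \<open>A nonzero element of least degree in the ideal generated by \<open>p\<close> and
  \<open>g\<close> divides both. Were it no unit, it would be an associate of the irreducible
  \<open>p\<close>, and \<open>p\<close> would divide \<open>g\<close>.\<close>

lemma irreducible_bezout:
  fixes p g :: "'a :: field poly"
  assumes p: "irreducible p" and g: "\<not> p dvd g"
  obtains u v where "u * p + v * g = 1"
proof -
  define I where "I = {u * p + v * g | u v. True}"
  have p0: "p \<noteq> 0" using p by (auto simp: Factorial_Ring.irreducible_def)
  have pI: "p \<in> I" unfolding I_def by (rule CollectI, rule exI[of _ 1], rule exI[of _ 0]) simp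
  have gI: "g \<in> I" unfolding I_def by (rule CollectI, rule exI[of _ 0], rule exI[of _ 1]) simp
  obtain d where d: "d \<in> I" "d \<noteq> 0" and min: "\<And>h. h \<in> I \<Longrightarrow> h \<noteq> 0 \<Longrightarrow> degree d \<le> degree h"
    using ex_has_least_nat[of "\<lambda>h. h \<in> I \<and> h \<noteq> 0" p degree] pI p0 by blast
  from d(1) obtain a b where ab: "d = a * p + b * g" by (auto simp: I_def)
  have dvd: "d dvd h" if h: "h \<in> I" for h
  proof -
    from h obtain u v where uv: "h = u * p + v * g" by (auto simp: I_def)
    have "h mod d = h - (h div d) * d"
      by (simp add: minus_div_mult_eq_mod)
    also have "\<dots> = (u - (h div d) * a) * p + (v - (h div d) * b) * g"
      unfolding uv ab by (simp only: algebra_simps)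
    finally have "h mod d \<in> I" by (auto simp: I_def)
    have "h mod d = 0"
    proof (rule ccontr)
      assume "h mod d \<noteq> 0"
      then have "degree d \<le> degree (h mod d)" using min \<open>h mod d \<in> I\<close> by blast
      moreover have "degree (h mod d) < degree d"
        using degree_mod_less[OF d(2), of h] \<open>h mod d \<noteq> 0\<close> by simp
      ultimately show False by simp
    qed
    then show ?thesis by (simp add: mod_eq_0_iff_dvd)
  qed
  obtain k where k: "p = d * k" using dvd[OF pI] by (elim dvdE)
  have "is_unit d"
  proof (rule ccontr)
    assume "\<not> is_unit d"
    then have "is_unit k" using Factorial_Ring.irreducibleD[OF p k] by blast
    then obtain k' where "1 = k * k'" by (elim dvdE)
    then have "d = p * k'" by (simp add: k mult.assoc)
    then have "p dvd d" by simp
    then show False using g dvd[OF gI] dvd_trans by blast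
  qed
  then obtain e where e: "1 = d * e" by (elim dvdE)
  have "(e * a) * p + (e * b) * g = d * e"
    unfolding ab by (simp add: algebra_simps)
  then have "(e * a) * p + (e * b) * g = 1"
    using e by simp
  then show thesis by (rule that)
qed

lemma irr_dvd_irr:
  assumes "p \<in> irr_polys" "r \<in> irr_polys" "p dvd r"
  shows "p = r"
proof -
  from assms(3) obtain k where k: "r = p * k" by (elim dvdE)
  have "is_unit k"
    using Factorial_Ring.irreducibleD[OF irr_polysD(1)[OF assms(2)] k] irr_polysD(6)[OF assms(1)] by blast
  then obtain c where c: "k = [:c:]" by (metis is_unit_poly_iff)
  have "lead_coeff r = lead_coeff p * lead_coeff k" unfolding k by (rule lead_coeff_mult)
  then have "c = 1" using irr_polysD(2)[OF assms(1)] irr_polysD(2)[OF assms(2)] c by simp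
  then show ?thesis using k c by simp
qed

lemma irr_dvd_prod:
  assumes p: "p \<in> irr_polys" and S: "finite S" "S \<subseteq> irr_polys" "p dvd \<Prod>S"
  shows "p \<in> S"
  using S
proof (induction S)
  case empty
  then show ?case using irr_polysD(6)[OF p] by simp
next
  case (insert r S)
  then have "p dvd r \<or> p dvd \<Prod>S"
    using irr_polysD(5)[OF p] by (simp add: prime_elem_dvd_mult_iff)
  then show ?case using insert irr_dvd_irr[OF p, of r] by auto
qed

lemma prod_irr_dvd:
  assumes "finite S" "S \<subseteq> irr_polys" "\<And>p. p \<in> S \<Longrightarrow> p dvd f"
  shows "\<Prod>S dvd f"
  using assms
proof (induction S)
  case (insert p S)
  then obtain k where k: "f = \<Prod>S * k" by (auto elim: dvdE)
  have "p dvd \<Prod>S * k" using insert.prems(2)[of p] k by simp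
  moreover have "\<not> p dvd \<Prod>S"
    using irr_dvd_prod[of p S] insert by auto
  ultimately have "p dvd k"
    using irr_polysD(5)[of p] insert.prems(1) by (auto simp: prime_elem_dvd_mult_iff)
  then show ?case using k insert.hyps by (auto elim!: dvdE)
qed auto

lemma prod_irr_nonzero: "S \<subseteq> irr_polys \<Longrightarrow> \<Prod>S \<noteq> 0"
  by (cases "finite S") (use irr_polysD(3) in \<open>auto simp: subset_iff\<close>)

lemma degree_prod_irr:
  assumes "finite S" "S \<subseteq> irr_polys"
  shows "degree (\<Prod>S) = (\<Sum>p\<in>S. degree p)"
  using assms irr_polysD(3) by (subst degree_prod_eq_sum_degree) auto

lemma lead_coeff_prod_irr:
  assumes "finite S" "S \<subseteq> irr_polys"
  shows "lead_coeff (\<Prod>S) = 1"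
  unfolding lead_coeff_prod using assms irr_polysD(2) by (intro prod.neutral) auto

lemma prod_irr_inject:
  assumes "finite S" "S \<subseteq> irr_polys" "finite S'" "S' \<subseteq> irr_polys" "\<Prod>S = \<Prod>S'"
  shows "S = S'"
proof -
  have "S \<subseteq> S'" if "finite S" "S \<subseteq> irr_polys" "finite S'" "S' \<subseteq> irr_polys" "\<Prod>S = \<Prod>S'" for S S'
  proof
    fix p assume "p \<in> S"
    then have "p dvd \<Prod>S'" using that by (metis dvd_prod_eqI)
    then show "p \<in> S'" using irr_dvd_prod[of p S'] that \<open>p \<in> S\<close> by auto
  qed
  then show ?thesis using assms by (metis subset_antisym)
qed

lemma ex_irr_factor:
  assumes "degree (f :: 'a :: field poly) > 0"
  obtains p where "p \<in> irr_polys" "p dvd f"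
proof -
  have "\<exists>p. (p dvd f \<and> degree p > 0) \<and> (\<forall>h. h dvd f \<and> degree h > 0 \<longrightarrow> degree p \<le> degree h)"
    by (rule ex_has_least_nat[of _ f]) (use assms in simp)
  then obtain p where p: "p dvd f" "degree p > 0" and min: "\<And>h. h dvd f \<Longrightarrow> degree h > 0 \<Longrightarrow> degree p \<le> degree h"
    by (elim exE conjE) simp
  have p0: "p \<noteq> 0" using p(2) by auto
  have "irreducible p"
  proof (rule Factorial_Ring.irreducibleI)
    show "p \<noteq> 0" by (rule p0)
    show "\<not> is_unit p" using p(2) p0 by (simp add: is_unit_iff_degree)
    fix a b assume ab: "p = a * b"
    then have nz: "a \<noteq> 0" "b \<noteq> 0" using p0 by auto
    have "degree p = degree a + degree b" using nz by (simp add: ab degree_mult_eq)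
    moreover have "a dvd f" using ab p(1) by (metis dvd_mult_left)
    ultimately have "degree a = 0 \<or> degree b = 0"
      using min[of a] by linarith
    then show "is_unit a \<or> is_unit b" using nz by (simp add: is_unit_iff_degree)
  qed
  moreover define c where "c = inverse (lead_coeff p)"
  have "c \<noteq> 0" using p0 by (simp add: c_def)
  ultimately have "smult c p \<in> irr_polys"
    using p0 by (simp add: irr_polys_def c_def irreducible_smult_field)
  moreover have "smult c p dvd f" using p(1) \<open>c \<noteq> 0\<close> by (simp add: smult_dvd_iff)
  ultimately show thesis by (rule that)
qed

lemma squarefree_eq_prod_irr:
  fixes f :: "'a :: field poly"
  assumes "lead_coeff f = 1" "\<And>p. p \<in> irr_polys \<Longrightarrow> \<not> p * p dvd f"
  shows "\<exists>S. finite S \<and> S \<subseteq> irr_polys \<and> \<Prod>S = f"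
  using assms
proof (induction "degree f" arbitrary: f rule: less_induct)
  case less
  show ?case
  proof (cases "degree f = 0")
    case True
    then have "f = 1" using less.prems(1) by (auto elim!: degree_eq_zeroE)
    then show ?thesis by (intro exI[of _ "{}"]) auto
  next
    case False
    then obtain p where p: "p \<in> irr_polys" "p dvd f" using ex_irr_factor by auto
    then obtain h where h: "f = p * h" by (elim dvdE)
    have f0: "f \<noteq> 0" using less.prems(1) by auto
    have "degree f = degree p + degree h"
      using f0 unfolding h by (intro degree_mult_eq) auto
    then have "degree h < degree f" using irr_polysD(4)[OF p(1)] by simp
    moreover have "lead_coeff h = 1"
      using less.prems(1) irr_polysD(2)[OF p(1)] unfolding h lead_coeff_mult by simp
    moreover have "\<not> r * r dvd h" if "r \<in> irr_polys" for r
      using less.prems(2)[OF that] unfolding h by (metis dvd_mult)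
    ultimately obtain S where S: "finite S" "S \<subseteq> irr_polys" "\<Prod>S = h"
      using less.hyps[of h] by blast
    have "p \<notin> S"
    proof
      assume "p \<in> S"
      then have "p dvd h" using S by (metis dvd_prod_eqI)
      then have "p * p dvd f" unfolding h by (intro mult_dvd_mono) auto
      with less.prems(2)[OF p(1)] show False ..
    qed
    then show ?thesis using S p h by (intro exI[of _ "insert p S"]) auto
  qed
qed

text \<open>No \<open>r \<in> S\<close> divides \<open>p\<close>, so the multiples of
  \<open>p\<close> in \<open>T\<close> free of factors from \<open>S\<close> are the
  \<open>p * g\<close> with \<open>g\<close> free of them. \<open>T\<close> is arbitrary because the
  sieve is applied to polynomials of bounded degree and to monic ones of fixed degree.\<close>

lemma sieve_step:
  assumes T: "finite T" and p: "p \<in> irr_polys" "p \<notin> S" and S: "S \<subseteq> irr_polys"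
  shows "card {f \<in> T. \<forall>r\<in>insert p S. \<not> r dvd f} + card {g. p * g \<in> T \<and> (\<forall>r\<in>S. \<not> r dvd g)} =
    card {f \<in> T. \<forall>r\<in>S. \<not> r dvd f}"
proof -
  have free: "(\<forall>r\<in>S. \<not> r dvd p * g) \<longleftrightarrow> (\<forall>r\<in>S. \<not> r dvd g)" for g
  proof (intro ball_cong refl)
    fix r assume r: "r \<in> S"
    then have "\<not> r dvd p" using irr_dvd_irr[of r p] p S by auto
    then show "(\<not> r dvd p * g) = (\<not> r dvd g)"
      using irr_polysD(5)[of r] r S by (auto simp: prime_elem_dvd_mult_iff)
  qed
  have eq: "{f \<in> T. \<forall>r\<in>S. \<not> r dvd f} = {f \<in> T. \<forall>r\<in>insert p S. \<not> r dvd f} \<union>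
      (*) p ` {g. p * g \<in> T \<and> (\<forall>r\<in>S. \<not> r dvd g)}" (is "_ = ?A \<union> ?B")
  proof (rule Set.set_eqI, rule iffI)
    fix f assume f: "f \<in> {f \<in> T. \<forall>r\<in>S. \<not> r dvd f}"
    show "f \<in> ?A \<union> ?B"
    proof (cases "p dvd f")
      case True
      then obtain g where "f = p * g" by (elim dvdE)
      then show ?thesis using f free[of g] by auto
    qed (use f in auto)
  next
    fix f assume "f \<in> ?A \<union> ?B"
    then show "f \<in> {f \<in> T. \<forall>r\<in>S. \<not> r dvd f}"
      using free by (elim UnE imageE) auto
  qed
  have disj: "?A \<inter> ?B = {}" by auto
  have "?B \<subseteq> T" by auto
  then have fin: "finite ?A" "finite ?B" using T by (auto intro: finite_subset)
  have "card ?B = card {g. p * g \<in> T \<and> (\<forall>r\<in>S. \<not> r dvd g)}"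
    using irr_polysD(3)[OF p(1)] by (intro card_image) (auto simp: inj_on_def)
  then show ?thesis
    unfolding eq card_Un_disjoint[OF fin disj] by simp
qed

text \<open>A vector space of dimension \<open>m\<close> also for \<open>m = 0\<close>, thanks to
  the explicit zero.\<close>

definition polys_below :: "nat \<Rightarrow> 'a :: field poly set" where
  "polys_below m = {f. f = 0 \<or> degree f < m}"

lemma polys_below_iff: "f \<in> polys_below m \<longleftrightarrow> (\<forall>i\<ge>m. coeff f i = 0)"
  unfolding polys_below_def using coeff_eq_0 le_degree leading_coeff_0_iff
  by (metis (mono_tags, lifting) dual_order.strict_trans2 linorder_not_le mem_Collect_eq coeff_0)

lemma bij_betw_polys_below:
  "bij_betw (\<lambda>f. \<lambda>i\<in>{..<m}. coeff f i) (polys_below m) ({..<m} \<rightarrow>\<^sub>E UNIV)"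
proof (rule bij_betwI[where g = "\<lambda>c. \<Sum>i<m. monom (c i) i"])
  show "(\<lambda>f. \<lambda>i\<in>{..<m}. coeff f i) \<in> polys_below m \<rightarrow> {..<m} \<rightarrow>\<^sub>E UNIV" by auto
  show "(\<lambda>c. \<Sum>i<m. monom (c i) i) \<in> ({..<m} \<rightarrow>\<^sub>E UNIV) \<rightarrow> polys_below m"
    by (auto simp: polys_below_iff coeff_sum intro!: sum.neutral)
  show "(\<Sum>i<m. monom ((\<lambda>i\<in>{..<m}. coeff f i) i) i) = f" if "f \<in> polys_below m" for f :: "'a poly"
    using that by (intro poly_eqI) (auto simp: polys_below_iff coeff_sum)
  show "(\<lambda>i\<in>{..<m}. coeff (\<Sum>i<m. monom (c i) i) i) = c" if "c \<in> {..<m} \<rightarrow>\<^sub>E UNIV" for c :: "nat \<Rightarrow> 'a"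
    using that by (auto simp: coeff_sum restrict_def PiE_def extensional_def)
qed

lemma finite_polys_below [simp]: "finite (polys_below m :: 'a :: {field, finite} poly set)"
  and card_polys_below: "card (polys_below m :: 'a poly set) = CARD('a) ^ m"
proof -
  note b = bij_betw_polys_below[of m, where ?'a = 'a]
  have "finite ({..<m} \<rightarrow>\<^sub>E (UNIV :: 'a set))" by (intro finite_PiE) auto
  with b show "finite (polys_below m :: 'a poly set)" using bij_betw_finite by blast
  show "card (polys_below m :: 'a poly set) = CARD('a) ^ m"
    using bij_betw_same_card[OF b] by (simp add: card_PiE)
qed

text \<open>Sieving by \<open>p\<close> also needs the count for \<open>m - d\<close>, so
  \<open>m\<close> is kept free; the degree bound makes that subtraction exact.\<close>

lemma card_polys_below_free:
  fixes S :: "'a :: {field, finite} poly set"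
  assumes "finite S" "S \<subseteq> irr_polys" "(\<Sum>p\<in>S. degree p) \<le> m"
  shows "real (card {f \<in> polys_below m. \<forall>r\<in>S. \<not> r dvd f}) =
    real CARD('a) ^ m * (\<Prod>p\<in>S. 1 - 1 / real CARD('a) ^ degree p)"
  using assms
proof (induction S arbitrary: m)
  case empty
  then show ?case by (simp add: card_polys_below)
next
  case (insert p S)
  define d where "d = degree p"
  have p: "p \<in> irr_polys" using insert.prems by simp
  have d: "d \<le> m" "(\<Sum>p\<in>S. degree p) \<le> m" "(\<Sum>p\<in>S. degree p) \<le> m - d"
    using insert.prems(2) insert.hyps by (auto simp: d_def)
  have "p * g \<in> polys_below m \<longleftrightarrow> g \<in> polys_below (m - d)" for g
    using irr_polysD(3)[OF p] by (cases "g = 0") (auto simp: polys_below_def d_def degree_mult_eq)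
  then have "card {f \<in> polys_below m. \<forall>r\<in>insert p S. \<not> r dvd f} + card {g \<in> polys_below (m - d). \<forall>r\<in>S. \<not> r dvd g} =
    card {f \<in> polys_below m. \<forall>r\<in>S. \<not> r dvd f}"
    using sieve_step[OF finite_polys_below p insert.hyps(2), of m] insert.prems(1) by simp
  then have "real (card {f \<in> polys_below m. \<forall>r\<in>insert p S. \<not> r dvd f}) =
    real (card {f \<in> polys_below m. \<forall>r\<in>S. \<not> r dvd f}) - real (card {g \<in> polys_below (m - d). \<forall>r\<in>S. \<not> r dvd g})"
    by linarith
  also have "\<dots> = (real CARD('a) ^ m - real CARD('a) ^ (m - d)) * (\<Prod>p\<in>S. 1 - 1 / real CARD('a) ^ degree p)"
    using insert.IH[of m] insert.IH[of "m - d"] insert.prems(1) d by (simp add: algebra_simps)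
  also have "real CARD('a) ^ m - real CARD('a) ^ (m - d) = real CARD('a) ^ m * (1 - 1 / real CARD('a) ^ d)"
    using d(1) by (simp add: power_diff algebra_simps)
  finally show ?case using insert.hyps by (simp add: d_def mult_ac)
qed

text \<open>The order of the unit group modulo \<open>\<Prod>S\<close>, the analogue of Euler's phi
  function.\<close>

lemma card_residues_free:
  fixes S :: "'a :: {field, finite} poly set"
  assumes "finite S" "S \<subseteq> irr_polys"
  shows "real (card {f \<in> polys_below (\<Sum>p\<in>S. degree p). \<forall>r\<in>S. \<not> r dvd f}) =
    (\<Prod>p\<in>S. real CARD('a) ^ degree p - 1)"
  unfolding card_polys_below_free[OF assms order.refl] power_sum prod.distrib[symmetric]
  by (intro prod.cong) (auto simp: right_diff_distrib)

section \<open>Separability and roots in the algebraic closure\<close>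

interpretation to_ac: field_hom "to_ac :: 'a :: field \<Rightarrow> 'a alg_closure"
  by unfold_locales auto

interpretation to_ac_poly: map_poly_comm_ring_hom "to_ac :: 'a :: field \<Rightarrow> 'a alg_closure" ..

text \<open>A polynomial with vanishing derivative is a \<open>p\<close>-th power, since every element of a finite
  field of characteristic \<open>p\<close> is a \<open>p\<close>-th power.\<close>

lemma pderiv_irreducible_nonzero:
  fixes p :: "'a :: {field, finite} poly"
  assumes p: "irreducible p"
  shows "pderiv p \<noteq> 0"
proof
  assume pd: "pderiv p = 0"
  define c where "c = CHAR('a)"
  have "prime c"
    unfolding c_def using finite_imp_CHAR_pos[where ?'a = 'a] by (intro prime_CHAR_semidom) auto
  then have c2: "c \<ge> 2" and prime: "prime CHAR('a)" "prime CHAR('a poly)"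
    by (auto simp: prime_ge_2_nat c_def)
  have inj: "inj (\<lambda>x :: 'a. x ^ c)"
  proof (rule injI)
    fix x y :: 'a assume "x ^ c = y ^ c"
    \<comment> \<open>Additivity of the \<open>c\<close>-th power yields
      \<open>(x - y) ^ c = 0\<close>.\<close>
    moreover have "((x - y) + y) ^ c = (x - y) ^ c + y ^ c"
      unfolding c_def by (rule freshmans_dream[OF prime(1) refl])
    ultimately show "x = y" by simp
  qed
  have "\<exists>y. y ^ c = x" for x :: 'a
    using finite_UNIV_inj_surj[OF _ inj] by (metis finite surjD)
  then obtain rt where rt: "\<And>x :: 'a. rt x ^ c = x" by metis
  \<comment> \<open>\<open>g ^ c\<close> has the coefficient of \<open>p\<close> at each exponent
    \<open>c * i\<close>, and \<open>p\<close> has no other nonzero coefficients.\<close>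
  define g where "g = (\<Sum>i\<le>degree p. monom (rt (coeff p (c * i))) i)"
  have nz: "c dvd i" if "coeff p i \<noteq> 0" for i
  proof (cases i)
    case (Suc k)
    have "of_nat (Suc k) * coeff p (Suc k) = 0"
      using arg_cong[OF pd, of "\<lambda>f. coeff f k"] by (simp add: coeff_pderiv)
    then have "of_nat (Suc k) = (0 :: 'a)" using that Suc by simp
    then show ?thesis unfolding c_def Suc of_nat_eq_0_iff_char_dvd .
  qed simp
  have "g ^ c = (\<Sum>i\<le>degree p. monom (rt (coeff p (c * i))) i ^ c)"
    unfolding g_def by (rule freshmans_dream_sum[OF prime(2)]) (simp add: c_def)
  also have "\<dots> = (\<Sum>i\<le>degree p. monom (coeff p (c * i)) (c * i))"
    by (simp add: monom_power rt mult.commute)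
  also have "\<dots> = p"
  proof (rule poly_eqI)
    fix k
    show "coeff (\<Sum>i\<le>degree p. monom (coeff p (c * i)) (c * i)) k = coeff p k"
    proof (cases "c dvd k \<and> k \<le> degree p")
      case True
      then obtain j where j: "k = c * j" by (auto elim: dvdE)
      have "j \<le> c * j" using c2 by simp
      then have "j \<le> degree p" using True j by linarith
      have "coeff (\<Sum>i\<le>degree p. monom (coeff p (c * i)) (c * i)) k =
          (\<Sum>i\<le>degree p. if i = j then coeff p k else 0)"
        unfolding coeff_sum using c2 j by (intro sum.cong) auto
      then show ?thesis using \<open>j \<le> degree p\<close> by simp
    next
      case False
      then have "coeff p k = 0" using nz[of k] coeff_eq_0[of p k] by force
      moreover have "coeff (monom (coeff p (c * i)) (c * i)) k = 0" for i
        using \<open>coeff p k = 0\<close> by auto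
      ultimately show ?thesis by (simp add: coeff_sum)
    qed
  qed
  finally have g: "p = g * g ^ (c - 1)" using c2 by (cases c) auto
  have "\<not> is_unit g"
  proof
    assume u: "is_unit g"
    then have "is_unit (g ^ (c - 1))" using is_unit_power_iff by blast
    from mult_dvd_mono[OF u this] have "is_unit p" using g by simp
    then show False using p by (auto simp: Factorial_Ring.irreducible_def)
  qed
  moreover have "is_unit g \<or> is_unit (g ^ (c - 1))"
    using Factorial_Ring.irreducibleD[OF p g] .
  ultimately have "c - 1 = 0" unfolding is_unit_power_iff by blast
  then show False using c2 by simp
qed

text \<open>Over an algebraically closed field the roots form a multiset of size
  \<open>degree f\<close>; a root occurring twice would also be a root of the derivative.\<close>

lemma card_roots_eq_degree:
  fixes f :: "'a :: alg_closed_field poly"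
  assumes f: "f \<noteq> 0" and simple: "\<And>x. poly f x = 0 \<Longrightarrow> poly (pderiv f) x \<noteq> 0"
  shows "card {x. poly f x = 0} = degree f"
proof -
  obtain M where M: "size M = degree f" "f = smult (lead_coeff f) (\<Prod>x\<in>#M. [:- x, 1:])"
    using alg_closed_imp_factorization[OF f] by blast
  have lc: "lead_coeff f \<noteq> 0" using f by simp
  have root: "poly (\<Prod>x\<in>#N. [:- x, 1:]) x = 0 \<longleftrightarrow> x \<in># N" for N and x :: 'a
    by (induction N) auto
  have "count M x \<le> 1" for x
  proof (rule ccontr)
    assume "\<not> count M x \<le> 1"
    then have "{#x, x#} \<subseteq># M" by (simp add: subseteq_mset_def)
    then obtain N where "M = {#x, x#} + N" by (auto simp: subset_mset.le_iff_add)
    define h where "h = smult (lead_coeff f) (\<Prod>x\<in>#N. [:- x, 1:])"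
    have fx: "f = [:- x, 1:] * ([:- x, 1:] * h)"
      by (subst M(2)) (simp add: \<open>M = {#x, x#} + N\<close> h_def)
    have "poly f x = 0"
      by (subst fx) (simp only: poly_mult, simp)
    moreover have "poly (pderiv f) x = 0"
      by (subst fx) (simp only: pderiv_mult poly_mult poly_add, simp)
    ultimately show False using simple by blast
  qed
  then have "M = mset_set (set_mset M)"
    by (intro multiset_eqI) (metis Suc_leI count_greater_zero_iff count_mset_set(1) count_mset_set(3) finite_set_mset le_antisym not_gr_zero One_nat_def not_in_iff)
  then have "size M = card (set_mset M)"
    by (metis size_mset_set)
  moreover have "{x. poly f x = 0} = set_mset M"
    using lc by (subst M(2)) (auto simp: root)
  ultimately show ?thesis using M(1) by simp
qed

lemma bezout_no_common_root:
  fixes p g :: "'a :: field poly"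
  assumes "irreducible p" "\<not> p dvd g" "poly (map_poly to_ac p) x = 0"
  shows "poly (map_poly to_ac g) x \<noteq> 0"
proof
  assume g: "poly (map_poly to_ac g) x = 0"
  obtain u v where uv: "u * p + v * g = 1"
    using irreducible_bezout[OF assms(1,2)] by blast
  have "map_poly to_ac u * map_poly to_ac p + map_poly to_ac v * map_poly to_ac g = 1"
    using arg_cong[OF uv, of "map_poly to_ac"]
    by (simp add: to_ac_poly.hom_add to_ac_poly.hom_mult)
  from arg_cong[OF this, of "\<lambda>f. poly f x"] show False
    using g assms(3) by simp
qed

text \<open>\<open>pderiv p\<close> is nonzero of smaller degree than \<open>p\<close>, hence not
  divisible by it, and Bezout's identity excludes a common root.\<close>

lemma card_roots_irr:
  fixes p :: "'a :: {field, finite} poly"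
  assumes p: "p \<in> irr_polys"
  shows "card {x. poly (map_poly to_ac p) x = 0} = degree p"
proof -
  have "\<not> p dvd pderiv p"
  proof
    assume "p dvd pderiv p"
    then have "degree p \<le> degree (pderiv p)"
      using pderiv_irreducible_nonzero irr_polysD(1)[OF p] by (intro dvd_imp_degree_le) auto
    also have "degree (pderiv p) \<le> degree p - 1"
      by (intro degree_le) (auto simp: coeff_pderiv coeff_eq_0)
    also have "\<dots> < degree p" using irr_polysD(4)[OF p] by simp
    finally show False by simp
  qed
  then have "poly (pderiv (map_poly to_ac p)) x \<noteq> 0" if "poly (map_poly to_ac p) x = 0" for x
    unfolding to_ac.map_poly_pderiv[symmetric]
    by (rule bezout_no_common_root[OF irr_polysD(1)[OF p] _ that])
  then show ?thesis
    using card_roots_eq_degree[of "map_poly to_ac p"] irr_polysD(3)[OF p] by simp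
qed

lemma card_roots_prod_irr:
  fixes S :: "'a :: {field, finite} poly set"
  assumes S: "finite S" "S \<subseteq> irr_polys"
  shows "card {x. poly (map_poly to_ac (\<Prod>S)) x = 0} = degree (\<Prod>S)"
proof -
  have "{x. poly (map_poly to_ac (\<Prod>S)) x = 0} = (\<Union>p\<in>S. {x. poly (map_poly to_ac p) x = 0})"
    using S(1) by (auto simp: to_ac_poly.hom_prod poly_prod)
  also have "card \<dots> = (\<Sum>p\<in>S. card {x. poly (map_poly to_ac p) x = 0})"
  proof (rule card_UN_disjoint[OF S(1)])
    show "\<forall>p\<in>S. finite {x. poly (map_poly to_ac p) x = 0}"
    proof
      fix p assume "p \<in> S"
      then have "map_poly to_ac p \<noteq> 0" using S(2) irr_polysD(3)[of p] by auto
      then show "finite {x. poly (map_poly to_ac p) x = 0}" by (rule poly_roots_finite)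
    qed
    show "\<forall>p\<in>S. \<forall>r\<in>S. p \<noteq> r \<longrightarrow> {x. poly (map_poly to_ac p) x = 0} \<inter> {x. poly (map_poly to_ac r) x = 0} = {}"
    proof (intro ballI impI)
      fix p r assume "p \<in> S" "r \<in> S" "p \<noteq> r"
      then have "irreducible p" "\<not> p dvd r"
        using S(2) irr_polysD(1) irr_dvd_irr by blast+
      then show "{x. poly (map_poly to_ac p) x = 0} \<inter> {x. poly (map_poly to_ac r) x = 0} = {}"
        using bezout_no_common_root by blast
    qed
  qed
  also have "\<dots> = (\<Sum>p\<in>S. degree p)"
    using S(2) card_roots_irr by (intro sum.cong) auto
  finally show ?thesis using degree_prod_irr[OF S] by simp
qed

text \<open>If \<open>f = p * p * h\<close>, all roots of \<open>f\<close> are roots of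
  \<open>p * h\<close>, whose degree is too small.\<close>

lemma card_roots_imp_prod_irr:
  fixes f :: "'a :: field poly"
  assumes f: "lead_coeff f = 1" and card: "card {x. poly (map_poly to_ac f) x = 0} = degree f"
  shows "\<exists>S. finite S \<and> S \<subseteq> irr_polys \<and> \<Prod>S = f"
proof (rule squarefree_eq_prod_irr[OF f])
  fix p :: "'a poly" assume p: "p \<in> irr_polys"
  show "\<not> p * p dvd f"
  proof
    assume "p * p dvd f"
    then obtain h where h: "f = p * p * h" by (elim dvdE)
    have nz: "p \<noteq> 0" "h \<noteq> 0" using f h by auto
    have "{x. poly (map_poly to_ac f) x = 0} = {x. poly (map_poly to_ac (p * h)) x = 0}"
      by (auto simp: h to_ac_poly.hom_mult)
    then have "degree f \<le> degree (map_poly to_ac (p * h))"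
      using card_poly_roots_bound[of "map_poly to_ac (p * h)"] card nz by simp
    then show False
      using nz irr_polysD(4)[OF p] by (simp add: h degree_mult_eq)
  qed
qed

section \<open>Cyclic vectors\<close>

definition mat_poly :: "nat \<Rightarrow> 'a :: comm_ring_1 mat \<Rightarrow> 'a poly \<Rightarrow> 'a mat" where
  "mat_poly n A p = fold_coeffs (\<lambda>c M. c \<cdot>\<^sub>m 1\<^sub>m n + A * M) p (0\<^sub>m n n)"

context
  fixes n :: nat and A :: "'a :: comm_ring_1 mat"
  assumes A [simp]: "A \<in> carrier_mat n n"
begin

lemma mat_poly_0 [simp]: "mat_poly n A 0 = 0\<^sub>m n n"
  by (simp add: mat_poly_def)

lemma mat_poly_pCons: "mat_poly n A (pCons c p) = c \<cdot>\<^sub>m 1\<^sub>m n + A * mat_poly n A p"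
\<comment> \<open>\<open>pCons 0 0\<close> is the zero polynomial, on which
  \<open>fold_coeffs\<close> performs no step.\<close>
proof (cases "c = 0 \<and> p = 0")
  case True
  then have "mat_poly n A (pCons c p) = 0\<^sub>m n n" by simp
  also have "\<dots> = 0 \<cdot>\<^sub>m 1\<^sub>m n + A * 0\<^sub>m n n"
    unfolding right_mult_zero_mat[OF A] by (intro eq_matI) auto
  finally show ?thesis using True by simp
next
  case False
  then show ?thesis by (auto simp: mat_poly_def)
qed

lemma mat_poly_carrier [simp]: "mat_poly n A p \<in> carrier_mat n n"
proof (induction p)
  case (pCons a p)
  then show ?case
    unfolding mat_poly_pCons using mult_carrier_mat[OF A pCons.IH] by (intro add_carrier_mat) auto
qed simp

lemma mat_poly_dims: "dim_row A = n" "dim_col A = n" "dim_row (mat_poly n A p) = n" "dim_col (mat_poly n A p) = n"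
  using carrier_matD[OF A] carrier_matD[OF mat_poly_carrier] by auto

lemma mat_poly_add: "mat_poly n A (p + q) = mat_poly n A p + mat_poly n A q"
proof (induction p q rule: poly_induct2)
  case (pCons a p b q)
  have "mat_poly n A (pCons a p + pCons b q) = (a + b) \<cdot>\<^sub>m 1\<^sub>m n + A * (mat_poly n A p + mat_poly n A q)"
    by (simp add: mat_poly_pCons pCons.IH)
  also have "A * (mat_poly n A p + mat_poly n A q) = A * mat_poly n A p + A * mat_poly n A q"
    by (rule mult_add_distrib_mat[OF A mat_poly_carrier mat_poly_carrier])
  finally show ?case
    unfolding mat_poly_pCons by (intro eq_matI) (auto simp: mat_poly_dims algebra_simps)
qed (auto intro!: eq_matI)

lemma mat_poly_smult: "mat_poly n A (smult c p) = c \<cdot>\<^sub>m mat_poly n A p"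
proof (induction p)
  case (pCons a p)
  have "A * (c \<cdot>\<^sub>m mat_poly n A p) = c \<cdot>\<^sub>m (A * mat_poly n A p)"
    by (rule mult_smult_distrib[OF A mat_poly_carrier])
  then show ?case
    unfolding smult_pCons mat_poly_pCons pCons.IH by (intro eq_matI) (auto simp: mat_poly_dims algebra_simps)
qed (auto intro!: eq_matI)

lemma mat_poly_mult: "mat_poly n A (p * q) = mat_poly n A p * mat_poly n A q"
proof (induction p)
  case (pCons a p)
  have "mat_poly n A (pCons a p * q) = a \<cdot>\<^sub>m mat_poly n A q + (0 \<cdot>\<^sub>m 1\<^sub>m n + A * (mat_poly n A p * mat_poly n A q))"
    by (simp add: mult_pCons_left mat_poly_add mat_poly_smult mat_poly_pCons pCons.IH)
  also have "\<dots> = a \<cdot>\<^sub>m mat_poly n A q + A * (mat_poly n A p * mat_poly n A q)"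
    by (intro eq_matI) (auto simp: mat_poly_dims)
  also have "A * (mat_poly n A p * mat_poly n A q) = A * mat_poly n A p * mat_poly n A q"
    by (rule assoc_mult_mat[OF A mat_poly_carrier mat_poly_carrier, symmetric])
  also have "a \<cdot>\<^sub>m mat_poly n A q = (a \<cdot>\<^sub>m 1\<^sub>m n) * mat_poly n A q"
    unfolding mult_smult_assoc_mat[OF one_carrier_mat mat_poly_carrier] left_mult_one_mat[OF mat_poly_carrier] ..
  also have "\<dots> + A * mat_poly n A p * mat_poly n A q = (a \<cdot>\<^sub>m 1\<^sub>m n + A * mat_poly n A p) * mat_poly n A q"
    by (rule add_mult_distrib_mat[OF _ mult_carrier_mat[OF A mat_poly_carrier] mat_poly_carrier, symmetric]) simp
  finally show ?case by (simp add: mat_poly_pCons)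
qed (simp add: left_mult_zero_mat[OF mat_poly_carrier])

lemma mat_poly_1 [simp]: "mat_poly n A 1 = 1\<^sub>m n"
  unfolding one_pCons mat_poly_pCons mat_poly_0 right_mult_zero_mat[OF A] by (intro eq_matI) auto

context
  fixes v :: "'a vec"
  assumes v [simp]: "v \<in> carrier_vec n"
begin

lemma mat_poly_vec_carrier [simp]: "mat_poly n A f *\<^sub>v v \<in> carrier_vec n"
  by (rule mult_mat_vec_carrier[OF mat_poly_carrier v])

lemma mat_poly_vec_mult: "mat_poly n A (f * g) *\<^sub>v v = mat_poly n A f *\<^sub>v (mat_poly n A g *\<^sub>v v)"
  unfolding mat_poly_mult by (rule assoc_mult_mat_vec[OF mat_poly_carrier mat_poly_carrier v])

lemma mat_poly_vec_add: "mat_poly n A (f + g) *\<^sub>v v = mat_poly n A f *\<^sub>v v + mat_poly n A g *\<^sub>v v"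
  unfolding mat_poly_add by (rule add_mult_distrib_mat_vec[OF mat_poly_carrier mat_poly_carrier v])

lemma mat_poly_vec_smult_index:
  assumes i: "i < n"
  shows "(mat_poly n A (smult c f) *\<^sub>v v) $ i = c * (mat_poly n A f *\<^sub>v v) $ i"
  using i smult_scalar_prod_distrib[OF row_carrier_vec[OF i mat_poly_carrier] v, of c f]
  by (simp add: mat_poly_smult mat_poly_dims)

lemma mat_poly_vec_0 [simp]: "mat_poly n A 0 *\<^sub>v v = 0\<^sub>v n"
  by (intro eq_vecI) auto

lemma mat_poly_vec_1 [simp]: "mat_poly n A 1 *\<^sub>v v = v"
  by simp

lemma mat_poly_vec_sum_index:
  assumes i: "i < n"
  shows "(mat_poly n A (\<Sum>j\<in>J. smult (c j) (g j)) *\<^sub>v v) $ i = (\<Sum>j\<in>J. c j * (mat_poly n A (g j) *\<^sub>v v) $ i)"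
proof (induction J rule: infinite_finite_induct)
  case (insert j J)
  have "(mat_poly n A (\<Sum>j\<in>insert j J. smult (c j) (g j)) *\<^sub>v v) $ i =
      (mat_poly n A (smult (c j) (g j)) *\<^sub>v v) $ i + (mat_poly n A (\<Sum>j\<in>J. smult (c j) (g j)) *\<^sub>v v) $ i"
    using insert.hyps i by (simp add: mat_poly_vec_add mat_poly_dims del: index_mult_mat_vec)
  then show ?case
    using insert i by (simp add: mat_poly_vec_smult_index del: index_mult_mat_vec)
qed (use i in auto)

lemma mat_poly_vec_dvd:
  assumes "f dvd h" "mat_poly n A f *\<^sub>v v = 0\<^sub>v n"
  shows "mat_poly n A h *\<^sub>v v = 0\<^sub>v n"
proof -
  obtain k where "h = k * f" using assms(1) by (metis dvdE mult.commute)
  then have "mat_poly n A h *\<^sub>v v = mat_poly n A k *\<^sub>v 0\<^sub>v n"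
    by (simp add: mat_poly_vec_mult assms(2))
  also have "\<dots> = 0\<^sub>v n"
    using carrier_matD[OF mat_poly_carrier[of k]] by (intro eq_vecI) auto
  finally show ?thesis .
qed

lemma mat_poly_vec_monom_Suc:
  "mat_poly n A (monom 1 (Suc j)) *\<^sub>v v = A *\<^sub>v (mat_poly n A (monom 1 j) *\<^sub>v v)"
proof -
  have "mat_poly n A (monom 1 (Suc j)) = A * mat_poly n A (monom 1 j)"
    unfolding monom_Suc mat_poly_pCons by (intro eq_matI) (auto simp: mat_poly_dims)
  then show ?thesis
    using assoc_mult_mat_vec[OF A mat_poly_carrier v] by simp
qed

end

end

section \<open>Krylov matrices\<close>

definition krylov :: "nat \<Rightarrow> 'a :: comm_ring_1 mat \<Rightarrow> 'a vec \<Rightarrow> 'a mat" where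
  "krylov n A v = mat n n (\<lambda>(i, j). (mat_poly n A (monom 1 j) *\<^sub>v v) $ i)"

lemma krylov_carrier [simp]: "krylov n A v \<in> carrier_mat n n"
  by (simp add: krylov_def)

text \<open>Stated through the Krylov matrix because the count rests on \<open>krylov\<close> being
  a bijection onto \<open>GL n\<close>; \<open>cyclic_vec_iff\<close> gives the form used for
  polynomials.\<close>

definition cyclic_vec :: "nat \<Rightarrow> 'a :: field mat \<Rightarrow> 'a vec \<Rightarrow> bool" where
  "cyclic_vec n A v \<longleftrightarrow> krylov n A v \<in> GL n"

lemma poly_eq_sum_smult_monom:
  assumes "f \<in> polys_below n"
  shows "f = (\<Sum>j<n. smult (coeff f j) (monom 1 j))"
  using assms by (intro poly_eqI) (auto simp: coeff_sum polys_below_iff mult_delta_right)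

lemma vec_eq_coeff:
  assumes "(c :: 'a :: field vec) \<in> carrier_vec n"
  obtains f where "f \<in> polys_below n" "c = vec n (coeff f)"
proof
  show "(\<Sum>j<n. smult (c $ j) (monom 1 j)) \<in> polys_below n"
    by (auto simp: polys_below_iff coeff_sum intro!: sum.neutral)
  show "c = vec n (coeff (\<Sum>j<n. smult (c $ j) (monom 1 j)))"
    using assms by (intro eq_vecI) (auto simp: coeff_sum mult_delta_right)
qed

context
  fixes n :: nat and A :: "'a :: field mat" and v :: "'a vec"
  assumes A: "A \<in> carrier_mat n n" and v: "v \<in> carrier_vec n"
begin

lemma col_krylov: "j < n \<Longrightarrow> col (krylov n A v) j = mat_poly n A (monom 1 j) *\<^sub>v v"
  using mat_poly_vec_carrier[OF A v, of "monom 1 j"]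
  by (intro eq_vecI) (auto simp: krylov_def simp del: dim_mult_mat_vec)

lemma krylov_mult_vec:
  assumes f: "f \<in> polys_below n"
  shows "krylov n A v *\<^sub>v vec n (coeff f) = mat_poly n A f *\<^sub>v v"
proof (rule eq_vecI)
  have d: "dim_vec (mat_poly n A f *\<^sub>v v) = n"
    using mat_poly_vec_carrier[OF A v] carrier_vecD by blast
  show "dim_vec (krylov n A v *\<^sub>v vec n (coeff f)) = dim_vec (mat_poly n A f *\<^sub>v v)"
    unfolding d by (simp add: krylov_def)
  fix i assume "i < dim_vec (mat_poly n A f *\<^sub>v v)"
  then have i: "i < n" using d by simp
  have "(krylov n A v *\<^sub>v vec n (coeff f)) $ i = (\<Sum>j<n. coeff f j * (mat_poly n A (monom 1 j) *\<^sub>v v) $ i)"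
  proof -
    have "(krylov n A v *\<^sub>v vec n (coeff f)) $ i = (\<Sum>j<n. krylov n A v $$ (i, j) * coeff f j)"
      using i by (simp add: krylov_def scalar_prod_def lessThan_atLeast0)
    also have "\<dots> = (\<Sum>j<n. coeff f j * (mat_poly n A (monom 1 j) *\<^sub>v v) $ i)"
      using i by (intro sum.cong) (auto simp: krylov_def simp del: index_mult_mat_vec)
    finally show ?thesis .
  qed
  also have "\<dots> = (mat_poly n A (\<Sum>j<n. smult (coeff f j) (monom 1 j)) *\<^sub>v v) $ i"
    by (rule mat_poly_vec_sum_index[OF A v i, symmetric])
  also have "(\<Sum>j<n. smult (coeff f j) (monom 1 j)) = f"
    by (rule poly_eq_sum_smult_monom[OF f, symmetric])
  finally show "(krylov n A v *\<^sub>v vec n (coeff f)) $ i = (mat_poly n A f *\<^sub>v v) $ i" .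
qed

text \<open>The kernel vectors of the Krylov matrix are the coefficient vectors of the polynomials
  in \<open>polys_below n\<close> that annihilate \<open>v\<close>.\<close>

lemma cyclic_vec_iff:
  "cyclic_vec n A v \<longleftrightarrow> (\<forall>f\<in>polys_below n. mat_poly n A f *\<^sub>v v = 0\<^sub>v n \<longrightarrow> f = 0)"
proof -
  have "det (krylov n A v) = 0 \<longleftrightarrow> (\<exists>c. c \<in> carrier_vec n \<and> c \<noteq> 0\<^sub>v n \<and> krylov n A v *\<^sub>v c = 0\<^sub>v n)"
    by (rule det_0_iff_vec_prod_zero[OF krylov_carrier])
  also have "\<dots> \<longleftrightarrow> (\<exists>f\<in>polys_below n. f \<noteq> 0 \<and> mat_poly n A f *\<^sub>v v = 0\<^sub>v n)"
  proof
    assume "\<exists>c. c \<in> carrier_vec n \<and> c \<noteq> 0\<^sub>v n \<and> krylov n A v *\<^sub>v c = 0\<^sub>v n"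
    then obtain c where c: "c \<in> carrier_vec n" "c \<noteq> 0\<^sub>v n" "krylov n A v *\<^sub>v c = 0\<^sub>v n" by blast
    obtain f where f: "f \<in> polys_below n" "c = vec n (coeff f)" using vec_eq_coeff[OF c(1)] .
    have "f \<noteq> 0" using c(2) f(2) by auto
    then show "\<exists>f\<in>polys_below n. f \<noteq> 0 \<and> mat_poly n A f *\<^sub>v v = 0\<^sub>v n"
      using f c(3) krylov_mult_vec[OF f(1)] by auto
  next
    assume "\<exists>f\<in>polys_below n. f \<noteq> 0 \<and> mat_poly n A f *\<^sub>v v = 0\<^sub>v n"
    then obtain f where f: "f \<in> polys_below n" "f \<noteq> 0" "mat_poly n A f *\<^sub>v v = 0\<^sub>v n" by blast
    have "vec n (coeff f) \<noteq> 0\<^sub>v n"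
    proof
      assume *: "vec n (coeff f) = 0\<^sub>v n"
      have "coeff f i = 0" for i
        using f(1) arg_cong[OF *, of "\<lambda>c. c $ i"] by (cases "i < n") (auto simp: polys_below_iff)
      then show False using f(2) by (simp add: poly_eq_iff)
    qed
    then show "\<exists>c. c \<in> carrier_vec n \<and> c \<noteq> 0\<^sub>v n \<and> krylov n A v *\<^sub>v c = 0\<^sub>v n"
      using krylov_mult_vec[OF f(1)] f(3) by (intro exI[of _ "vec n (coeff f)"]) auto
  qed
  finally show ?thesis
    unfolding cyclic_vec_def GL_iff_det by auto
qed

lemma cyclic_vec_surj:
  assumes "cyclic_vec n A v" "w \<in> carrier_vec n"
  obtains f where "f \<in> polys_below n" "w = mat_poly n A f *\<^sub>v v"
proof -
  obtain B where B: "B \<in> carrier_mat n n" "krylov n A v * B = 1\<^sub>m n"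
    using GL_inverse assms(1) unfolding cyclic_vec_def by blast
  obtain f where f: "f \<in> polys_below n" "B *\<^sub>v w = vec n (coeff f)"
    using vec_eq_coeff[OF mult_mat_vec_carrier[OF B(1) assms(2)]] .
  have "w = krylov n A v *\<^sub>v (B *\<^sub>v w)"
    using assoc_mult_mat_vec[OF krylov_carrier B(1) assms(2), of A v] B(2) assms(2) by simp
  then show thesis
    using that f krylov_mult_vec[OF f(1)] by metis
qed

end

lemma polys_below_degree: "f \<noteq> 0 \<Longrightarrow> f \<in> polys_below m \<longleftrightarrow> degree f < m"
  by (simp add: polys_below_def)

lemma monic_minus_monom:
  assumes "lead_coeff \<phi> = 1" "degree \<phi> = n"
  shows "\<phi> - monom 1 n \<in> polys_below n"
  using assms coeff_eq_0[of \<phi>] by (auto simp: polys_below_iff le_less)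

text \<open>The columns of the common Krylov matrix are a basis on which \<open>A\<close> is known:
  each column goes to the next, and the last to the combination dictated by
  \<open>\<phi>\<close>.\<close>

lemma krylov_inject:
  fixes A A' :: "'a :: field mat"
  assumes n: "0 < n" and \<phi>: "lead_coeff \<phi> = 1" "degree \<phi> = n"
    and A: "A \<in> carrier_mat n n" "v \<in> carrier_vec n" "mat_poly n A \<phi> *\<^sub>v v = 0\<^sub>v n" "cyclic_vec n A v"
    and A': "A' \<in> carrier_mat n n" "v' \<in> carrier_vec n" "mat_poly n A' \<phi> *\<^sub>v v' = 0\<^sub>v n"
    and K: "krylov n A v = krylov n A' v'"
  shows "A = A'" "v = v'"
proof -
  have v0: "col (krylov n A v) 0 = v" if "A \<in> carrier_mat n n" "v \<in> carrier_vec n" for A :: "'a mat" and v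
    using col_krylov[OF that n] mat_poly_vec_1[OF that] by simp
  show "v = v'" using v0[OF A(1,2)] v0[OF A'(1,2)] K by simp
  define \<psi> where "\<psi> = \<phi> - monom 1 n"
  have \<psi>: "\<psi> \<in> polys_below n" unfolding \<psi>_def by (rule monic_minus_monom[OF \<phi>])
  have step: "A *\<^sub>v col (krylov n A v) j =
      (if Suc j < n then col (krylov n A v) (Suc j) else - (krylov n A v *\<^sub>v vec n (coeff \<psi>)))"
    if "A \<in> carrier_mat n n" "v \<in> carrier_vec n" "mat_poly n A \<phi> *\<^sub>v v = 0\<^sub>v n" "j < n" for A :: "'a mat" and v j
  proof -
    have *: "A *\<^sub>v col (krylov n A v) j = mat_poly n A (monom 1 (Suc j)) *\<^sub>v v"
      using that by (simp add: col_krylov mat_poly_vec_monom_Suc)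
    show ?thesis
    proof (cases "Suc j < n")
      case True
      then show ?thesis using * that by (simp add: col_krylov)
    next
      case False
      then have j: "Suc j = n" using that by simp
      have "\<phi> = monom 1 n + \<psi>" by (simp add: \<psi>_def)
      then have "mat_poly n A (monom 1 n) *\<^sub>v v + mat_poly n A \<psi> *\<^sub>v v = 0\<^sub>v n"
        using that(3) mat_poly_vec_add[OF that(1,2)] by simp
      then have "mat_poly n A (monom 1 n) *\<^sub>v v = - (mat_poly n A \<psi> *\<^sub>v v)"
        using carrier_vecD[OF mat_poly_vec_carrier[OF that(1,2)]]
        by (simp add: vec_eq_iff eq_neg_iff_add_eq_0 del: index_mult_mat_vec dim_mult_mat_vec)
      then show ?thesis using * j krylov_mult_vec[OF that(1,2) \<psi>] by simp
    qed
  qed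
  have "A * krylov n A v = A' * krylov n A v"
  proof (rule mat_col_eqI)
    fix j assume "j < dim_col (A' * krylov n A v)"
    then have j: "j < n" using krylov_carrier[of n A v] by simp
    have "col (A * krylov n A v) j = A *\<^sub>v col (krylov n A v) j"
      by (rule col_mult2[OF A(1) krylov_carrier j])
    also have "\<dots> = A' *\<^sub>v col (krylov n A v) j"
      using step[OF A(1-3) j] step[OF A'(1-3) j] K by simp
    also have "\<dots> = col (A' * krylov n A v) j"
      by (rule col_mult2[OF A'(1) krylov_carrier j, symmetric])
    finally show "col (A * krylov n A v) j = col (A' * krylov n A v) j" .
  qed (use A(1) A'(1) in auto)
  moreover obtain B where B: "B \<in> carrier_mat n n" "krylov n A v * B = 1\<^sub>m n"
    using GL_inverse A(4) unfolding cyclic_vec_def by blast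
  ultimately have "A * krylov n A v * B = A' * krylov n A v * B" by simp
  then show "A = A'"
    using B A(1) A'(1) assoc_mult_mat[OF A(1) krylov_carrier B(1), of A v] assoc_mult_mat[OF A'(1) krylov_carrier B(1), of A v]
    by simp
qed

text \<open>The companion matrix \<open>C\<close> of \<open>\<phi>\<close> shifts the standard
  basis; conjugation by \<open>g\<close> makes it shift the columns of \<open>g\<close>
  instead.\<close>

lemma krylov_surj:
  fixes g :: "'a :: field mat"
  assumes n: "0 < n" and \<phi>: "lead_coeff \<phi> = 1" "degree \<phi> = n" and g: "g \<in> GL n"
  obtains A v where "A \<in> carrier_mat n n" "v \<in> carrier_vec n" "mat_poly n A \<phi> *\<^sub>v v = 0\<^sub>v n" "krylov n A v = g"
proof -
  have gc: "g \<in> carrier_mat n n" using g by (simp add: GL_def)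
  obtain h where h: "h \<in> carrier_mat n n" "g * h = 1\<^sub>m n" "h * g = 1\<^sub>m n" using GL_inverse[OF g] by blast
  define C where "C = mat n n (\<lambda>(i, j). if Suc j < n then if i = Suc j then 1 else 0 else - coeff \<phi> i)"
  define A where "A = g * C * h"
  define v where "v = col g 0"
  have C: "C \<in> carrier_mat n n" by (simp add: C_def)
  have A: "A \<in> carrier_mat n n" using gc C h by (simp add: A_def)
  have v: "v \<in> carrier_vec n" using gc n by (simp add: v_def)
  have Ag: "A * g = g * C"
  proof -
    have "A * g = g * C * (h * g)"
      unfolding A_def using gc C h by (intro assoc_mult_mat) auto
    then show ?thesis using h gc C by simp
  qed
  have Acol: "A *\<^sub>v col g j = g *\<^sub>v col C j" if "j < n" for j
    using col_mult2[OF A gc that] col_mult2[OF gc C that] Ag by simp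
  have pow: "mat_poly n A (monom 1 j) *\<^sub>v v = col g j" if "j < n" for j
    using that
  proof (induction j)
    case 0
    then show ?case using mat_poly_vec_1[OF A v] by (simp add: v_def)
  next
    case (Suc j)
    have "col C j = unit_vec n (Suc j)"
      using Suc.prems by (intro eq_vecI) (auto simp: C_def)
    then have "g *\<^sub>v col C j = col g (Suc j)"
      using gc Suc.prems by (intro eq_vecI) auto
    then show ?case
      using Suc Acol[of j] by (simp add: mat_poly_vec_monom_Suc[OF A v])
  qed
  have K: "krylov n A v = g"
    using gc by (intro mat_col_eqI) (auto simp: col_krylov[OF A v] pow carrier_matD[OF krylov_carrier])
  have "mat_poly n A \<phi> *\<^sub>v v = 0\<^sub>v n"
  proof -
    define \<psi> where "\<psi> = \<phi> - monom 1 n"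
    have \<psi>: "\<psi> \<in> polys_below n" unfolding \<psi>_def by (rule monic_minus_monom[OF \<phi>])
    obtain j where j: "n = Suc j" using n by (cases n) auto
    have "col C j = - vec n (coeff \<psi>)"
      using j by (intro eq_vecI) (auto simp: C_def \<psi>_def)
    then have 1: "mat_poly n A (monom 1 n) *\<^sub>v v = - (g *\<^sub>v vec n (coeff \<psi>))"
      using Acol[of j] pow[of j] j gc mat_poly_vec_monom_Suc[OF A v, of j] by (auto intro!: eq_vecI)
    have 2: "mat_poly n A \<psi> *\<^sub>v v = g *\<^sub>v vec n (coeff \<psi>)"
      using krylov_mult_vec[OF A v \<psi>] K by simp
    have "\<phi> = monom 1 n + \<psi>" by (simp add: \<psi>_def)
    then have "mat_poly n A \<phi> *\<^sub>v v = - (g *\<^sub>v vec n (coeff \<psi>)) + g *\<^sub>v vec n (coeff \<psi>)"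
      using mat_poly_vec_add[OF A v] 1 2 by simp
    then show ?thesis using gc by (auto intro!: eq_vecI)
  qed
  then show thesis using that A v K by blast
qed

text \<open>Annihilation of \<open>v\<close> stands in for a prescribed characteristic polynomial:
  \<open>cyclic_char_poly\<close> turns it into \<open>char_poly A = \<phi>\<close> when
  \<open>\<phi>\<close> is a product of distinct irreducibles.\<close>

lemma card_cyclic_pairs:
  fixes \<phi> :: "'a :: field poly"
  assumes n: "0 < n" and \<phi>: "lead_coeff \<phi> = 1" "degree \<phi> = n"
  shows "card {(A, v). A \<in> carrier_mat n n \<and> v \<in> carrier_vec n \<and> cyclic_vec n A v \<and> mat_poly n A \<phi> *\<^sub>v v = 0\<^sub>v n} =
    card (GL n :: 'a mat set)" (is "card ?X = _")
proof (rule bij_betw_same_card)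
  show "bij_betw (\<lambda>(A, v). krylov n A v) ?X (GL n)"
    unfolding bij_betw_def
  proof
    show "inj_on (\<lambda>(A, v). krylov n A v) ?X"
    proof (rule inj_onI, clarify)
      fix A A' :: "'a mat" and v v'
      assume "A \<in> carrier_mat n n" "v \<in> carrier_vec n" "cyclic_vec n A v" "mat_poly n A \<phi> *\<^sub>v v = 0\<^sub>v n"
        "A' \<in> carrier_mat n n" "v' \<in> carrier_vec n" "mat_poly n A' \<phi> *\<^sub>v v' = 0\<^sub>v n"
        "krylov n A v = krylov n A' v'"
      then show "A = A' \<and> v = v'"
        using krylov_inject[OF n \<phi>, of A v A' v'] by blast
    qed
    show "(\<lambda>(A, v). krylov n A v) ` ?X = GL n"
    proof
      show "(\<lambda>(A, v). krylov n A v) ` ?X \<subseteq> GL n"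
        by (auto simp: cyclic_vec_def)
      show "GL n \<subseteq> (\<lambda>(A, v). krylov n A v) ` ?X"
      proof
        fix g :: "'a mat" assume g: "g \<in> GL n"
        obtain A v where "A \<in> carrier_mat n n" "v \<in> carrier_vec n" "mat_poly n A \<phi> *\<^sub>v v = 0\<^sub>v n" "krylov n A v = g"
          using krylov_surj[OF n \<phi> g] .
        then show "g \<in> (\<lambda>(A, v). krylov n A v) ` ?X"
          using g by (intro image_eqI[of _ _ "(A, v)"]) (simp_all add: cyclic_vec_def)
      qed
    qed
  qed
qed

section \<open>Matrices with a given characteristic polynomial\<close>

lemma mat_poly_linear:
  assumes A: "(A :: 'a :: field mat) \<in> carrier_mat n n"
  shows "mat_poly n A [:- x, 1:] = char_matrix A x"
  using A by (intro eq_matI) (auto simp: mat_poly_pCons[OF A] char_matrix_def right_mult_zero_mat[OF A])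

text \<open>Over the closed field \<open>p\<close> splits, so up to a nonzero scalar
  \<open>det (mat_poly n A p)\<close> is the product of the \<open>det (char_matrix A x)\<close>
  over the roots \<open>x\<close> of \<open>p\<close>.\<close>

lemma det_mat_poly_eq_0_iff:
  fixes A :: "'a :: alg_closed_field mat"
  assumes A: "A \<in> carrier_mat n n" and p: "p \<noteq> 0"
  shows "det (mat_poly n A p) = 0 \<longleftrightarrow> (\<exists>x. poly p x = 0 \<and> poly (char_poly A) x = 0)"
proof -
  obtain M where M: "p = smult (lead_coeff p) (\<Prod>x\<in>#M. [:- x, 1:])"
    using alg_closed_imp_factorization[OF p] by blast
  have lc: "lead_coeff p \<noteq> 0" using p by simp
  have prod: "det (mat_poly n A (\<Prod>x\<in>#N. [:- x, 1:])) = 0 \<longleftrightarrow> (\<exists>x\<in>#N. poly (char_poly A) x = 0)" for N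
  proof (induction N)
    case (add x N)
    have "det (mat_poly n A ([:- x, 1:] * (\<Prod>x\<in>#N. [:- x, 1:]))) =
        det (char_matrix A x) * det (mat_poly n A (\<Prod>x\<in>#N. [:- x, 1:]))"
      unfolding mat_poly_mult[OF A] mat_poly_linear[OF A]
      by (rule det_mult[OF char_matrix_closed[OF A] mat_poly_carrier[OF A]])
    then show ?case
      using add eigenvalue_det[OF A, of x] eigenvalue_root_char_poly[OF A, of x] by auto
  qed (simp add: mat_poly_1[OF A])
  have root: "poly (\<Prod>x\<in>#N. [:- x, 1:]) x = 0 \<longleftrightarrow> x \<in># N" for N and x :: 'a
    by (induction N) auto
  have "det (mat_poly n A p) = lead_coeff p ^ n * det (mat_poly n A (\<Prod>x\<in>#M. [:- x, 1:]))"
    by (subst M) (simp add: mat_poly_smult[OF A] det_smult carrier_matD[OF mat_poly_carrier[OF A]])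
  moreover have "poly p x = 0 \<longleftrightarrow> x \<in># M" for x
    using lc by (subst M) (simp add: root)
  ultimately show ?thesis
    using lc prod by auto
qed

lemma map_mat_mat_poly:
  fixes A :: "'a :: field mat"
  assumes A: "A \<in> carrier_mat n n"
  shows "map_mat to_ac (mat_poly n A p) = mat_poly n (map_mat to_ac A) (map_poly to_ac p)"
proof -
  have A': "map_mat to_ac A \<in> carrier_mat n n" using A by simp
  show ?thesis
  proof (induction p)
    case 0
    then show ?case using mat_poly_0[OF A] mat_poly_0[OF A'] by (auto intro!: eq_matI)
  next
    case (pCons a p)
    have "map_poly to_ac (pCons a p) = pCons (to_ac a) (map_poly to_ac p)"
      using pCons.hyps by (intro poly_eqI) (auto simp: coeff_map_poly coeff_pCons split: nat.split)
    moreover have "map_mat to_ac (A * mat_poly n A p) = map_mat to_ac A * map_mat to_ac (mat_poly n A p)"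
      by (rule to_ac.mat_hom_mult[OF A mat_poly_carrier[OF A]])
    moreover have "map_mat to_ac (a \<cdot>\<^sub>m 1\<^sub>m n + A * mat_poly n A p) =
        to_ac a \<cdot>\<^sub>m 1\<^sub>m n + map_mat to_ac (A * mat_poly n A p)"
      using carrier_matD[OF mult_carrier_mat[OF A mat_poly_carrier[OF A]]] by (intro eq_matI) auto
    ultimately show ?case
      by (simp add: mat_poly_pCons[OF A] mat_poly_pCons[OF A'] pCons.IH)
  qed
qed

text \<open>Over the closure, singularity means a common root of \<open>p\<close> and
  \<open>char_poly A\<close>; by Bezout's identity an irreducible \<open>p\<close> has a common root
  only with its multiples.\<close>

lemma det_mat_poly_irr:
  fixes A :: "'a :: field mat"
  assumes A: "A \<in> carrier_mat n n" and p: "p \<in> irr_polys"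
  shows "det (mat_poly n A p) = 0 \<longleftrightarrow> p dvd char_poly A"
proof -
  have A': "map_mat to_ac A \<in> carrier_mat n n" using A by simp
  have p': "map_poly to_ac p \<noteq> 0" using irr_polysD(3)[OF p] by simp
  have "det (mat_poly n A p) = 0 \<longleftrightarrow> det (map_mat to_ac (mat_poly n A p)) = 0"
    by (simp add: to_ac.hom_det)
  also have "\<dots> \<longleftrightarrow> (\<exists>x. poly (map_poly to_ac p) x = 0 \<and> poly (map_poly to_ac (char_poly A)) x = 0)"
    unfolding map_mat_mat_poly[OF A] det_mat_poly_eq_0_iff[OF A' p'] to_ac.char_poly_hom[OF A] ..
  also have "\<dots> \<longleftrightarrow> p dvd char_poly A"
  proof
    assume "p dvd char_poly A"
    then obtain k where k: "char_poly A = p * k" by (elim dvdE)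
    have "degree (map_poly to_ac p) > 0" using irr_polysD(4)[OF p] by simp
    then obtain x where "poly (map_poly to_ac p) x = 0"
      using alg_closed_imp_poly_has_root by blast
    then show "\<exists>x. poly (map_poly to_ac p) x = 0 \<and> poly (map_poly to_ac (char_poly A)) x = 0"
      by (auto simp: k to_ac_poly.hom_mult)
  next
    assume "\<exists>x. poly (map_poly to_ac p) x = 0 \<and> poly (map_poly to_ac (char_poly A)) x = 0"
    then show "p dvd char_poly A"
      using bezout_no_common_root[OF irr_polysD(1)[OF p]] by blast
  qed
  finally show ?thesis .
qed

lemma monic_dvd_monic_eq:
  fixes f h :: "'a :: field poly"
  assumes "f dvd h" "lead_coeff f = 1" "lead_coeff h = 1" "degree f = degree h"
  shows "f = h"
proof -
  obtain k where k: "h = f * k" using assms(1) by (elim dvdE)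
  have nz: "f \<noteq> 0" "k \<noteq> 0" using assms(3) k by auto
  then have "degree k = 0" using assms(4) by (simp add: k degree_mult_eq)
  then obtain c where c: "k = [:c:]" by (elim degree_eq_zeroE)
  moreover have "lead_coeff k = 1" using assms(2,3) unfolding k lead_coeff_mult by simp
  ultimately show ?thesis using k by simp
qed

lemma polys_below_dvd:
  assumes "h dvd f" "f \<in> polys_below (degree h)"
  shows "f = 0"
proof (rule ccontr)
  assume "f \<noteq> 0"
  with assms dvd_imp_degree_le[of h f] show False by (simp add: polys_below_degree)
qed

lemma annihilators_coprime:
  fixes A :: "'a :: field mat"
  assumes A: "A \<in> carrier_mat n n" and v: "v \<in> carrier_vec n" and p: "irreducible p" "\<not> p dvd f"
    and "mat_poly n A p *\<^sub>v v = 0\<^sub>v n" "mat_poly n A f *\<^sub>v v = 0\<^sub>v n"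
  shows "v = 0\<^sub>v n"
proof -
  obtain a b where "a * p + b * f = 1" using irreducible_bezout[OF p] .
  then have "v = mat_poly n A (a * p + b * f) *\<^sub>v v"
    using mat_poly_vec_1[OF A v] by simp
  also have "\<dots> = mat_poly n A (a * p) *\<^sub>v v + mat_poly n A (b * f) *\<^sub>v v"
    by (rule mat_poly_vec_add[OF A v])
  also have "mat_poly n A (a * p) *\<^sub>v v = 0\<^sub>v n"
    by (rule mat_poly_vec_dvd[OF A v dvd_triv_right assms(5)])
  also have "mat_poly n A (b * f) *\<^sub>v v = 0\<^sub>v n"
    by (rule mat_poly_vec_dvd[OF A v dvd_triv_right assms(6)])
  finally show ?thesis by simp
qed

text \<open>A sum of nonzero vectors annihilated by \<open>p(A)\<close>, one for each \<open>p \<in> S\<close>, is cyclic.\<close>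

lemma char_poly_prod_irr_cyclic:
  fixes A :: "'a :: field mat"
  assumes A: "A \<in> carrier_mat n n" and S: "finite S" "S \<subseteq> irr_polys" and cp: "char_poly A = \<Prod>S"
  obtains v where "v \<in> carrier_vec n" "cyclic_vec n A v" "mat_poly n A (\<Prod>S) *\<^sub>v v = 0\<^sub>v n"
proof -
  have "\<forall>p\<in>S. \<exists>v. v \<in> carrier_vec n \<and> v \<noteq> 0\<^sub>v n \<and> mat_poly n A p *\<^sub>v v = 0\<^sub>v n"
  proof
    fix p assume p: "p \<in> S"
    then have "p dvd char_poly A" using S cp by (metis dvd_prod_eqI)
    then have "det (mat_poly n A p) = 0" using det_mat_poly_irr[OF A, of p] p S by blast
    then show "\<exists>v. v \<in> carrier_vec n \<and> v \<noteq> 0\<^sub>v n \<and> mat_poly n A p *\<^sub>v v = 0\<^sub>v n"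
      using det_0_iff_vec_prod_zero[OF mat_poly_carrier[OF A]] by blast
  qed
  then obtain w where w: "\<And>p. p \<in> S \<Longrightarrow> w p \<in> carrier_vec n" "\<And>p. p \<in> S \<Longrightarrow> w p \<noteq> 0\<^sub>v n"
    "\<And>p. p \<in> S \<Longrightarrow> mat_poly n A p *\<^sub>v w p = 0\<^sub>v n"
    by metis
  define v where "v = vec n (\<lambda>i. \<Sum>p\<in>S. w p $ i)"
  have v: "v \<in> carrier_vec n" by (simp add: v_def)
  have fv: "(mat_poly n A f *\<^sub>v v) $ i = (\<Sum>p\<in>S. (mat_poly n A f *\<^sub>v w p) $ i)" if i: "i < n" for f i
  proof -
    have idx: "(mat_poly n A f *\<^sub>v u) $ i = (\<Sum>k<n. mat_poly n A f $$ (i, k) * u $ k)" if "u \<in> carrier_vec n" for u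
      using that i carrier_matD[OF mat_poly_carrier[OF A, of f]] by (simp add: scalar_prod_def lessThan_atLeast0)
    have "(mat_poly n A f *\<^sub>v v) $ i = (\<Sum>k<n. \<Sum>p\<in>S. mat_poly n A f $$ (i, k) * w p $ k)"
      unfolding idx[OF v] by (intro sum.cong refl) (simp add: v_def sum_distrib_left)
    also have "\<dots> = (\<Sum>p\<in>S. \<Sum>k<n. mat_poly n A f $$ (i, k) * w p $ k)" by (rule sum.swap)
    also have "\<dots> = (\<Sum>p\<in>S. (mat_poly n A f *\<^sub>v w p) $ i)"
      using w(1) by (intro sum.cong refl) (simp add: idx del: index_mult_mat_vec)
    finally show ?thesis .
  qed
  have kill: "mat_poly n A f *\<^sub>v w p = 0\<^sub>v n" if "p \<in> S" "p dvd f" for p f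
    using mat_poly_vec_dvd[OF A w(1)[OF that(1)] that(2) w(3)[OF that(1)]] .
  have deg: "degree (\<Prod>S) = n" using degree_monic_char_poly[OF A] cp by simp
  have "cyclic_vec n A v"
    unfolding cyclic_vec_iff[OF A v]
  proof (intro ballI impI)
    fix f assume f: "f \<in> polys_below n" "mat_poly n A f *\<^sub>v v = 0\<^sub>v n"
    have "p dvd f" if p: "p \<in> S" for p
    proof (rule ccontr)
      assume "\<not> p dvd f"
      \<comment> \<open>\<open>g * f\<close> annihilates \<open>v\<close> and, through
        \<open>g\<close>, every summand other than \<open>w p\<close>; hence it annihilates
        \<open>w p\<close> as well, although it is coprime to \<open>p\<close>.\<close>
      define g where "g = \<Prod>(S - {p})"
      have "\<not> p dvd g"
      proof
        assume "p dvd g"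
        then have "p \<in> S - {p}"
          unfolding g_def using p S by - (rule irr_dvd_prod, auto)
        then show False by simp
      qed
      then have npd: "\<not> p dvd g * f"
        using \<open>\<not> p dvd f\<close> irr_polysD(5)[of p] p S by (auto simp: prime_elem_dvd_mult_iff)
      have "mat_poly n A (g * f) *\<^sub>v w p = 0\<^sub>v n"
      proof (rule eq_vecI)
        fix i assume "i < dim_vec (0\<^sub>v n :: 'a vec)"
        then have i: "i < n" by simp
        have "0 = (mat_poly n A (g * f) *\<^sub>v v) $ i"
          using mat_poly_vec_dvd[OF A v dvd_triv_right f(2), of g] i by simp
        also have "\<dots> = (\<Sum>r\<in>S. (mat_poly n A (g * f) *\<^sub>v w r) $ i)" by (rule fv[OF i])
        also have "\<dots> = (\<Sum>r\<in>S. if r = p then (mat_poly n A (g * f) *\<^sub>v w p) $ i else 0)"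
        proof (intro sum.cong refl)
          fix r assume r: "r \<in> S"
          show "(mat_poly n A (g * f) *\<^sub>v w r) $ i = (if r = p then (mat_poly n A (g * f) *\<^sub>v w p) $ i else 0)"
          proof (cases "r = p")
            case False
            then have "r dvd g" unfolding g_def using S(1) r by (intro dvd_prod_eqI[of _ r]) auto
            then have "r dvd g * f" by simp
            then show ?thesis using kill[OF r, of "g * f"] False i by simp
          qed simp
        qed
        also have "\<dots> = (mat_poly n A (g * f) *\<^sub>v w p) $ i" using p S(1) by (simp del: index_mult_mat_vec)
        finally show "(mat_poly n A (g * f) *\<^sub>v w p) $ i = 0\<^sub>v n $ i" using i by simp
      qed (use carrier_matD[OF mat_poly_carrier[OF A]] in simp)
      then have "w p = 0\<^sub>v n"
        using annihilators_coprime[OF A w(1)[OF p] _ npd w(3)[OF p]] irr_polysD(1) p S by blast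
      then show False using w(2)[OF p] by simp
    qed
    then have "\<Prod>S dvd f" by (rule prod_irr_dvd[OF S])
    then show "f = 0"
      using f(1) deg polys_below_dvd by blast
  qed
  moreover have "mat_poly n A (\<Prod>S) *\<^sub>v v = 0\<^sub>v n"
  proof (rule eq_vecI)
    fix i assume "i < dim_vec (0\<^sub>v n :: 'a vec)"
    then have i: "i < n" by simp
    have "(mat_poly n A (\<Prod>S) *\<^sub>v w p) $ i = 0" if "p \<in> S" for p
      using kill[OF that, of "\<Prod>S"] i S(1) that by (simp add: dvd_prod_eqI[OF S(1) that])
    then show "(mat_poly n A (\<Prod>S) *\<^sub>v v) $ i = 0\<^sub>v n $ i"
      unfolding fv[OF i] using i by simp
  qed (use carrier_matD[OF mat_poly_carrier[OF A]] in simp)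
  ultimately show thesis using that v by blast
qed

text \<open>For \<open>p \<in> S\<close> the cofactor of \<open>p\<close> in \<open>\<Prod>S\<close>
  has degree below \<open>n\<close>, so it maps \<open>v\<close> to a nonzero vector, which lies in
  the kernel of \<open>mat_poly n A p\<close>. Thus every \<open>p\<close> divides
  \<open>char_poly A\<close>, and the degrees agree.\<close>

lemma cyclic_char_poly:
  fixes A :: "'a :: field mat"
  assumes A: "A \<in> carrier_mat n n" and v: "v \<in> carrier_vec n" and S: "finite S" "S \<subseteq> irr_polys" "degree (\<Prod>S) = n"
    and cyc: "cyclic_vec n A v" and ann: "mat_poly n A (\<Prod>S) *\<^sub>v v = 0\<^sub>v n"
  shows "char_poly A = \<Prod>S"
proof -
  have "p dvd char_poly A" if p: "p \<in> S" for p
  proof -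
    define g where "g = \<Prod>(S - {p})"
    have pg: "\<Prod>S = p * g" unfolding g_def using S(1) p by (simp add: prod.remove)
    have pI: "p \<in> irr_polys" using p S(2) by blast
    have nz: "p \<noteq> 0" "g \<noteq> 0"
      using prod_irr_nonzero[OF S(2)] unfolding pg by auto
    have "degree g < n"
      using S(3) irr_polysD(4)[OF pI] nz by (simp add: pg degree_mult_eq)
    then have "mat_poly n A g *\<^sub>v v \<noteq> 0\<^sub>v n"
      using cyc nz unfolding cyclic_vec_iff[OF A v] by (auto simp: polys_below_degree)
    moreover have "mat_poly n A p *\<^sub>v (mat_poly n A g *\<^sub>v v) = 0\<^sub>v n"
      using ann by (simp add: pg mat_poly_vec_mult[OF A v])
    ultimately have "det (mat_poly n A p) = 0"
      using det_0_iff_vec_prod_zero[OF mat_poly_carrier[OF A]] mat_poly_vec_carrier[OF A v] by blast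
    then show ?thesis using det_mat_poly_irr[OF A pI] by blast
  qed
  then have "\<Prod>S dvd char_poly A" by (rule prod_irr_dvd[OF S(1,2)])
  then have "\<Prod>S = char_poly A"
    using lead_coeff_prod_irr[OF S(1,2)] degree_monic_char_poly[OF A] S(3)
    by (intro monic_dvd_monic_eq) auto
  then show ?thesis ..
qed

text \<open>Division with remainder: the annihilator ideal of a cyclic vector is generated by
  \<open>\<phi>\<close>, so the space is the quotient ring modulo \<open>\<phi>\<close>.\<close>

lemma cyclic_mat_poly_eq_0_iff:
  fixes A :: "'a :: field mat"
  assumes A: "A \<in> carrier_mat n n" and v: "v \<in> carrier_vec n" and cyc: "cyclic_vec n A v"
    and \<phi>: "degree \<phi> = n" "\<phi> \<noteq> 0" and ann: "mat_poly n A \<phi> *\<^sub>v v = 0\<^sub>v n"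
  shows "mat_poly n A f *\<^sub>v v = 0\<^sub>v n \<longleftrightarrow> \<phi> dvd f"
proof
  assume f: "mat_poly n A f *\<^sub>v v = 0\<^sub>v n"
  have "mat_poly n A ((f div \<phi>) * \<phi> + f mod \<phi>) *\<^sub>v v =
      mat_poly n A ((f div \<phi>) * \<phi>) *\<^sub>v v + mat_poly n A (f mod \<phi>) *\<^sub>v v"
    by (rule mat_poly_vec_add[OF A v])
  also have "mat_poly n A ((f div \<phi>) * \<phi>) *\<^sub>v v = 0\<^sub>v n"
    by (rule mat_poly_vec_dvd[OF A v _ ann]) simp
  finally have "mat_poly n A (f mod \<phi>) *\<^sub>v v = 0\<^sub>v n"
    using f mat_poly_vec_carrier[OF A v, of "f mod \<phi>"] by simp
  moreover have "f mod \<phi> \<in> polys_below n"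
    using degree_mod_less[OF \<phi>(2), of f] \<phi>(1) by (auto simp: polys_below_def)
  ultimately have "f mod \<phi> = 0" using cyc unfolding cyclic_vec_iff[OF A v] by blast
  then show "\<phi> dvd f" by (simp add: mod_eq_0_iff_dvd)
qed (rule mat_poly_vec_dvd[OF A v _ ann])

text \<open>Fix a cyclic \<open>v\<close> and write vectors as \<open>h f\<close>. If some
  \<open>p \<in> S\<close> divides \<open>f\<close>, the cofactor of \<open>p\<close> annihilates
  \<open>h f\<close>; if none does, \<open>\<Prod>S dvd g * f\<close> forces every
  \<open>p \<in> S\<close>, hence \<open>\<Prod>S\<close>, to divide \<open>g\<close>.\<close>

lemma card_cyclic_vecs:
  fixes A :: "'a :: field mat"
  assumes A: "A \<in> carrier_mat n n" and S: "finite S" "S \<subseteq> irr_polys" and cp: "char_poly A = \<Prod>S"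
  shows "card {v \<in> carrier_vec n. cyclic_vec n A v \<and> mat_poly n A (\<Prod>S) *\<^sub>v v = 0\<^sub>v n} =
    card {f \<in> polys_below n. \<forall>p\<in>S. \<not> p dvd f}" (is "card ?V = card ?F")
proof -
  have deg: "degree (\<Prod>S) = n" using degree_monic_char_poly[OF A] cp by simp
  have nz: "\<Prod>S \<noteq> 0" by (rule prod_irr_nonzero[OF S(2)])
  obtain v where v: "v \<in> carrier_vec n" and cyc: "cyclic_vec n A v" and ann: "mat_poly n A (\<Prod>S) *\<^sub>v v = 0\<^sub>v n"
    using char_poly_prod_irr_cyclic[OF A S cp] .
  note zero_iff = cyclic_mat_poly_eq_0_iff[OF A v cyc deg nz ann]
  define h where "h f = mat_poly n A f *\<^sub>v v" for f
  have hc: "h f \<in> carrier_vec n" for f unfolding h_def by (rule mat_poly_vec_carrier[OF A v])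
  have hh: "mat_poly n A g *\<^sub>v h f = 0\<^sub>v n \<longleftrightarrow> \<Prod>S dvd g * f" for f g
    unfolding h_def mat_poly_vec_mult[OF A v, symmetric] by (rule zero_iff)
  have cyc_iff: "cyclic_vec n A (h f) \<longleftrightarrow> (\<forall>p\<in>S. \<not> p dvd f)" for f
  proof
    assume c: "cyclic_vec n A (h f)"
    show "\<forall>p\<in>S. \<not> p dvd f"
    proof (intro ballI notI)
      fix p assume p: "p \<in> S" "p dvd f"
      define g where "g = \<Prod>(S - {p})"
      have pg: "\<Prod>S = g * p" unfolding g_def using S(1) p(1) by (simp add: prod.remove mult.commute)
      have g0: "g \<noteq> 0" "p \<noteq> 0" using nz unfolding pg by auto
      have "p \<in> irr_polys" using p(1) S(2) by blast
      then have "degree g < n"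
        using deg irr_polysD(4)[of p] g0 by (simp add: pg degree_mult_eq)
      moreover have "mat_poly n A g *\<^sub>v h f = 0\<^sub>v n"
        unfolding hh pg using p(2) by simp
      ultimately show False
        using c g0 unfolding cyclic_vec_iff[OF A hc] by (auto simp: polys_below_degree)
    qed
  next
    assume f: "\<forall>p\<in>S. \<not> p dvd f"
    show "cyclic_vec n A (h f)"
      unfolding cyclic_vec_iff[OF A hc]
    proof (intro ballI impI)
      fix g assume g: "g \<in> polys_below n" "mat_poly n A g *\<^sub>v h f = 0\<^sub>v n"
      have "p dvd g" if p: "p \<in> S" for p
      proof -
        have "p dvd \<Prod>S" by (rule dvd_prod_eqI[OF S(1) p refl])
        then have "p dvd g * f" using g(2) unfolding hh by (rule dvd_trans)
        then show ?thesis using f p irr_polysD(5)[of p] S(2) by (auto simp: prime_elem_dvd_mult_iff)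
      qed
      then have "\<Prod>S dvd g" by (rule prod_irr_dvd[OF S])
      then show "g = 0"
        using g(1) deg polys_below_dvd by blast
    qed
  qed
  have "inj_on h (polys_below n)"
  proof (rule inj_onI)
    fix f g assume fg: "f \<in> polys_below n" "g \<in> polys_below n" "h f = h g"
    have "f - g \<in> polys_below n" using fg(1,2) by (simp add: polys_below_iff)
    moreover have "mat_poly n A (f - g) *\<^sub>v v = 0\<^sub>v n"
    proof -
      have "h f = h (f - g) + h g"
        using mat_poly_vec_add[OF A v, of "f - g" g] unfolding h_def by simp
      then have "h (f - g) + h g = 0\<^sub>v n + h g" using fg(3) hc[of g] by simp
      then have "h (f - g) = 0\<^sub>v n"
        using hc[of "f - g"] hc[of g] by (simp add: vec_eq_iff)
      then show ?thesis unfolding h_def .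
    qed
    ultimately have "f - g = 0" using cyc unfolding cyclic_vec_iff[OF A v] by blast
    then show "f = g" by simp
  qed
  then have "inj_on h ?F" by (rule inj_on_subset) auto
  moreover have "h ` ?F = ?V"
  proof
    show "h ` ?F \<subseteq> ?V"
      using hc cyc_iff by (auto simp: hh)
    show "?V \<subseteq> h ` ?F"
    proof
      fix w assume w: "w \<in> ?V"
      then have wc: "w \<in> carrier_vec n" by simp
      obtain f where f: "f \<in> polys_below n" "w = mat_poly n A f *\<^sub>v v"
        using cyclic_vec_surj[OF A v cyc wc] .
      have wf: "w = h f" using f(2) by (simp add: h_def)
      have "\<forall>p\<in>S. \<not> p dvd f" using w unfolding wf cyc_iff[symmetric] by simp
      then show "w \<in> h ` ?F" using f(1) wf by simp
    qed
  qed
  ultimately show ?thesis using card_image by fastforce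
qed

lemma finite_carrier_mat: "finite (carrier_mat n m :: 'a :: finite mat set)"
  and finite_carrier_vec: "finite (carrier_vec n :: 'a :: finite vec set)"
proof -
  have "A \<in> mat n m ` ({..<n} \<times> {..<m} \<rightarrow>\<^sub>E UNIV)" if "A \<in> carrier_mat n m" for A :: "'a mat"
  proof
    show "A = mat n m (\<lambda>p\<in>{..<n} \<times> {..<m}. A $$ p)"
      using that by (intro eq_matI) auto
  qed (simp add: PiE_def)
  then have "(carrier_mat n m :: 'a mat set) \<subseteq> mat n m ` ({..<n} \<times> {..<m} \<rightarrow>\<^sub>E UNIV)" by blast
  moreover have "finite ({..<n} \<times> {..<m} \<rightarrow>\<^sub>E (UNIV :: 'a set))" by (intro finite_PiE) simp_all
  ultimately show "finite (carrier_mat n m :: 'a mat set)" by (meson finite_imageI finite_subset)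
  have "v \<in> vec n ` ({..<n} \<rightarrow>\<^sub>E UNIV)" if "v \<in> carrier_vec n" for v :: "'a vec"
  proof
    show "v = vec n (\<lambda>i\<in>{..<n}. v $ i)"
      using that by (intro eq_vecI) auto
  qed (simp add: PiE_def)
  then have "(carrier_vec n :: 'a vec set) \<subseteq> vec n ` ({..<n} \<rightarrow>\<^sub>E UNIV)" by blast
  moreover have "finite ({..<n} \<rightarrow>\<^sub>E (UNIV :: 'a set))" by (intro finite_PiE) simp_all
  ultimately show "finite (carrier_vec n :: 'a vec set)" by (meson finite_imageI finite_subset)
qed

text \<open>The pairs of \<open>card_cyclic_pairs\<close> are counted a second time, matrix by
  matrix; all fibres have the same size.\<close>

lemma card_char_poly_eq_prod_irr:
  fixes S :: "'a :: {field, finite} poly set"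
  assumes n: "0 < n" and S: "finite S" "S \<subseteq> irr_polys" "(\<Sum>p\<in>S. degree p) = n"
  shows "real (card {A \<in> carrier_mat n n. char_poly A = \<Prod>S}) * (\<Prod>p\<in>S. real CARD('a) ^ degree p - 1) =
    real (card (GL n :: 'a mat set))"
proof -
  define M where "M = {A \<in> carrier_mat n n. char_poly A = \<Prod>S}"
  define V where "V A = {v \<in> carrier_vec n. cyclic_vec n A v \<and> mat_poly n A (\<Prod>S) *\<^sub>v v = 0\<^sub>v n}" for A :: "'a mat"
  have deg: "degree (\<Prod>S) = n" using degree_prod_irr[OF S(1,2)] S(3) by simp
  have "{(A, v). A \<in> carrier_mat n n \<and> v \<in> carrier_vec n \<and> cyclic_vec n A v \<and> mat_poly n A (\<Prod>S) *\<^sub>v v = 0\<^sub>v n} = Sigma M V"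
    using cyclic_char_poly[OF _ _ S(1,2) deg] by (auto simp: M_def V_def)
  then have "card (GL n :: 'a mat set) = card (Sigma M V)"
    using card_cyclic_pairs[OF n lead_coeff_prod_irr[OF S(1,2)] deg] by simp
  also have "\<dots> = (\<Sum>A\<in>M. card (V A))"
  proof (rule card_SigmaI)
    show "finite M"
      by (rule finite_subset[OF _ finite_carrier_mat[of n n]]) (auto simp: M_def)
    show "\<forall>A\<in>M. finite (V A)"
      by (intro ballI finite_subset[OF _ finite_carrier_vec[of n]]) (auto simp: V_def)
  qed
  also have "\<dots> = (\<Sum>A\<in>M. card {f \<in> polys_below n. \<forall>p\<in>S. \<not> p dvd f})"
    using card_cyclic_vecs[OF _ S(1,2)] by (intro sum.cong) (auto simp: M_def V_def)
  also have "\<dots> = card M * card {f \<in> polys_below n. \<forall>p\<in>S. \<not> p dvd f}" by simp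
  finally show ?thesis
    using card_residues_free[OF S(1,2)] S(3) by (simp add: M_def)
qed

section \<open>The generating function\<close>

definition monic_polys :: "nat \<Rightarrow> 'a :: field poly set" where
  "monic_polys n = {f. lead_coeff f = 1 \<and> degree f = n}"

lemma monic_polys_eq_image: "monic_polys n = (\<lambda>f. f + monom 1 n) ` polys_below n"
proof (rule Set.set_eqI, rule iffI)
  fix f :: "'a poly" assume "f \<in> monic_polys n"
  then have "f - monom 1 n \<in> polys_below n"
    by (intro monic_minus_monom) (auto simp: monic_polys_def)
  then show "f \<in> (\<lambda>f. f + monom 1 n) ` polys_below n"
    by (intro image_eqI[of _ _ "f - monom 1 n"]) auto
next
  fix f :: "'a poly" assume "f \<in> (\<lambda>f. f + monom 1 n) ` polys_below n"
  then obtain g where g: "g \<in> polys_below n" "f = g + monom 1 n" by blast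
  have "coeff f n = 1" "\<forall>i>n. coeff f i = 0"
    using g by (auto simp: polys_below_iff)
  then have "degree f = n"
    by (intro antisym degree_le le_degree) auto
  then show "f \<in> monic_polys n"
    using \<open>coeff f n = 1\<close> by (simp add: monic_polys_def)
qed

lemma finite_monic_polys [simp]: "finite (monic_polys n :: 'a :: {field, finite} poly set)"
  and card_monic_polys: "card (monic_polys n :: 'a poly set) = CARD('a) ^ n"
proof -
  have "inj_on (\<lambda>f. f + monom 1 n) (polys_below n :: 'a poly set)" by (auto simp: inj_on_def)
  then show "card (monic_polys n :: 'a poly set) = CARD('a) ^ n"
    unfolding monic_polys_eq_image by (simp add: card_image card_polys_below)
  show "finite (monic_polys n :: 'a poly set)"
    unfolding monic_polys_eq_image by simp
qed

text \<open>The zeta function of the affine line without the Euler factors of \<open>S\<close>. The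
  division by \<open>CARD('a) ^ n\<close> moves its pole to 1, so that \<open>sieve_fps {}\<close>
  is the geometric series.\<close>

definition sieve_fps :: "'a :: {field, finite} poly set \<Rightarrow> real fps" where
  "sieve_fps S = Abs_fps (\<lambda>n. real (card {f \<in> monic_polys n. \<forall>p\<in>S. \<not> p dvd f}) / real CARD('a) ^ n)"

text \<open>Among the polynomials surviving \<open>S\<close>, the multiples of \<open>p\<close> are
  \<open>p\<close> times survivors of degree smaller by \<open>degree p\<close>: one Euler
  factor.\<close>

lemma sieve_fps_insert:
  fixes p :: "'a :: {field, finite} poly"
  assumes p: "p \<in> irr_polys" "p \<notin> S" and S: "S \<subseteq> irr_polys"
  shows "sieve_fps (insert p S) = (1 - fps_const (1 / real CARD('a) ^ degree p) * fps_X ^ degree p) * sieve_fps S"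
proof (rule fps_ext)
  fix n
  define d where "d = degree p"
  define w where "w S n = real (card {f \<in> monic_polys n. \<forall>p\<in>S. \<not> p dvd f})" for S :: "'a poly set" and n
  have mult: "p * g \<in> monic_polys n \<longleftrightarrow> d \<le> n \<and> g \<in> monic_polys (n - d)" for g
  proof (cases "g = 0")
    case False
    have lc: "lead_coeff (p * g) = lead_coeff g"
      unfolding lead_coeff_mult irr_polysD(2)[OF p(1)] by simp
    have deg: "degree (p * g) = d + degree g"
      using irr_polysD(3)[OF p(1)] False by (simp add: degree_mult_eq d_def)
    show ?thesis
      unfolding monic_polys_def mem_Collect_eq lc unfolding deg by auto
  qed (simp add: monic_polys_def)
  have "w (insert p S) n + real (card {g. p * g \<in> monic_polys n \<and> (\<forall>r\<in>S. \<not> r dvd g)}) = w S n"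
    using sieve_step[OF finite_monic_polys p S, of n] unfolding w_def by linarith
  moreover have "real (card {g. p * g \<in> monic_polys n \<and> (\<forall>r\<in>S. \<not> r dvd g)}) = (if n < d then 0 else w S (n - d))"
    unfolding mult w_def by auto
  ultimately have w: "w (insert p S) n = w S n - (if n < d then 0 else w S (n - d))" by linarith
  have nth: "fps_nth (sieve_fps S) n = w S n / real CARD('a) ^ n" for S :: "'a poly set" and n
    by (simp add: sieve_fps_def w_def)
  have "fps_nth ((1 - fps_const (1 / real CARD('a) ^ d) * fps_X ^ d) * sieve_fps S) n =
      fps_nth (sieve_fps S) n - 1 / real CARD('a) ^ d * fps_nth (fps_X ^ d * sieve_fps S) n"
    by (simp only: left_diff_distrib mult_1_left fps_sub_nth mult.assoc fps_mult_left_const_nth)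
  also have "\<dots> = fps_nth (sieve_fps (insert p S)) n"
    by (auto simp: nth w fps_X_power_mult_nth diff_divide_distrib power_diff)
  finally show "fps_nth (sieve_fps (insert p S)) n =
      fps_nth ((1 - fps_const (1 / real CARD('a) ^ degree p) * fps_X ^ degree p) * sieve_fps S) n"
    unfolding d_def ..
qed

lemma sieve_fps_eq:
  fixes S :: "'a :: {field, finite} poly set"
  assumes "finite S" "S \<subseteq> irr_polys"
  shows "sieve_fps S = (\<Prod>p\<in>S. 1 - fps_const (1 / real CARD('a) ^ degree p) * fps_X ^ degree p) * Abs_fps (\<lambda>_. 1)"
  using assms
proof (induction S)
  case empty
  then show ?case by (simp add: sieve_fps_def card_monic_polys)
next
  case (insert p S)
  then show ?case by (simp add: sieve_fps_insert mult.assoc)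
qed

lemma X_irr: "[:0, 1:] \<in> irr_polys"
  using irreducible_linear_field_poly[of 1 "0 :: 'a :: field"] by (simp add: irr_polys_def)

text \<open>The irreducible \<open>[:0, 1:]\<close> divides the characteristic polynomials of
  singular matrices and is left out. The cut-off \<open>D\<close> keeps the Euler products finite
  without changing their coefficients up to \<open>D\<close>.\<close>

definition primes_upto :: "nat \<Rightarrow> 'a :: field poly set" where
  "primes_upto D = {p \<in> irr_polys. p \<noteq> [:0, 1:] \<and> degree p \<le> D}"

lemma primes_upto_irr: "primes_upto D \<subseteq> irr_polys"
  by (auto simp: primes_upto_def)

lemma finite_primes_upto [simp]: "finite (primes_upto D :: 'a :: {field, finite} poly set)"
  by (rule finite_subset[OF _ finite_polys_below[of "Suc D"]]) (auto simp: primes_upto_def polys_below_def)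

text \<open>A nonconstant polynomial of degree at most \<open>D\<close> has an irreducible factor of
  degree at most \<open>D\<close>, so nothing but 1 survives: the truncated form of the Euler
  product of the zeta function.\<close>

lemma sieve_fps_all_nth:
  assumes "n \<le> D"
  shows "fps_nth (sieve_fps (insert [:0, 1:] (primes_upto D) :: 'a :: {field, finite} poly set)) n = (if n = 0 then 1 else 0)"
proof -
  define T where "T = (insert [:0, 1:] (primes_upto D) :: 'a poly set)"
  have T: "T = {p \<in> irr_polys. p = [:0, 1:] \<or> degree p \<le> D}"
    using X_irr by (auto simp: T_def primes_upto_def)
  have "{f \<in> monic_polys n. \<forall>p\<in>T. \<not> p dvd f} = (if n = 0 then {1} else {})"
  proof (cases "n = 0")
    case True
    have m0: "monic_polys 0 = {1 :: 'a poly}"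
      by (auto simp: monic_polys_def elim!: degree_eq_zeroE)
    have sing: "{f \<in> {1 :: 'a poly}. Q f} = {1}" if "Q 1" for Q
      using that by auto
    have "\<forall>p\<in>T. \<not> p dvd 1"
      using irr_polysD(6) by (auto simp only: T)
    then have "{f \<in> monic_polys 0. \<forall>p\<in>T. \<not> p dvd f} = {1}"
      unfolding m0 by (rule sing)
    then show ?thesis using True by simp
  next
    case False
    have "\<exists>p\<in>T. p dvd f" if "f \<in> monic_polys n" for f
    proof -
      have f: "degree f = n" "f \<noteq> 0" using that by (auto simp: monic_polys_def)
      then have "degree f > 0" using False by simp
      then obtain p where p: "p \<in> irr_polys" "p dvd f" by (rule ex_irr_factor)
      then have "p \<in> T"
        using dvd_imp_degree_le[of p f] f assms by (simp add: T)
      with p(2) show ?thesis by blast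
    qed
    then show ?thesis using False by auto
  qed
  then show ?thesis by (simp add: sieve_fps_def T_def[symmetric])
qed

text \<open>For \<open>0 < n\<close> this is the probability in question
  (\<open>prob_regular_semisimple\<close>); the type argument selects the field.\<close>

definition rs_sum :: "'a :: {field, finite} itself \<Rightarrow> nat \<Rightarrow> real" where
  "rs_sum _ n = (\<Sum>S | finite S \<and> S \<subseteq> irr_polys - {[:0, 1:]} \<and> (\<Sum>p\<in>S. degree p) = n.
     \<Prod>p\<in>S. 1 / (real CARD('a) ^ degree (p :: 'a poly) - 1))"

definition rs_fps :: "'a :: {field, finite} itself \<Rightarrow> nat \<Rightarrow> real fps" where
  "rs_fps _ D = (\<Prod>p\<in>(primes_upto D :: 'a poly set).
     1 + fps_const (1 / (real CARD('a) ^ degree p - 1)) * fps_X ^ degree p)"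

lemma fps_const_prod: "(\<Prod>i\<in>I. fps_const (c i)) = fps_const (\<Prod>i\<in>I. c i :: 'a :: comm_ring_1)"
  by (induction I rule: infinite_finite_induct) auto

text \<open>Expanding the product gives one term for each set of irreducibles; all members of a set
  of total degree \<open>n \<le> D\<close> pass the cut-off.\<close>

lemma rs_fps_nth:
  assumes "n \<le> D"
  shows "fps_nth (rs_fps TYPE('a :: {field, finite}) D) n = rs_sum TYPE('a) n"
proof -
  define c where "c p = 1 / (real CARD('a) ^ degree p - 1)" for p :: "'a poly"
  have "rs_fps TYPE('a) D = (\<Prod>p\<in>(primes_upto D :: 'a poly set). fps_const (c p) * fps_X ^ degree p + 1)"
    by (simp add: rs_fps_def c_def add.commute)
  also have "\<dots> = (\<Sum>S\<in>Pow (primes_upto D :: 'a poly set). \<Prod>p\<in>S. fps_const (c p) * fps_X ^ degree p)"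
    by (subst prod_add) auto
  also have "\<dots> = (\<Sum>S\<in>Pow (primes_upto D :: 'a poly set). fps_const (\<Prod>p\<in>S. c p) * fps_X ^ (\<Sum>p\<in>S. degree p))"
    by (intro sum.cong refl) (simp add: prod.distrib fps_const_prod power_sum)
  finally have "fps_nth (rs_fps TYPE('a) D) n =
      (\<Sum>S\<in>Pow (primes_upto D :: 'a poly set). if (\<Sum>p\<in>S. degree p) = n then \<Prod>p\<in>S. c p else 0)"
    by (auto simp: fps_sum_nth fps_X_power_nth intro!: sum.cong)
  also have "\<dots> = (\<Sum>S | S \<in> Pow (primes_upto D :: 'a poly set) \<and> (\<Sum>p\<in>S. degree p) = n. \<Prod>p\<in>S. c p)"
    by (rule sum.inter_filter[symmetric]) simp
  also have "{S. S \<in> Pow (primes_upto D :: 'a poly set) \<and> (\<Sum>p\<in>S. degree p) = n} =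
      {S. finite S \<and> S \<subseteq> irr_polys - {[:0, 1:]} \<and> (\<Sum>p\<in>S. degree p) = n}"
  proof (intro Collect_cong iffI conjI)
    fix S :: "'a poly set"
    assume S: "S \<in> Pow (primes_upto D) \<and> (\<Sum>p\<in>S. degree p) = n"
    then show "finite S" using finite_primes_upto finite_subset by blast
    show "S \<subseteq> irr_polys - {[:0, 1:]}" "(\<Sum>p\<in>S. degree p) = n" using S by (auto simp: primes_upto_def)
  next
    fix S :: "'a poly set"
    assume S: "finite S \<and> S \<subseteq> irr_polys - {[:0, 1:]} \<and> (\<Sum>p\<in>S. degree p) = n"
    then show "(\<Sum>p\<in>S. degree p) = n" by simp
    have "degree p \<le> D" if "p \<in> S" for p
      using member_le_sum[of p S degree] S that assms by simp
    then show "S \<in> Pow (primes_upto D)" using S by (auto simp: primes_upto_def)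
  qed
  finally show ?thesis by (simp add: rs_sum_def c_def)
qed

lemma card_field_ge_2: "CARD('a :: {field, finite}) \<ge> 2"
proof -
  have "card {0, 1 :: 'a} \<le> CARD('a)" by (rule card_mono) auto
  then show ?thesis by simp
qed

text \<open>
  The sign \<open>s = - 1\<close> gives the product of the right-hand sides of the Euler factor identity
  \<open>(1 + x / (Q - 1)) (1 - x / Q) = 1 + (x - x\<^sup>2) / (Q (Q - 1))\<close>, which is 1 at \<open>x = 1\<close>;
  the sign \<open>s = 1\<close> gives a majorant.
\<close>

definition corr_poly :: "real \<Rightarrow> 'a :: {field, finite} itself \<Rightarrow> nat \<Rightarrow> real poly" where
  "corr_poly s _ D = (\<Prod>p\<in>(primes_upto D :: 'a poly set).
     let b = 1 / (real CARD('a) ^ degree p * (real CARD('a) ^ degree p - 1))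
     in 1 + monom b (degree p) + monom (s * b) (2 * degree p))"

text \<open>Every factor of \<open>rs_fps\<close> meets the Euler factor of the same
  \<open>p\<close> in the sieve. The Euler factor of \<open>[:0, 1:]\<close> and the geometric
  series remain.\<close>

lemma rs_fps_corr:
  "rs_fps TYPE('a :: {field, finite}) D * sieve_fps (insert [:0, 1:] (primes_upto D) :: 'a poly set) =
   fps_of_poly (corr_poly (- 1) TYPE('a) D) * ((1 - fps_const (1 / real CARD('a)) * fps_X) * Abs_fps (\<lambda>_. 1))"
proof -
  define P where "P = (primes_upto D :: 'a poly set)"
  define q where "q = real CARD('a)"
  have q: "q \<ge> 2" using card_field_ge_2[where ?'a = 'a] by (simp add: q_def)
  have fin: "finite P" and PI: "P \<subseteq> irr_polys" and X: "[:0, 1:] \<notin> P"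
    using primes_upto_irr by (auto simp: P_def) (auto simp: primes_upto_def)
  have fac: "(1 + fps_const (1 / (q ^ d - 1)) * fps_X ^ d) * (1 - fps_const (1 / q ^ d) * fps_X ^ d) =
      fps_of_poly (let b = 1 / (q ^ d * (q ^ d - 1)) in 1 + monom b d + monom (- 1 * b) (2 * d))"
    if "d > 0" for d
  proof -
    have "q ^ d > 1" using q that by (intro one_less_power) auto
    then have nz: "q ^ d \<noteq> 0" "q ^ d - 1 \<noteq> 0" by linarith+
    define u v where "u = 1 / (q ^ d - 1)" and "v = 1 / q ^ d"
    have uv: "u - v = 1 / (q ^ d * (q ^ d - 1))" "u * v = 1 / (q ^ d * (q ^ d - 1))"
      using nz by (auto simp: u_def v_def field_simps)
    have "(1 + fps_const u * fps_X ^ d) * (1 - fps_const v * fps_X ^ d) =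
        1 + fps_const (u - v) * fps_X ^ d + fps_const (- (u * v)) * fps_X ^ (2 * d)"
    proof -
      have "(1 + a * x) * (1 - b * x) = 1 + (a - b) * x + - (a * b) * (x * x)" for a b x :: "real fps"
        by (simp add: algebra_simps)
      from this[of "fps_const u" "fps_X ^ d" "fps_const v"] show ?thesis
        unfolding power_add[symmetric] mult_2[symmetric] fps_const_sub fps_const_mult fps_const_neg .
    qed
    then show ?thesis
      unfolding uv by (simp add: u_def v_def fps_of_poly_add fps_of_poly_monom Let_def)
  qed
  have "rs_fps TYPE('a) D * (\<Prod>p\<in>P. 1 - fps_const (1 / q ^ degree p) * fps_X ^ degree p) =
      (\<Prod>p\<in>P. (1 + fps_const (1 / (q ^ degree p - 1)) * fps_X ^ degree p) * (1 - fps_const (1 / q ^ degree p) * fps_X ^ degree p))"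
    unfolding rs_fps_def P_def[symmetric] q_def[symmetric] prod.distrib ..
  also have "\<dots> = fps_of_poly (corr_poly (- 1) TYPE('a) D)"
    unfolding corr_poly_def P_def[symmetric] q_def[symmetric] fps_of_poly_prod
    using PI irr_polysD(4) by (intro prod.cong refl fac) blast
  finally have *: "rs_fps TYPE('a) D * (\<Prod>p\<in>P. 1 - fps_const (1 / q ^ degree p) * fps_X ^ degree p) =
      fps_of_poly (corr_poly (- 1) TYPE('a) D)" .
  have "sieve_fps (insert [:0, 1:] P) =
      (1 - fps_const (1 / q) * fps_X) * ((\<Prod>p\<in>P. 1 - fps_const (1 / q ^ degree p) * fps_X ^ degree p) * Abs_fps (\<lambda>_. 1))"
    using sieve_fps_eq[of "insert [:0, 1:] P"] fin PI X X_irr by (simp add: q_def mult.assoc)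
  then show ?thesis
    unfolding P_def[symmetric] q_def[symmetric] *[symmetric] by (simp add: mult_ac)
qed

text \<open>
  Up to degree \<open>n\<close> the sieve series is constant 1, so multiplying by it does not change coefficient \<open>n\<close>.
\<close>

lemma rs_sum_eq:
  assumes "0 < n"
  shows "rs_sum TYPE('a :: {field, finite}) n =
    (\<Sum>j\<le>n. coeff (corr_poly (- 1) TYPE('a) n) j) -
    (\<Sum>j\<le>n - 1. coeff (corr_poly (- 1) TYPE('a) n) j) / real CARD('a)"
proof -
  define H where "H = fps_of_poly (corr_poly (- 1) TYPE('a) n)"
  define W where "W = sieve_fps (insert [:0, 1:] (primes_upto n) :: 'a poly set)"
  have "fps_nth (rs_fps TYPE('a) n * W) n = (\<Sum>i=0..n. fps_nth (rs_fps TYPE('a) n) i * (if i = n then 1 else 0))"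
    unfolding fps_mult_nth W_def by (intro sum.cong refl) (auto simp: sieve_fps_all_nth)
  also have "\<dots> = rs_sum TYPE('a) n"
    by (simp add: mult_delta_right rs_fps_nth)
  finally have 1: "rs_sum TYPE('a) n = fps_nth (rs_fps TYPE('a) n * W) n" ..
  have S: "fps_nth (H * Abs_fps (\<lambda>_. 1)) m = (\<Sum>j\<le>m. coeff (corr_poly (- 1) TYPE('a) n) j)" for m
    by (simp add: fps_mult_nth H_def atLeast0AtMost)
  have "rs_fps TYPE('a) n * W = H * Abs_fps (\<lambda>_. 1) - fps_const (1 / real CARD('a)) * (fps_X * (H * Abs_fps (\<lambda>_. 1)))"
    unfolding W_def rs_fps_corr H_def by (simp add: algebra_simps)
  then have "fps_nth (rs_fps TYPE('a) n * W) n =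
      fps_nth (H * Abs_fps (\<lambda>_. 1)) n - 1 / real CARD('a) * fps_nth (fps_X * (H * Abs_fps (\<lambda>_. 1))) n"
    by (simp only: fps_sub_nth fps_mult_left_const_nth)
  also have "fps_nth (fps_X * (H * Abs_fps (\<lambda>_. 1))) n = fps_nth (H * Abs_fps (\<lambda>_. 1)) (n - 1)"
    using assms by (subst fps_X_mult_nth) simp
  finally show ?thesis unfolding 1 S by simp
qed

section \<open>Majorants and convergence\<close>

lemma coeff_prod_dominated:
  fixes f g :: "'b \<Rightarrow> real poly"
  assumes "\<And>i j. i \<in> I \<Longrightarrow> \<bar>coeff (f i) j\<bar> \<le> coeff (g i) j"
  shows "\<bar>coeff (\<Prod>i\<in>I. f i) j\<bar> \<le> coeff (\<Prod>i\<in>I. g i) j"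
  using assms
proof (induction I arbitrary: j rule: infinite_finite_induct)
  case (insert i I)
  have "\<bar>coeff (f i * (\<Prod>i\<in>I. f i)) j\<bar> \<le> (\<Sum>k\<le>j. \<bar>coeff (f i) k\<bar> * \<bar>coeff (\<Prod>i\<in>I. f i) (j - k)\<bar>)"
    unfolding coeff_mult abs_mult[symmetric] by (rule sum_abs)
  also have "\<dots> \<le> (\<Sum>k\<le>j. coeff (g i) k * coeff (\<Prod>i\<in>I. g i) (j - k))"
  proof (intro sum_mono mult_mono)
    fix k
    show "\<bar>coeff (f i) k\<bar> \<le> coeff (g i) k" using insert.prems by simp
    then show "0 \<le> coeff (g i) k" by linarith
    show "\<bar>coeff (\<Prod>i\<in>I. f i) (j - k)\<bar> \<le> coeff (\<Prod>i\<in>I. g i) (j - k)"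
      using insert by simp
  qed simp
  finally show ?case using insert.hyps by (simp add: coeff_mult)
qed auto

lemma poly_eq_sum_atMost:
  fixes p :: "'a :: comm_semiring_1 poly"
  assumes "degree p \<le> N"
  shows "poly p x = (\<Sum>i\<le>N. coeff p i * x ^ i)"
  unfolding poly_altdef
  by (rule sum.mono_neutral_left) (use assms in \<open>auto simp: coeff_eq_0\<close>)

text \<open>In the tail \<open>\<rho> ^ j / \<rho> ^ m\<close> is at least 1, so weighting the
  dominating coefficients by it only increases the sum.\<close>

lemma coeff_partial_sum_bound:
  fixes f g :: "real poly"
  assumes dom: "\<And>j. \<bar>coeff f j\<bar> \<le> coeff g j" and \<rho>: "\<rho> \<ge> 1"
  shows "\<bar>poly f 1 - (\<Sum>j\<le>m. coeff f j)\<bar> \<le> poly g \<rho> / \<rho> ^ m"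
proof -
  define N where "N = Max {degree f, degree g, m}"
  have N: "degree f \<le> N" "degree g \<le> N" "m \<le> N" by (auto simp: N_def)
  have g0: "0 \<le> coeff g j" for j using dom[of j] by linarith
  have "{..N} = {..m} \<union> {m<..N}" using N(3) by auto
  then have "(\<Sum>j\<le>N. coeff f j) = (\<Sum>j\<le>m. coeff f j) + (\<Sum>j\<in>{m<..N}. coeff f j)"
    by (simp only: sum.union_disjoint[of "{..m}" "{m<..N}"] finite_atMost finite_greaterThanAtMost) (auto intro: sum.union_disjoint)
  then have "poly f 1 - (\<Sum>j\<le>m. coeff f j) = (\<Sum>j\<in>{m<..N}. coeff f j)"
    using poly_eq_sum_atMost[OF N(1), of 1] by simp
  then have "\<bar>poly f 1 - (\<Sum>j\<le>m. coeff f j)\<bar> \<le> (\<Sum>j\<in>{m<..N}. \<bar>coeff f j\<bar>)"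
    by (simp add: sum_abs)
  also have "\<dots> \<le> (\<Sum>j\<in>{m<..N}. coeff g j * \<rho> ^ j / \<rho> ^ m)"
  proof (rule sum_mono)
    fix j assume "j \<in> {m<..N}"
    then have "\<rho> ^ m \<le> \<rho> ^ j" using \<rho> by (intro power_increasing) auto
    then have "1 \<le> \<rho> ^ j / \<rho> ^ m" using \<rho> by simp
    then have "coeff g j * 1 \<le> coeff g j * (\<rho> ^ j / \<rho> ^ m)" using g0 by (intro mult_left_mono) auto
    then show "\<bar>coeff f j\<bar> \<le> coeff g j * \<rho> ^ j / \<rho> ^ m" using dom[of j] by simp
  qed
  also have "\<dots> \<le> (\<Sum>j\<le>N. coeff g j * \<rho> ^ j / \<rho> ^ m)"
    using g0 \<rho> by (intro sum_mono2) auto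
  also have "\<dots> = poly g \<rho> / \<rho> ^ m"
    unfolding poly_eq_sum_atMost[OF N(2)] sum_divide_distrib ..
  finally show ?thesis .
qed

lemma sum_primes_upto_le:
  fixes F :: "nat \<Rightarrow> real"
  assumes "\<And>d. F d \<ge> 0"
  shows "(\<Sum>p\<in>(primes_upto D :: 'a :: {field, finite} poly set). F (degree p)) \<le> (\<Sum>d=1..D. real CARD('a) ^ d * F d)"
proof -
  define P where "P = (primes_upto D :: 'a poly set)"
  have "degree ` P \<subseteq> {1..D}"
    using irr_polysD(4) by (fastforce simp: P_def primes_upto_def)
  then have "(\<Sum>p\<in>P. F (degree p)) = (\<Sum>d=1..D. \<Sum>p\<in>{p \<in> P. degree p = d}. F (degree p))"
    by (intro sum.group[symmetric]) (auto simp: P_def)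
  also have "\<dots> = (\<Sum>d=1..D. real (card {p \<in> P. degree p = d}) * F d)"
    by (intro sum.cong refl) simp
  also have "\<dots> \<le> (\<Sum>d=1..D. real CARD('a) ^ d * F d)"
  proof (intro sum_mono mult_right_mono assms)
    fix d
    have "card {p \<in> P. degree p = d} \<le> card (monic_polys d :: 'a poly set)"
      by (intro card_mono finite_monic_polys) (auto simp: P_def primes_upto_def monic_polys_def irr_polys_def)
    then show "real (card {p \<in> P. degree p = d}) \<le> real CARD('a) ^ d"
      unfolding card_monic_polys by (metis of_nat_le_iff of_nat_power)
  qed
  finally show ?thesis unfolding P_def .
qed

text \<open>Uniform in the cut-off \<open>D\<close>. Via \<open>1 + y \<le> exp y\<close> the
  product reduces to a sum in which degree \<open>d\<close> contributes at most
  \<open>4 * (\<rho>\<^sup>2 / q) ^ d\<close>: one factor 2 comes from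
  \<open>\<rho> ^ d \<le> \<rho> ^ (2 * d)\<close>, the other from
  \<open>q ^ d - 1 \<ge> q ^ d / 2\<close>.\<close>

lemma corr_poly_bounded:
  fixes \<rho> :: real
  assumes \<rho>: "\<rho> \<ge> 1" "\<rho>\<^sup>2 < real CARD('a)"
  shows "poly (corr_poly 1 TYPE('a :: {field, finite}) D) \<rho> \<le> exp (4 / (1 - \<rho>\<^sup>2 / real CARD('a)))"
proof -
  define q where "q = real CARD('a)"
  have q: "q \<ge> 2" using card_field_ge_2[where ?'a = 'a] by (simp add: q_def)
  define F where "F d = 2 * \<rho> ^ (2 * d) / (q ^ d * (q ^ d - 1))" for d
  define r where "r = \<rho>\<^sup>2 / q"
  have r: "0 \<le> r" "r < 1" using \<rho> q by (auto simp: r_def q_def)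
  have qd: "q ^ d \<ge> 1" for d using q by (intro one_le_power) auto
  have F0: "F d \<ge> 0" for d using qd[of d] \<rho> by (auto simp: F_def)
  have "poly (corr_poly 1 TYPE('a) D) \<rho> = (\<Prod>p\<in>(primes_upto D :: 'a poly set).
      1 + (\<rho> ^ degree p + \<rho> ^ (2 * degree p)) / (q ^ degree p * (q ^ degree p - 1)))"
    unfolding corr_poly_def poly_prod q_def[symmetric]
    by (intro prod.cong refl) (simp add: Let_def poly_monom add_divide_distrib)
  also have "\<dots> \<le> (\<Prod>p\<in>(primes_upto D :: 'a poly set). exp (F (degree p)))"
  proof (intro prod_mono conjI)
    fix p :: "'a poly"
    define d where "d = degree p"
    have "\<rho> ^ d \<le> \<rho> ^ (2 * d)" using \<rho> by (intro power_increasing) auto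
    then have "(\<rho> ^ d + \<rho> ^ (2 * d)) / (q ^ d * (q ^ d - 1)) \<le> F d"
      unfolding F_def using qd[of d] by (intro divide_right_mono) auto
    also have "1 + F d \<le> exp (F d)" by (rule exp_ge_add_one_self)
    finally show "1 + (\<rho> ^ degree p + \<rho> ^ (2 * degree p)) / (q ^ degree p * (q ^ degree p - 1)) \<le> exp (F (degree p))"
      by (simp add: d_def)
    show "0 \<le> 1 + (\<rho> ^ degree p + \<rho> ^ (2 * degree p)) / (q ^ degree p * (q ^ degree p - 1))"
      using qd[of "degree p"] \<rho> by (intro add_nonneg_nonneg divide_nonneg_nonneg) auto
  qed
  also have "\<dots> = exp (\<Sum>p\<in>(primes_upto D :: 'a poly set). F (degree p))"
    by (simp add: exp_sum)
  also have "(\<Sum>p\<in>(primes_upto D :: 'a poly set). F (degree p)) \<le> (\<Sum>d=1..D. q ^ d * F d)"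
    unfolding q_def by (rule sum_primes_upto_le[OF F0])
  also have "\<dots> \<le> (\<Sum>d=1..D. 4 * r ^ d)"
  proof (rule sum_mono)
    fix d assume "d \<in> {1..D}"
    then have "q \<le> q ^ d" using q by (intro self_le_power) auto
    then have "q ^ d \<ge> 2" using q by linarith
    then have *: "q ^ d / 2 \<le> q ^ d - 1" "0 < q ^ d / 2" by auto
    have "q ^ d \<noteq> 0" using \<open>q ^ d \<ge> 2\<close> by linarith
    then have "q ^ d * F d = 2 * \<rho> ^ (2 * d) / (q ^ d - 1)"
      unfolding F_def times_divide_eq_right by (rule mult_divide_mult_cancel_left)
    also have "\<dots> \<le> 2 * \<rho> ^ (2 * d) / (q ^ d / 2)"
      using * \<rho> by (intro divide_left_mono mult_pos_pos) auto
    also have "\<dots> = 4 * r ^ d"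
      by (simp add: r_def power_divide power_mult)
    finally show "q ^ d * F d \<le> 4 * r ^ d" .
  qed
  also have "\<dots> \<le> (\<Sum>d<Suc D. 4 * r ^ d)"
    using r by (intro sum_mono2) auto
  also have "\<dots> \<le> 4 / (1 - r)"
  proof -
    have "(\<Sum>d<Suc D. r ^ d) \<le> 1 / (1 - r)"
      using r by (subst sum_gp_strict) (auto simp: divide_right_mono)
    then show ?thesis by (simp only: sum_distrib_left[symmetric])
  qed
  finally show ?thesis by (simp add: r_def q_def)
qed

lemma rs_sum_tendsto:
  "rs_sum TYPE('a :: {field, finite}) \<longlonglongrightarrow> 1 - 1 / real CARD('a)"
proof -
  define q where "q = real CARD('a)"
  have q: "q \<ge> 2" using card_field_ge_2[where ?'a = 'a] by (simp add: q_def)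
  \<comment> \<open>Any \<open>\<rho> > 1\<close> with \<open>\<rho>\<^sup>2 < q\<close> would
    serve.\<close>
  define \<rho> where "\<rho> = sqrt (sqrt q)"
  have "sqrt q > 1" using q by simp
  then have \<rho>: "\<rho> > 1" "\<rho>\<^sup>2 = sqrt q" by (auto simp: \<rho>_def)
  have \<rho>q: "\<rho>\<^sup>2 < q"
  proof -
    have "\<rho>\<^sup>2 * 1 < sqrt q * sqrt q" unfolding \<rho>(2) using \<open>sqrt q > 1\<close> by (intro mult_strict_left_mono) auto
    then show ?thesis using q by simp
  qed
  define C where "C = exp (4 / (1 - \<rho>\<^sup>2 / q))"
  define s where "s n m = (\<Sum>j\<le>m. coeff (corr_poly (- 1) TYPE('a) n) j)" for n m
  \<comment> \<open>\<open>C\<close> depends neither on \<open>n\<close> nor on \<open>m\<close>.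
    The cut-off \<open>n\<close> grows along with the index of the partial sum, so a constant
    depending on the cut-off would not do.\<close>
  have bound: "\<bar>1 - s n m\<bar> \<le> C / \<rho> ^ m" for n m
  proof -
    have "poly (corr_poly (- 1) TYPE('a) n) 1 = 1"
      unfolding corr_poly_def poly_prod by (intro prod.neutral) (simp add: Let_def poly_monom)
    moreover have "\<bar>poly (corr_poly (- 1) TYPE('a) n) 1 - s n m\<bar> \<le> poly (corr_poly 1 TYPE('a) n) \<rho> / \<rho> ^ m"
      unfolding s_def
    proof (rule coeff_partial_sum_bound)
      fix j
      show "\<bar>coeff (corr_poly (- 1) TYPE('a) n) j\<bar> \<le> coeff (corr_poly 1 TYPE('a) n) j"
        unfolding corr_poly_def
      proof (rule coeff_prod_dominated)
        fix p :: "'a poly" and j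
        have "real CARD('a) ^ degree p \<ge> 1" using q by (intro one_le_power) (auto simp: q_def)
        then have b: "1 / (real CARD('a) ^ degree p * (real CARD('a) ^ degree p - 1)) \<ge> 0"
          by (intro divide_nonneg_nonneg mult_nonneg_nonneg) auto
        have gen: "\<bar>coeff (1 + monom b k + monom (- 1 * b) l) j\<bar> \<le> coeff (1 + monom b k + monom (1 * b) l) j"
          if "b \<ge> 0" for b :: real and k l
          using that by (auto simp: coeff_1)
        show "\<bar>coeff (let b = 1 / (real CARD('a) ^ degree p * (real CARD('a) ^ degree p - 1))
             in 1 + monom b (degree p) + monom (- 1 * b) (2 * degree p)) j\<bar>
          \<le> coeff (let b = 1 / (real CARD('a) ^ degree p * (real CARD('a) ^ degree p - 1))
             in 1 + monom b (degree p) + monom (1 * b) (2 * degree p)) j"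
          unfolding Let_def by (rule gen[OF b])
      qed
    qed (use \<rho> in simp)
    moreover have "poly (corr_poly 1 TYPE('a) n) \<rho> \<le> C"
      unfolding C_def q_def using \<rho> \<rho>q by (intro corr_poly_bounded) (auto simp: q_def)
    then have "poly (corr_poly 1 TYPE('a) n) \<rho> / \<rho> ^ m \<le> C / \<rho> ^ m"
      using \<rho> by (intro divide_right_mono) auto
    ultimately show ?thesis by linarith
  qed
  have lim: "(\<lambda>n. C / \<rho> ^ n) \<longlonglongrightarrow> 0"
    using LIMSEQ_divide_realpow_zero[OF \<rho>(1)] .
  have s_lim: "(\<lambda>n. s (f n) n) \<longlonglongrightarrow> 1" for f
  proof -
    have "(\<lambda>n. 1 - s (f n) n) \<longlonglongrightarrow> 0"
      by (rule Lim_null_comparison[OF _ lim]) (use bound in auto)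
    from tendsto_diff[OF tendsto_const[of 1] this] show ?thesis by simp
  qed
  \<comment> \<open>The shift to \<open>Suc n\<close> turns the index \<open>n - 1\<close> of
    \<open>rs_sum_eq\<close> into \<open>n\<close>.\<close>
  have "(\<lambda>n. s (Suc n) (Suc n) - s (Suc n) n / q) \<longlonglongrightarrow> 1 - 1 / q"
    using q by (intro tendsto_intros LIMSEQ_Suc[OF s_lim[of "\<lambda>n. n"]] s_lim) auto
  moreover have "rs_sum TYPE('a) (Suc n) = s (Suc n) (Suc n) - s (Suc n) n / q" for n
    using rs_sum_eq[of "Suc n", where ?'a = 'a] by (simp add: s_def q_def)
  ultimately have "(\<lambda>n. rs_sum TYPE('a) (Suc n)) \<longlonglongrightarrow> 1 - 1 / q" by simp
  then show ?thesis unfolding q_def by (rule LIMSEQ_imp_Suc)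
qed

section \<open>The limiting probability\<close>

lemma regular_semisimple_mat_iff:
  fixes A :: "'a :: {field, finite} mat"
  assumes A: "A \<in> carrier_mat n n"
  shows "regular_semisimple_mat n A \<longleftrightarrow>
    det A \<noteq> 0 \<and> card {x. poly (map_poly to_ac (char_poly A)) x = 0} = n"
proof -
  have "map_mat to_ac A \<in> GL n \<longleftrightarrow> det A \<noteq> 0"
    using A by (simp add: GL_iff_det to_ac.hom_det)
  then show ?thesis
    unfolding regular_semisimple_mat_def regular_mat_def semisimple_mat_def regular_diagonalizable_iff
      to_ac.char_poly_hom[OF A] by blast
qed

lemma det_eq_0_iff_dvd_char_poly:
  fixes A :: "'a :: field mat"
  assumes A: "A \<in> carrier_mat n n"
  shows "det A = 0 \<longleftrightarrow> [:0, 1:] dvd char_poly A"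
proof -
  have "char_matrix A 0 = A"
    using A by (intro eq_matI) (auto simp: char_matrix_def)
  then have "det A = 0 \<longleftrightarrow> poly (char_poly A) 0 = 0"
    using eigenvalue_det[OF A, of 0] eigenvalue_root_char_poly[OF A, of 0] by simp
  then show ?thesis
    by (simp add: poly_eq_0_iff_dvd)
qed

text \<open>Having \<open>n\<close> distinct roots in the closure amounts to being a product of
  distinct irreducibles, by \<open>card_roots_imp_prod_irr\<close> and
  \<open>card_roots_prod_irr\<close>; excluding \<open>[:0, 1:]\<close> expresses
  invertibility.\<close>

lemma regular_semisimple_eq_UN:
  "{A \<in> GL n. regular_semisimple_mat n A} =
    (\<Union>S\<in>{S. finite S \<and> S \<subseteq> irr_polys - {[:0, 1:]} \<and> (\<Sum>p\<in>S. degree p) = n}.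
      {A \<in> carrier_mat n n. char_poly A = \<Prod>(S :: 'a :: {field, finite} poly set)})"
  (is "?R = (\<Union>S\<in>?I. ?C S)")
proof (intro antisym subsetI)
  fix A :: "'a mat" assume "A \<in> ?R"
  then have A: "A \<in> carrier_mat n n" and det: "det A \<noteq> 0"
    and card: "card {x. poly (map_poly to_ac (char_poly A)) x = 0} = n"
    by (auto simp: GL_iff_det regular_semisimple_mat_iff)
  have cp: "degree (char_poly A) = n" "lead_coeff (char_poly A) = 1"
    using degree_monic_char_poly[OF A] by auto
  obtain S where S: "finite S" "S \<subseteq> irr_polys" "\<Prod>S = char_poly A"
    using card_roots_imp_prod_irr[OF cp(2)] card cp(1) by auto
  have "[:0, 1:] \<notin> S"
  proof
    assume "[:0, 1:] \<in> S"
    then have "[:0, 1:] dvd char_poly A" using S(1,3) dvd_prod_eqI by metis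
    then show False using det det_eq_0_iff_dvd_char_poly[OF A] by blast
  qed
  then have "S \<in> ?I" using S cp(1) degree_prod_irr[OF S(1,2)] by auto
  then show "A \<in> (\<Union>S\<in>?I. ?C S)" using A S(3) by (intro UN_I[of S]) auto
next
  fix A :: "'a mat" assume "A \<in> (\<Union>S\<in>?I. ?C S)"
  then obtain S where S: "finite S" "S \<subseteq> irr_polys - {[:0, 1:]}" "(\<Sum>p\<in>S. degree p) = n"
    and A: "A \<in> carrier_mat n n" and cp: "char_poly A = \<Prod>S" by auto
  from S(2) have S': "S \<subseteq> irr_polys" by blast
  have "\<not> [:0, 1:] dvd \<Prod>S"
    using irr_dvd_prod[OF X_irr S(1) S'] S(2) by blast
  then have "det A \<noteq> 0" using det_eq_0_iff_dvd_char_poly[OF A] cp by simp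
  moreover have "card {x. poly (map_poly to_ac (char_poly A)) x = 0} = n"
    unfolding cp card_roots_prod_irr[OF S(1) S'] degree_prod_irr[OF S(1) S'] by (rule S(3))
  ultimately show "A \<in> ?R"
    using A by (simp add: GL_iff_det regular_semisimple_mat_iff)
qed

lemma prob_regular_semisimple:
  assumes n: "0 < n"
  shows "measure_pmf.prob (pmf_of_set (GL n :: 'a :: {field, finite} mat set)) {A. regular_semisimple_mat n A} =
    rs_sum TYPE('a) n"
proof -
  define I where "I = {S :: 'a poly set. finite S \<and> S \<subseteq> irr_polys - {[:0, 1:]} \<and> (\<Sum>p\<in>S. degree p) = n}"
  define C where "C S = {A \<in> carrier_mat n n. char_poly A = \<Prod>S}" for S :: "'a poly set"
  define g where "g = real (card (GL n :: 'a mat set))"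
  have ne: "(GL n :: 'a mat set) \<noteq> {}" using one_mat_in_GL by blast
  then have g: "g > 0" by (simp add: g_def finite_GL card_gt_0_iff)
  have "I \<subseteq> Pow (primes_upto n)"
    using member_le_sum[of _ _ degree] by (fastforce simp: I_def primes_upto_def)
  then have finI: "finite I" by (rule finite_subset) simp
  have "card {A \<in> GL n. regular_semisimple_mat n (A :: 'a mat)} = card (\<Union>S\<in>I. C S)"
    unfolding regular_semisimple_eq_UN I_def C_def ..
  also have "\<dots> = (\<Sum>S\<in>I. card (C S))"
  proof (rule card_UN_disjoint[OF finI])
    show "\<forall>S\<in>I. finite (C S)"
      by (intro ballI finite_subset[OF _ finite_carrier_mat[of n n]]) (auto simp: C_def)
    show "\<forall>S\<in>I. \<forall>S'\<in>I. S \<noteq> S' \<longrightarrow> C S \<inter> C S' = {}"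
    proof (intro ballI impI)
      fix S S' assume "S \<in> I" "S' \<in> I" "S \<noteq> S'"
      moreover from this have "finite S" "S \<subseteq> irr_polys" "finite S'" "S' \<subseteq> irr_polys"
        by (auto simp: I_def)
      ultimately have "\<Prod>S \<noteq> \<Prod>S'"
        using prod_irr_inject[of S S'] by blast
      then show "C S \<inter> C S' = {}"
        by (auto simp: C_def)
    qed
  qed
  finally have "real (card {A \<in> GL n. regular_semisimple_mat n (A :: 'a mat)}) / g = (\<Sum>S\<in>I. real (card (C S)) / g)"
    by (simp add: sum_divide_distrib)
  also have "\<dots> = (\<Sum>S\<in>I. \<Prod>p\<in>S. 1 / (real CARD('a) ^ degree p - 1))"
  proof (rule sum.cong[OF refl])
    fix S assume "S \<in> I"
    then have S: "finite S" "S \<subseteq> irr_polys" "(\<Sum>p\<in>S. degree p) = n" by (auto simp: I_def)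
    define d where "d = (\<Prod>p\<in>S. real CARD('a) ^ degree p - 1)"
    have "real (card (C S)) * d = g"
      using card_char_poly_eq_prod_irr[OF n S] by (simp add: C_def d_def g_def)
    then have "real (card (C S)) / g = 1 / d"
      using g by (auto simp: field_simps)
    then show "real (card (C S)) / g = (\<Prod>p\<in>S. 1 / (real CARD('a) ^ degree p - 1))"
      by (simp add: d_def prod_dividef)
  qed
  also have "\<dots> = rs_sum TYPE('a) n"
    by (simp add: rs_sum_def I_def)
  finally show ?thesis
    by (simp add: measure_pmf_of_set[OF ne finite_GL] g_def Int_def)
qed

theorem theorem7:
  fixes q :: nat
  assumes "primepow q"
    and "CARD('a :: {field, finite}) = q"
  shows "(\<lambda>n. measure_pmf.prob (pmf_of_set (GL n :: 'a mat set)) {A. regular_semisimple_mat n A})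
           \<longlonglongrightarrow> 1 - 1 / real q"
proof -
  \<comment> \<open>\<open>n = 0\<close> is set aside: the bijection of
    \<open>card_cyclic_pairs\<close> reads \<open>v\<close> off column 0 of the Krylov
    matrix.\<close>
  have "\<forall>\<^sub>F n in sequentially. rs_sum TYPE('a) n =
      measure_pmf.prob (pmf_of_set (GL n :: 'a mat set)) {A. regular_semisimple_mat n A}"
    using eventually_gt_at_top[of 0] by eventually_elim (simp add: prob_regular_semisimple)
  with rs_sum_tendsto[where ?'a = 'a] show ?thesis
    unfolding assms(2) by (rule Lim_transform_eventually)
qed

end
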